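(* All identities below between integral functionals are understood up to formal integration by parts, i.e. as identities of differential polynomials in $W_+,W_-$ modulo total $X$-derivatives. There exist polynomials $\mathbf P_n$, $n\in\{-1,0,1,2,\dots\}$ (with $\mathbf P_{-1}=0$), where for $n\ge 0$ the polynomial $\mathbf P_n$ depends on $\epsilon$, $W_+$, $W_-$ and derivatives $\partial_X^jW_\pm$ of order $j\le\lfloor n/2\rfloor$, such that for all $n\in\mathbb N=\{0,1,2,\dots\}$ and both choices of sign $$\mathcal H^{\epsilon\widetilde{GP}}_{2n}(W)\mp 2\,\mathcal H^{\epsilon\widetilde{GP}}_{2n-1}(W)=(\sqrt2\,\epsilon)^{2n+1}\Big(\mathcal E^{KdV}_{n-1}(\pm W_\pm)+\frac{\epsilon^2}{2}\int_{\mathbb R}\mathbf P_{2n}\mp\mathbf P_{2n-1}\,dX\Big).$$ In particular, for all $n\in\mathbb N$, $$\mathcal H^{\epsilon\widetilde{GP}}_{2n}(W)=\frac{(\sqrt2\,\epsilon)^{2n+1}}{2}\Big(\mathcal E^{KdV}_{n-1}(-W_-)+\mathcal E^{KdV}_{n-1}(W_+)+\epsilon^2\int_{\mathbb R}\mathbf P_{2n}\,dX\Big),$$ $$\mathcal H^{\epsilon\widetilde{GP}}_{2n-1}(W)=\frac{(\sqrt2\,\epsilon)^{2n+1}}{4}\Big(\mathcal E^{KdV}_{n-1}(-W_-)-\mathcal E^{KdV}_{n-1}(W_+)+\epsilon^2\int_{\mathbb R}\mathbf P_{2n-1}\,dX\Big).$$ Furthermore, there are no constant or linear monomials (as polynomials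 in $W_+,W_-$ and their derivatives) in $\mathbf P_n$. Lastly, for all $n\in\mathbb N$ there exist polynomials $\mathbf Q_{2n}$, depending on $\epsilon$, $W_+$, $W_-$ and up to $n-1$ derivatives thereof, such that $$\int_{\mathbb R}\mathbf P_{2n}\,dX=\frac14\int_{\mathbb R}\big(\partial_X^n(W_+-W_-)\big)^2\,dX+\int_{\mathbb R}\mathbf Q_{2n}\,dX .$$
   Context: $W=(W_+,W_-)$ is a pair of real-valued functions of $X\in\mathbb R$ decaying at infinity and $\epsilon>0$ is a parameter. "Polynomial depending on $\epsilon,W_+,W_-$ and derivatives" means a polynomial (nonnegative powers only) in $\epsilon$ and finitely many $\partial_X^jW_\pm$. In formulas with $\pm,\mp$ one takes consistently all upper or all lower signs; in particular $\pm W_\pm$ is $W_+$ or $-W_-$. Hamiltonians $\mathcal H^{\epsilon GP}_n$: Let $y$ be a formal variable (standing for $2ik$) and let $\lambda=\sum_{n\ge-1}c_ny^{-n}$ be the formal Laurent series with $\lambda^2=1-\frac{\epsilon^2}{2}y^2$ and $c_{-1}=-\frac{i\epsilon}{\sqrt2}$; explicitly $c_n=\frac{i}{(\sqrt2\epsilon)^n}\frac1n\binom{n}{(n-1)/2}$ for odd $n\ge1$ and $c_n=0$ for even $n\ge0$. Let $r=\sum_{n\ge0}r_ny^{-n}$ and $\sigma=\sum_{n\ge0}\sigma_ny^{-n}$ be the unique formal power series, with coefficients differential polynomials in $W_\pm$, such that $r_0=1$ and $$\partial_Xr=\frac{i\epsilon}{\sqrt2}\big(\epsilon^{-2}(1+\lambda)+W_+\big)r^2+\frac{i\epsilon}{\sqrt2}\big(\epsilon^{-2}(1-\lambda)-W_-\big),$$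 $$\partial_X\sigma=y\sigma-\sigma^2+\tfrac12\big(-\epsilon^2W_-W_+-(1+\lambda)W_-+(1-\lambda)W_+-i\sqrt2\,\epsilon\,(\partial_XW_+)\,r\big).$$ Then $\mathcal H^{\epsilon GP}_n(W)=-(-i)^n(\sqrt2\,\epsilon)^{n+1}\int_{\mathbb R}\sigma_{n+1}\,dX$ for $n\ge0$, and $\mathcal H^{\epsilon GP}_{-1}(W)=-\frac{\epsilon}{\sqrt2}\int_{\mathbb R}(W_++W_-)\,dX$. Hamiltonians $\mathcal H^{\epsilon\widetilde{GP}}_n$: for $n\ge0$, $\mathcal H^{\epsilon\widetilde{GP}}_{2n}=\mathcal H^{\epsilon GP}_{2n}$ and $$\mathcal H^{\epsilon\widetilde{GP}}_{2n-1}=\sum_{m=0}^n\binom{-1/2}{n-m}4^{n-m}\,2^{-\mathbf 1_{\{m=0\}}}\,\mathcal H^{\epsilon GP}_{2m-1}.$$ KdV energies: define differential polynomials in $U$ by $\sigma^{KdV}_0=0$, $\sigma^{KdV}_1=-U$, $\sigma^{KdV}_{n+1}=\partial_X\sigma^{KdV}_n+\sum_{k=0}^n\sigma^{KdV}_k\sigma^{KdV}_{n-k}$ for $n\ge1$, and $\mathcal E^{KdV}_n(U)=(-1)^n\int_{\mathbb R}\sigma^{KdV}_{2n+3}\,dX$ for $n\ge-1$. Thus $\mathcal E^{KdV}_{-1}=\int U$, $\mathcal E^{KdV}_0=\int U^2$, $\mathcal E^{KdV}_1=\int U_X^2+2U^3$. *)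

theory Defs
  imports Complex_Main "HOL-Library.Poly_Mapping"
    "HOL-Computational_Algebra.Computational_Algebra"
begin

subsection \<open>Differential polynomials in \<open>W\<^sub>+, W\<^sub>-\<close>\<close>

datatype wsign = WPlus | WMinus

text \<open>The pair \<open>(s, j)\<close> stands for the jet variable \<open>\<partial>\<^sub>X\<^sup>j W\<^sub>s\<close>. A differential polynomial is a
  polynomial in these commuting indeterminates; a key of the outer polynomial mapping is a
  monomial, given by its finitely supported exponent function.\<close>

type_synonym jet = "wsign \<times> nat"

type_synonym 'a dpoly = "(jet \<Rightarrow>\<^sub>0 nat) \<Rightarrow>\<^sub>0 'a"

definition cst :: "'a::zero \<Rightarrow> 'a dpoly" where
  "cst c = Poly_Mapping.single 0 c"

definition W :: "wsign \<Rightarrow> nat \<Rightarrow> 'a::zero_neq_one dpoly" where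
  "W s j = Poly_Mapping.single (Poly_Mapping.single (s, j) 1) 1"

abbreviation Wp :: "'a::zero_neq_one dpoly" where "Wp \<equiv> W WPlus 0"
abbreviation Wm :: "'a::zero_neq_one dpoly" where "Wm \<equiv> W WMinus 0"

text \<open>The total derivative \<open>\<partial>\<^sub>X\<close>: on a monomial \<open>m\<close> it is the sum, over the variables \<open>(s, j)\<close> of
  \<open>m\<close>, of the exponent times the monomial in which one factor \<open>(s, j)\<close> is replaced
  by \<open>(s, j + 1)\<close>.\<close>

definition tderiv :: "'a::comm_ring_1 dpoly \<Rightarrow> 'a dpoly" where
  "tderiv p = (\<Sum>m\<in>Poly_Mapping.keys p. \<Sum>v\<in>Poly_Mapping.keys m.
      Poly_Mapping.single
        (m - Poly_Mapping.single v 1 + Poly_Mapping.single (fst v, Suc (snd v)) 1)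
        (of_nat (Poly_Mapping.lookup m v) * Poly_Mapping.lookup p m))"

text \<open>A functional \<open>\<integral> a dX\<close> is represented by its density \<open>a\<close>, and equality of
  functionals is equality of densities modulo total derivatives.\<close>

definition same_integral :: "'a::comm_ring_1 dpoly \<Rightarrow> 'a dpoly \<Rightarrow> bool"
    (infix \<open>\<simeq>\<close> 50) where
  "a \<simeq> b \<longleftrightarrow> (\<exists>c. a - b = tderiv c)"

text \<open>Polynomials in \<open>\<epsilon>\<close> and the jet variables have type \<^typ>\<open>real poly dpoly\<close>, the
  coefficients being polynomials in \<open>\<epsilon>\<close>.\<close>

definition eval_eps :: "real \<Rightarrow> real poly dpoly \<Rightarrow> complex dpoly" where
  "eval_eps \<epsilon> p = Poly_Mapping.map (\<lambda>c. complex_of_real (poly c \<epsilon>)) p"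

text \<open>The bound is an integer so that \<open>order_le p (-1)\<close> says that \<open>p\<close> contains no jet variable.\<close>

definition order_le :: "'a::zero dpoly \<Rightarrow> int \<Rightarrow> bool" where
  "order_le p k \<longleftrightarrow>
     (\<forall>m\<in>Poly_Mapping.keys p. \<forall>v\<in>Poly_Mapping.keys m. int (snd v) \<le> k)"

definition mon_degree :: "(jet \<Rightarrow>\<^sub>0 nat) \<Rightarrow> nat" where
  "mon_degree m = (\<Sum>v\<in>Poly_Mapping.keys m. Poly_Mapping.lookup m v)"


subsection \<open>The series \<open>\<lambda>\<close>, \<open>r\<close> and \<open>\<sigma>\<close>\<close>

text \<open>Series in \<open>y\<^sup>-\<^sup>1\<close> are library series in the indeterminate \<open>X = y\<^sup>-\<^sup>1\<close>, so that
  \<open>y\<close> is \<^const>\<open>fls_X_inv\<close> and the coefficient of \<open>y\<^sup>-\<^sup>n\<close> has index \<open>n\<close>.\<close>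

definition lam :: "real \<Rightarrow> complex fls" where
  "lam \<epsilon> = (THE l. l\<^sup>2 = 1 - fls_const (complex_of_real (\<epsilon>\<^sup>2 / 2)) * fls_X_inv\<^sup>2 \<and>
      (\<forall>n< -1. fls_nth l n = 0) \<and>
      fls_nth l (-1) = - (\<i> * complex_of_real (\<epsilon> / sqrt 2)))"

definition lamW :: "real \<Rightarrow> complex dpoly fls" where
  "lamW \<epsilon> = Abs_fls (\<lambda>n. cst (fls_nth (lam \<epsilon>) n))"

abbreviation scal :: "complex \<Rightarrow> complex dpoly fls" where
  "scal c \<equiv> fls_const (cst c)"

definition series_deriv :: "complex dpoly fps \<Rightarrow> complex dpoly fps" where
  "series_deriv f = Abs_fps (\<lambda>n. tderiv (fps_nth f n))"

definition is_r :: "real \<Rightarrow> complex dpoly fps \<Rightarrow> bool" where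
  "is_r \<epsilon> r \<longleftrightarrow> fps_nth r 0 = 1 \<and>
     fps_to_fls (series_deriv r) =
       scal (\<i> * complex_of_real (\<epsilon> / sqrt 2)) *
         (scal (complex_of_real (1 / \<epsilon>\<^sup>2)) * (1 + lamW \<epsilon>) + fls_const Wp) * (fps_to_fls r)\<^sup>2 +
       scal (\<i> * complex_of_real (\<epsilon> / sqrt 2)) *
         (scal (complex_of_real (1 / \<epsilon>\<^sup>2)) * (1 - lamW \<epsilon>) - fls_const Wm)"

definition r_series :: "real \<Rightarrow> complex dpoly fps" where
  "r_series \<epsilon> = (THE r. is_r \<epsilon> r)"

definition is_sigma :: "real \<Rightarrow> complex dpoly fps \<Rightarrow> bool" where
  "is_sigma \<epsilon> \<sigma> \<longleftrightarrow>
     fps_to_fls (series_deriv \<sigma>) =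
       fls_X_inv * fps_to_fls \<sigma> - (fps_to_fls \<sigma>)\<^sup>2 +
       scal (1 / 2) *
         (- (scal (complex_of_real (\<epsilon>\<^sup>2)) * fls_const Wm * fls_const Wp)
          - (1 + lamW \<epsilon>) * fls_const Wm
          + (1 - lamW \<epsilon>) * fls_const Wp
          - scal (\<i> * complex_of_real (sqrt 2 * \<epsilon>)) *
              fls_const (tderiv Wp) * fps_to_fls (r_series \<epsilon>))"

definition sigma_series :: "real \<Rightarrow> complex dpoly fps" where
  "sigma_series \<epsilon> = (THE \<sigma>. is_sigma \<epsilon> \<sigma>)"


subsection \<open>The functionals, given by their densities\<close>

text \<open>Only indices \<open>\<ge> -1\<close> are meaningful in the following three definitions.\<close>

definition ham_GP :: "real \<Rightarrow> int \<Rightarrow> complex dpoly" where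
  "ham_GP \<epsilon> k =
     (if k = -1 then - (cst (complex_of_real (\<epsilon> / sqrt 2)) * (Wp + Wm))
      else - (cst ((- \<i>) ^ nat k * complex_of_real (sqrt 2 * \<epsilon>) ^ (nat k + 1)) *
               fps_nth (sigma_series \<epsilon>) (nat k + 1)))"

definition ham_GPt :: "real \<Rightarrow> int \<Rightarrow> complex dpoly" where
  "ham_GPt \<epsilon> k =
     (if even k then ham_GP \<epsilon> k
      else let n = nat ((k + 1) div 2) in
        \<Sum>m=0..n. cst (((-1/2) gchoose (n - m)) * 4 ^ (n - m) * (if m = 0 then 1 / 2 else 1)) *
          ham_GP \<epsilon> (2 * int m - 1))"

text \<open>Substituting a differential polynomial for \<open>U\<close> in \<open>\<sigma>\<^sup>K\<^sup>d\<^sup>V\<^sub>n\<close> commutes with \<open>\<partial>\<^sub>X\<close>, so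
  the recursion is run directly at the substituted argument.\<close>

fun sigma_KdV :: "complex dpoly \<Rightarrow> nat \<Rightarrow> complex dpoly" where
  "sigma_KdV U 0 = 0"
| "sigma_KdV U (Suc 0) = - U"
| "sigma_KdV U (Suc (Suc n)) = tderiv (sigma_KdV U (Suc n)) +
     (\<Sum>k=0..Suc n. sigma_KdV U k * sigma_KdV U (Suc n - k))"

definition energy_KdV :: "int \<Rightarrow> complex dpoly \<Rightarrow> complex dpoly" where
  "energy_KdV k U = cst ((-1) powi k) * sigma_KdV U (nat (2 * k + 3))"

end

theory Submission
  imports Defs
begin

text \<open>Put \<open>t = y\<^sup>-\<^sup>1\<close> and \<open>z = t \<lambda>\<close>, so that \<open>z\<^sup>2 = t\<^sup>2 - \<epsilon>\<^sup>2/2\<close>. In terms of \<open>z\<close> all negative powers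
  of \<open>\<epsilon>\<close> disappear: \<open>\<sigma> = al + z be\<close>, where the coefficients of \<open>al\<close> and \<open>be\<close> are differential
  polynomials whose coefficients are polynomials in \<open>\<epsilon>\<close>. The reflection \<open>y \<mapsto> -y\<close> shows that the even
  coefficients of \<open>al\<close> and the odd ones of \<open>z be\<close> are total derivatives. Hence
  \<open>\<H>\<^sub>2\<^sub>n\<close> is \<open>al\<^sub>2\<^sub>n\<^sub>+\<^sub>1\<close> up to a constant, and since the binomial sum defining the modified
  \<open>\<H>\<^sub>2\<^sub>n\<^sub>-\<^sub>1\<close> is a division by \<open>\<lambda>\<close>, the latter is \<open>be\<^sub>2\<^sub>n\<close>. Thus \<open>\<H>\<^sub>2\<^sub>n \<mp> 2 \<H>\<^sub>2\<^sub>n\<^sub>-\<^sub>1\<close> amounts to the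
  odd part of \<open>al + z be\<close> with \<open>\<lambda>\<close> replaced by \<open>\<mp>1\<close>; at \<open>\<epsilon> = 0\<close> this substitution respects the
  equations and turns them into the KdV recursion. The degree of a monomial in \<open>W\<close> is at least the
  power of \<open>\<epsilon>\<close> (plus one for \<open>be\<close>), which together with the scaling weight bounds the number of
  derivatives and hence, after integration by parts, the order. Only the quadratic part of
  \<open>al\<close> of order \<open>\<epsilon>\<^sup>2\<close> reaches order \<open>n\<close>, and it is computed explicitly.\<close>

text \<open>The obstacle is that the coefficients of \<open>lam\<close> carry ever larger negative
  powers of \<epsilon>, so \<epsilon> = 0 cannot be reached coefficientwise in the expansion of
  \<sigma>. The pair \<open>al\<close>, \<open>be\<close> sees z only through z^2, which is
  polynomial in \<epsilon>. At \<epsilon> = 0 this relation is z^2 = t^2; its roots z = t and z =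
  -t, that is \<lambda> = 1 and \<lambda> = -1, give the KdV limits for - \<open>Wm\<close> and
  \<open>Wp\<close>. They are substitutions into the pair, not limits of the actual \<lambda>. For
  this reason the system is studied with z as a free parameter having the prescribed square. The
  Riccati equation for r would bring \<epsilon>^-2 back, so it is traded for a relation linear in r.
  Degree dominates the power of \<epsilon> because every \<epsilon>^2 that reaches \<open>al\<close>
  comes with at least two factors from \<open>Wp\<close>, \<open>Wm\<close> and their
  derivatives.\<close>

lemma dpoly_sum_single: "p = (\<Sum>m\<in>Poly_Mapping.keys p. Poly_Mapping.single m (Poly_Mapping.lookup p m))"
  by (rule poly_mapping_eqI)
    (simp add: lookup_sum lookup_single when_def sum.delta in_keys_iff)

lemma dpoly_induct [case_names single add]:
  fixes p :: "'a::comm_monoid_add dpoly"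
  assumes single: "\<And>m c. P (Poly_Mapping.single m c)"
    and add: "\<And>p q. P p \<Longrightarrow> P q \<Longrightarrow> P (p + q)"
  shows "P p"
proof -
  have "P (\<Sum>m\<in>K. Poly_Mapping.single m (Poly_Mapping.lookup p m))" if "finite K" for K
    using that
  proof (induction K)
    case empty
    show ?case using single[of 0 0] by simp
  qed (simp add: single add)
  then show ?thesis
    by (subst dpoly_sum_single) simp
qed

section \<open>The total derivative is a derivation\<close>

definition raise :: "(jet \<Rightarrow>\<^sub>0 nat) \<Rightarrow> jet \<Rightarrow> (jet \<Rightarrow>\<^sub>0 nat)" where
  "raise m v = m - Poly_Mapping.single v 1 + Poly_Mapping.single (fst v, Suc (snd v)) 1"

definition tderiv_mon :: "(jet \<Rightarrow>\<^sub>0 nat) \<Rightarrow> 'a::comm_ring_1 \<Rightarrow> 'a dpoly" where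
  "tderiv_mon m c = (\<Sum>v\<in>Poly_Mapping.keys m.
      Poly_Mapping.single (raise m v) (of_nat (Poly_Mapping.lookup m v) * c))"

lemma tderiv_altdef: "tderiv p = (\<Sum>m\<in>Poly_Mapping.keys p. tderiv_mon m (Poly_Mapping.lookup p m))"
  by (simp add: tderiv_def tderiv_mon_def raise_def)

lemma tderiv_mon_superset:
  assumes "finite A" "Poly_Mapping.keys m \<subseteq> A"
  shows "tderiv_mon m c = (\<Sum>v\<in>A. Poly_Mapping.single (raise m v) (of_nat (Poly_Mapping.lookup m v) * c))"
  unfolding tderiv_mon_def using assms
  by (intro sum.mono_neutral_left) (auto simp: in_keys_iff)

lemma tderiv_add: "tderiv (p + q) = tderiv p + tderiv q"
  unfolding tderiv_altdef
  by (rule setsum_keys_plus_distrib)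
    (auto simp: tderiv_mon_def distrib_left single_add sum.distrib)

lemma tderiv_single: "tderiv (Poly_Mapping.single m c) = tderiv_mon m c"
  by (simp add: tderiv_altdef tderiv_mon_def)

lemma tderiv_0 [simp]: "tderiv 0 = 0"
  by (simp add: tderiv_def)

lemma tderiv_uminus: "tderiv (- p) = - tderiv p"
  using tderiv_add[of p "- p"] by (simp add: eq_neg_iff_add_eq_0 add.commute)

lemma tderiv_diff: "tderiv (p - q) = tderiv p - tderiv q"
  using tderiv_add[of p "- q"] by (simp add: tderiv_uminus)

lemma tderiv_sum: "tderiv (\<Sum>i\<in>I. f i) = (\<Sum>i\<in>I. tderiv (f i))"
  by (induction I rule: infinite_finite_induct) (auto simp: tderiv_add)

lemma raise_add:
  assumes "Poly_Mapping.lookup m v \<noteq> 0"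
  shows "raise (m + m') v = raise m v + m'"
proof (rule poly_mapping_eqI)
  fix k
  show "Poly_Mapping.lookup (raise (m + m') v) k = Poly_Mapping.lookup (raise m v + m') k"
    using assms by (auto simp: raise_def lookup_add lookup_minus lookup_single when_def)
qed

text \<open>The Leibniz rule holds variable by variable once the sums over the different supports
  are extended to the common finite set \<open>A\<close>.\<close>

lemma tderiv_mon_mult:
  "tderiv_mon (m + m') (c * c') = tderiv_mon m c * Poly_Mapping.single m' c' +
     Poly_Mapping.single m c * tderiv_mon m' c'"
proof -
  define A where "A = Poly_Mapping.keys m \<union> Poly_Mapping.keys m'"
  have "Poly_Mapping.keys (m + m') \<subseteq> A"
    unfolding A_def by (rule keys_add)
  moreover have "finite A" by (simp add: A_def)
  moreover have "Poly_Mapping.single (raise (m + m') v)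
      (of_nat (Poly_Mapping.lookup (m + m') v) * (c * c')) =
      Poly_Mapping.single (raise m v) (of_nat (Poly_Mapping.lookup m v) * c) * Poly_Mapping.single m' c' +
      Poly_Mapping.single m c * Poly_Mapping.single (raise m' v) (of_nat (Poly_Mapping.lookup m' v) * c')"
    for v
  proof -
    \<comment> \<open>If \<open>v\<close> does not occur in \<open>m\<close>, truncated subtraction
      makes \<open>raise m v\<close> a wrong monomial, but its coefficient is then 0.\<close>
    have 1: "Poly_Mapping.single (raise m v) (of_nat (Poly_Mapping.lookup m v) * c) * Poly_Mapping.single m' c'
      = Poly_Mapping.single (raise (m + m') v) (of_nat (Poly_Mapping.lookup m v) * (c * c'))"
      by (cases "Poly_Mapping.lookup m v = 0") (simp_all add: mult_single raise_add mult.assoc)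
    have 2: "Poly_Mapping.single m c * Poly_Mapping.single (raise m' v) (of_nat (Poly_Mapping.lookup m' v) * c')
      = Poly_Mapping.single (raise (m + m') v) (of_nat (Poly_Mapping.lookup m' v) * (c * c'))"
      by (cases "Poly_Mapping.lookup m' v = 0")
        (simp_all add: mult_single raise_add[of m' v m, unfolded add.commute[of m']] mult_ac add.commute)
    show ?thesis
      unfolding 1 2 by (simp add: lookup_add single_add[symmetric] distrib_right)
  qed
  ultimately show ?thesis
    by (simp add: tderiv_mon_superset[of A] A_def[symmetric] sum.distrib sum_distrib_left sum_distrib_right)
      (simp add: A_def sum.distrib tderiv_mon_superset[of A] sum_distrib_left sum_distrib_right)
qed

lemma tderiv_mult: "tderiv (p * q) = tderiv p * q + p * tderiv q"
proof (induction p rule: dpoly_induct)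
  case (single m c)
  show ?case
    by (induction q rule: dpoly_induct)
      (simp_all add: tderiv_single mult_single tderiv_mon_mult tderiv_add algebra_simps)
qed (simp_all add: tderiv_add algebra_simps)

lemma tderiv_cst [simp]: "tderiv (cst c) = 0"
  by (simp add: cst_def tderiv_single tderiv_mon_def)

lemma cst_0 [simp]: "cst 0 = 0" and cst_1 [simp]: "cst 1 = 1"
  by (simp_all add: cst_def)

lemma cst_add: "cst (a + b) = cst a + cst (b::'d::monoid_add)"
  and cst_mult: "cst (x * y) = cst x * cst (y::'a::semiring_0)"
  and cst_diff: "cst (a' - b') = cst a' - cst (b'::'b::ab_group_add)"
  and cst_uminus: "cst (- a') = - cst (a'::'b::ab_group_add)"
  and cst_numeral [simp]: "cst (numeral k) = (numeral k :: 'c::comm_ring_1 dpoly)"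
  by (simp_all add: cst_def single_add mult_single single_diff single_uminus)

lemma cst_sum: "cst (sum f I) = (\<Sum>i\<in>I. cst (f i :: 'a::comm_monoid_add))"
  by (induction I rule: infinite_finite_induct) (simp_all add: cst_add)

lemma lookup_cst_mult [simp]:
  "Poly_Mapping.lookup (cst c * p) m = c * Poly_Mapping.lookup (p::'a::comm_ring_1 dpoly) m"
  by (induction p rule: dpoly_induct)
    (simp_all add: cst_def mult_single lookup_add distrib_left lookup_single when_def)

lemma tderiv_cst_mult: "tderiv (cst c * p) = cst c * tderiv p"
  by (simp add: tderiv_mult)

lemma tderiv_1 [simp]: "tderiv 1 = 0"
  using tderiv_cst[of 1] by simp

lemma tderiv_numeral [simp]: "tderiv (numeral k) = 0"
  using tderiv_cst[of "numeral k"] by (simp only: cst_numeral)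

lemma tderiv_W [simp]: "tderiv (W s j) = W s (Suc j)"
  by (simp add: W_def tderiv_single tderiv_mon_def raise_def)

subsection \<open>Equality modulo total derivatives\<close>

lemma same_integral_refl [simp]: "a \<simeq> a"
  unfolding same_integral_def by (rule exI[of _ 0]) simp

lemma same_integral_sym: "a \<simeq> b \<Longrightarrow> b \<simeq> a"
  unfolding same_integral_def by (metis minus_diff_eq tderiv_uminus)

lemma same_integral_add: "a \<simeq> b \<Longrightarrow> c \<simeq> d \<Longrightarrow> a + c \<simeq> b + d"
  unfolding same_integral_def by (metis add_diff_add tderiv_add)

lemma same_integral_trans [trans]: "a \<simeq> b \<Longrightarrow> b \<simeq> c \<Longrightarrow> a \<simeq> c"
  unfolding same_integral_def by (metis diff_add_cancel add_diff_eq tderiv_add)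

lemma same_integral_cst: "a \<simeq> b \<Longrightarrow> cst c * a \<simeq> cst c * b"
  unfolding same_integral_def by (metis right_diff_distrib tderiv_cst_mult)

lemma same_integral_uminus: "a \<simeq> b \<Longrightarrow> - a \<simeq> - b"
  unfolding same_integral_def by (metis minus_diff_minus tderiv_uminus)

lemma same_integral_diff: "a \<simeq> b \<Longrightarrow> c \<simeq> d \<Longrightarrow> a - c \<simeq> b - d"
  using same_integral_add[OF _ same_integral_uminus] by fastforce

lemma same_integral_sum: "(\<And>i. i \<in> I \<Longrightarrow> f i \<simeq> g i) \<Longrightarrow> sum f I \<simeq> sum g I"
  by (induction I rule: infinite_finite_induct) (auto intro: same_integral_add)

lemma same_integral_tderiv: "tderiv c \<simeq> 0"
  unfolding same_integral_def by auto

lemma same_integral_by_parts: "tderiv a * b \<simeq> - (a * tderiv b)"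
  unfolding same_integral_def by (rule exI[of _ "a * b"]) (simp add: tderiv_mult)

section \<open>Power series with differential polynomials as coefficients\<close>

definition fps_tderiv :: "'a::comm_ring_1 dpoly fps \<Rightarrow> 'a dpoly fps" where
  "fps_tderiv f = Abs_fps (\<lambda>n. tderiv (fps_nth f n))"

lemma fps_tderiv_nth [simp]: "fps_nth (fps_tderiv f) n = tderiv (fps_nth f n)"
  by (simp add: fps_tderiv_def)

lemma series_deriv_eq: "series_deriv = fps_tderiv"
  by (rule ext) (simp add: series_deriv_def fps_tderiv_def)

lemma fps_tderiv_add: "fps_tderiv (f + g) = fps_tderiv f + fps_tderiv g"
  and fps_tderiv_diff: "fps_tderiv (f - g) = fps_tderiv f - fps_tderiv g"
  and fps_tderiv_uminus: "fps_tderiv (- f) = - fps_tderiv f"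
  by (rule fps_ext, simp add: tderiv_add tderiv_diff tderiv_uminus)+

lemma fps_tderiv_mult: "fps_tderiv (f * g) = fps_tderiv f * g + f * fps_tderiv g"
  by (rule fps_ext) (simp add: fps_mult_nth tderiv_sum tderiv_mult sum.distrib)

lemma fps_tderiv_const [simp]: "fps_tderiv (fps_const c) = fps_const (tderiv c)"
  by (rule fps_ext) simp

lemma fps_tderiv_1 [simp]: "fps_tderiv 1 = 0"
  and fps_tderiv_X [simp]: "fps_tderiv fps_X = 0"
  by (rule fps_ext, simp add: fps_X_def)+

lemma fps_tderiv_numeral [simp]: "fps_tderiv (numeral k) = 0"
  by (simp add: numeral_fps_const)

lemmas fps_tderiv_simps = fps_tderiv_add fps_tderiv_diff fps_tderiv_uminus fps_tderiv_mult

lemma fps_X_mult_cancel: "fps_X * f = fps_X * g \<longleftrightarrow> f = (g::'a::comm_ring_1 fps)"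
proof
  assume *: "fps_X * f = fps_X * g"
  show "f = g"
  proof (rule fps_ext)
    fix n
    have "fps_nth (fps_X * f) (Suc n) = fps_nth (fps_X * g) (Suc n)" by (simp only: *)
    then show "fps_nth f n = fps_nth g n" by simp
  qed
qed simp

text \<open>Because of the factor X, coefficient n of the right side involves only coefficients of
  \<open>d\<close> below n; by induction the left side reduces to f_0 d_n with f_0 invertible.
  Applied to the difference of two solutions, this gives uniqueness for all Riccati equations below;
  \<open>k = 0\<close> gives cancellation of units.\<close>

lemma fps_linear_eq_zero:
  fixes d f k :: "'a::comm_ring_1 dpoly fps"
  assumes inv: "fps_nth f 0 * w = 1" and eq: "f * d = fps_X * (k * fps_tderiv d)"
  shows "d = 0"
proof -
  have "fps_nth d n = 0" for n
  proof (induction n rule: less_induct)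
    case (less n)
    have *: "(\<Sum>i\<in>{0..n}. fps_nth f i * fps_nth d (n - i)) = fps_nth f 0 * fps_nth d n"
      by (subst sum.atLeast_Suc_atMost) (auto intro!: sum.neutral simp: less.IH)
    have "fps_nth (fps_X * (k * fps_tderiv d)) n = 0"
      by (cases n) (auto simp: fps_mult_nth less.IH intro!: sum.neutral)
    then have "fps_nth f 0 * fps_nth d n = 0"
      by (simp only: eq[symmetric] fps_mult_nth[of f d] *)
    moreover have "fps_nth d n = fps_nth f 0 * w * fps_nth d n"
      by (simp only: inv mult_1_left)
    ultimately show ?case
      by (simp only: mult.assoc[of _ w] mult.left_commute[of _ w] mult_zero_right)
  qed
  then show ?thesis by (intro fps_ext) simp
qed

lemma fps_unit_cancel:
  fixes d f :: "'a::comm_ring_1 dpoly fps"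
  assumes "fps_nth f 0 * w = 1" and "f * d = 0"
  shows "d = 0"
  using fps_linear_eq_zero[of f w d 0] assms by simp

lemma tderiv_of_nat_mult: "tderiv (of_nat n * p) = of_nat n * tderiv p"
proof -
  have "(of_nat n :: 'a dpoly) = cst (of_nat n)" by (simp add: cst_def)
  then show ?thesis by (simp only: tderiv_cst_mult)
qed

lemma fps_unit_inverse:
  fixes f :: "'a::comm_ring_1 fps"
  assumes "fps_nth f 0 = 1"
  obtains g where "f * g = 1"
  using fps_right_inverse[of f 1] assms by simp

text \<open>If \<open>g\<close> is the logarithmic \<open>X\<close>-derivative of \<open>f\<close> and \<open>l\<close> its logarithmic Euler derivative in
  the series variable, then the Euler derivative of \<open>g\<close> is \<open>\<partial>\<^sub>X l\<close>; so coefficient \<open>n\<close> of \<open>g\<close> is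
  \<open>\<partial>\<^sub>X (l\<^sub>n / n)\<close>.\<close>

lemma log_derivative_same_integral_0:
  fixes f g :: "complex dpoly fps"
  assumes f0: "fps_nth f 0 = 1" and eq: "f * g = fps_tderiv f"
  shows "fps_nth g n \<simeq> 0"
proof -
  define th :: "complex dpoly fps \<Rightarrow> complex dpoly fps" where "th = (\<lambda>h. fps_X * fps_deriv h)"
  have th_mult: "th (a * b) = th a * b + a * th b" for a b
    by (simp add: th_def algebra_simps)
  have th_nth: "fps_nth (th a) k = of_nat k * fps_nth a k" for a k
    by (cases k) (simp_all add: th_def)
  have comm: "fps_tderiv (th a) = th (fps_tderiv a)" for a
    by (rule fps_ext) (simp only: fps_tderiv_nth th_nth tderiv_of_nat_mult)
  obtain h where h: "f * h = 1" using f0 fps_unit_inverse by blast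
  define l where "l = h * th f"
  have fl: "f * l = th f" using h by (simp add: l_def mult.assoc[symmetric])
  have "th f * g + f * th g = fps_tderiv f * l + f * fps_tderiv l"
    using arg_cong[OF eq, of th] arg_cong[OF fl, of fps_tderiv]
    by (simp add: th_mult fps_tderiv_mult comm)
  then have "f * (th g - fps_tderiv l) = fps_tderiv f * l - th f * g"
    by (simp add: algebra_simps)
  also have "\<dots> = (f * g) * l - (f * l) * g" by (simp only: eq fl)
  finally have "f * (th g - fps_tderiv l) = 0" by (simp add: algebra_simps)
  from fps_unit_cancel[OF _ this, of 1] f0 have thg: "th g = fps_tderiv l" by simp
  have n: "of_nat n * fps_nth g n = tderiv (fps_nth l n)"
    using arg_cong[OF thg, of "\<lambda>x. fps_nth x n"] by (simp add: th_nth)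
  show ?thesis
  proof (cases n)
    case 0
    have "fps_nth (f * g) 0 = fps_nth (fps_tderiv f) 0" by (simp only: eq)
    then have "fps_nth g 0 = 0" using f0 by simp
    then show ?thesis using 0 by simp
  next
    case (Suc k)
    have "(of_nat n :: complex dpoly) = cst (of_nat n)" by (simp add: cst_def)
    then have "fps_nth g n = cst (1 / of_nat n) * (of_nat n * fps_nth g n)"
      using Suc by (simp add: mult.assoc[symmetric] cst_mult[symmetric] del: of_nat_Suc)
    also have "\<dots> = tderiv (cst (1 / of_nat n) * fps_nth l n)"
      by (simp only: n tderiv_cst_mult)
    finally show ?thesis by (simp only: same_integral_tderiv)
  qed
qed

subsection \<open>Coefficientwise maps\<close>

text \<open>Kept apart from \<open>coeff_hom\<close> because \<open>poly_shift 2\<close>, the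
  division by \<epsilon>^2 used later, is additive but not multiplicative. Additivity already gives
  commutation with \<open>tderiv\<close>, whose scalars are natural numbers.\<close>

locale coeff_additive =
  fixes \<phi> :: "'a::comm_ring_1 \<Rightarrow> 'b::comm_ring_1"
  assumes add: "\<phi> (a + b) = \<phi> a + \<phi> b"
begin

lemma zero [simp]: "\<phi> 0 = 0"
  using add[of 0 0] by simp

lemma of_nat_mult: "\<phi> (of_nat n * a) = of_nat n * \<phi> a"
  by (induction n) (simp_all add: add algebra_simps)

lemma uminus: "\<phi> (- a) = - \<phi> a"
  using add[of a "- a"] by (simp add: eq_neg_iff_add_eq_0 add.commute)

abbreviation dmap :: "'a dpoly \<Rightarrow> 'b dpoly" where "dmap \<equiv> Poly_Mapping.map \<phi>"

lemma lookup_dmap [simp]: "Poly_Mapping.lookup (dmap p) m = \<phi> (Poly_Mapping.lookup p m)"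
  by (simp add: map.rep_eq when_def)

lemma dmap_add: "dmap (p + q) = dmap p + dmap q"
  by (rule poly_mapping_eqI) (simp add: lookup_add add)

lemma dmap_uminus: "dmap (- p) = - dmap p"
  by (rule poly_mapping_eqI) (simp add: uminus)

lemma dmap_diff: "dmap (p - q) = dmap p - dmap q"
  using dmap_add[of p "- q"] by (simp add: dmap_uminus)

lemma dmap_0 [simp]: "dmap 0 = 0"
  by (rule poly_mapping_eqI) simp

lemma dmap_sum: "dmap (sum f I) = (\<Sum>i\<in>I. dmap (f i))"
  by (induction I rule: infinite_finite_induct) (simp_all add: dmap_add)

lemma dmap_single [simp]: "dmap (Poly_Mapping.single m c) = Poly_Mapping.single m (\<phi> c)"
  by (rule poly_mapping_eqI) (simp add: lookup_single when_def)

lemma dmap_cst [simp]: "dmap (cst c) = cst (\<phi> c)"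
  by (simp add: cst_def)

lemma dmap_tderiv: "dmap (tderiv p) = tderiv (dmap p)"
proof (induction p rule: dpoly_induct)
  case (single m c)
  show ?case by (simp add: tderiv_single tderiv_mon_def dmap_sum of_nat_mult)
qed (simp add: tderiv_add dmap_add)

lemma dmap_same_integral: "p \<simeq> q \<Longrightarrow> dmap p \<simeq> dmap q"
  unfolding same_integral_def by (metis dmap_diff dmap_tderiv)

end

locale coeff_hom = coeff_additive +
  assumes one [simp]: "\<phi> 1 = 1" and mult: "\<phi> (a * b) = \<phi> a * \<phi> b"
begin

lemma dmap_mult: "dmap (p * q) = dmap p * dmap q"
proof (induction p rule: dpoly_induct)
  case (single m c)
  show ?case
    by (induction q rule: dpoly_induct) (simp_all add: mult_single mult dmap_add algebra_simps)
qed (simp add: dmap_add algebra_simps)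

lemma dmap_1 [simp]: "dmap 1 = 1"
  using dmap_single[of 0 1] by simp

lemma dmap_W [simp]: "dmap (W s j) = W s j"
  by (simp add: W_def)

definition fmap :: "'a dpoly fps \<Rightarrow> 'b dpoly fps" where
  "fmap f = Abs_fps (\<lambda>n. dmap (fps_nth f n))"

lemma fmap_nth [simp]: "fps_nth (fmap f) n = dmap (fps_nth f n)"
  by (simp add: fmap_def)

lemma fmap_add: "fmap (f + g) = fmap f + fmap g"
  and fmap_diff: "fmap (f - g) = fmap f - fmap g"
  and fmap_uminus: "fmap (- f) = - fmap f"
  by (rule fps_ext, simp add: dmap_add dmap_diff dmap_uminus)+

lemma fmap_mult: "fmap (f * g) = fmap f * fmap g"
  by (rule fps_ext) (simp add: fps_mult_nth dmap_sum dmap_mult)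

lemma fmap_power: "fmap (f ^ n) = fmap f ^ n"
  by (induction n) (simp_all add: fmap_mult, rule fps_ext, simp)

lemma fmap_tderiv: "fmap (fps_tderiv f) = fps_tderiv (fmap f)"
  by (rule fps_ext) (simp add: dmap_tderiv)

lemma fmap_const [simp]: "fmap (fps_const c) = fps_const (dmap c)"
  by (rule fps_ext) simp

lemma fmap_1 [simp]: "fmap 1 = 1"
  and fmap_X [simp]: "fmap fps_X = fps_X"
  by (rule fps_ext, simp add: fps_X_def)+

lemma fmap_numeral [simp]: "fmap (numeral k) = numeral k"
  by (induction k) (simp_all only: numeral.simps fmap_add fmap_1)

lemmas fmap_simps = fmap_add fmap_diff fmap_uminus fmap_mult fmap_power fmap_tderiv

end

lemma eval_eps_hom: "coeff_hom (\<lambda>c. complex_of_real (poly c \<epsilon>))"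
  by unfold_locales simp_all

interpretation eval_eps: coeff_hom "\<lambda>c. complex_of_real (poly c \<epsilon>)"
  rewrites "Poly_Mapping.map (\<lambda>c. complex_of_real (poly c \<epsilon>)) = eval_eps \<epsilon>"
  for \<epsilon>
  by (rule eval_eps_hom) (simp add: fun_eq_iff eval_eps_def)

section \<open>Existence of the formal solution\<close>

lemma causal_fixpoint:
  fixes \<Theta> :: "(nat \<Rightarrow> 'b) \<Rightarrow> nat \<Rightarrow> 'b"
  assumes "\<And>x y n. (\<And>k. k < n \<Longrightarrow> x k = y k) \<Longrightarrow> \<Theta> x n = \<Theta> y n"
  obtains x where "\<Theta> x = x"
proof
  have "adm_wf less_than \<Theta>"
    unfolding adm_wf_def by (intro allI impI assms) simp
  then show "\<Theta> (wfrec less_than \<Theta>) = wfrec less_than \<Theta>"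
    by (simp add: wfrec_fixpoint[OF wf_less_than, symmetric])
qed

text \<open>Congruence modulo X^n. Only multiplication by X gains a step
  (\<open>agree_X\<close>).\<close>

definition agree :: "nat \<Rightarrow> 'a::comm_ring_1 fps \<Rightarrow> 'a fps \<Rightarrow> bool" where
  "agree n f g \<longleftrightarrow> (\<forall>k<n. fps_nth f k = fps_nth g k)"

lemma agree_refl: "agree n f f"
  and agree_add: "agree n f g \<Longrightarrow> agree n f' g' \<Longrightarrow> agree n (f + f') (g + g')"
  and agree_diff: "agree n f g \<Longrightarrow> agree n f' g' \<Longrightarrow> agree n (f - f') (g - g')"
  and agree_uminus: "agree n f g \<Longrightarrow> agree n (- f) (- g)"
  by (simp_all add: agree_def)

lemma agree_mult:
  assumes "agree n f g" "agree n f' g'"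
  shows "agree n (f * f') (g * g')"
  unfolding agree_def
proof (intro allI impI)
  fix k assume k: "k < n"
  have "fps_nth f i * fps_nth f' (k - i) = fps_nth g i * fps_nth g' (k - i)" if "i \<in> {0..k}" for i
  proof -
    have "i < n" "k - i < n" using that k by auto
    then show ?thesis using assms by (simp add: agree_def)
  qed
  then show "fps_nth (f * f') k = fps_nth (g * g') k"
    unfolding fps_mult_nth by (rule sum.cong[OF refl])
qed

lemma agree_tderiv: "agree n f g \<Longrightarrow> agree n (fps_tderiv f) (fps_tderiv g)"
  by (simp add: agree_def)

lemma agree_X: "agree n f g \<Longrightarrow> agree (Suc n) (fps_X * f) (fps_X * g)"
  unfolding agree_def
proof (intro allI impI)
  fix k assume "\<forall>k<n. fps_nth f k = fps_nth g k" "k < Suc n"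
  then show "fps_nth (fps_X * f) k = fps_nth (fps_X * g) k" by (cases k) simp_all
qed

lemmas agree_intros =
  agree_refl agree_add agree_diff agree_uminus agree_mult agree_tderiv agree_X

abbreviation fWp :: "'a::comm_ring_1 dpoly fps" where "fWp \<equiv> fps_const Wp"
abbreviation fWm :: "'a::comm_ring_1 dpoly fps" where "fWm \<equiv> fps_const Wm"
abbreviation fWp' :: "'a::comm_ring_1 dpoly fps" where "fWp' \<equiv> fps_const (W WPlus 1)"
abbreviation fcst :: "'a::comm_ring_1 \<Rightarrow> 'a dpoly fps" where "fcst c \<equiv> fps_const (cst c)"

abbreviation eps2 :: "real poly dpoly fps" where "eps2 \<equiv> fcst [:0, 0, 1:]"
abbreviation half :: "real poly dpoly fps" where "half \<equiv> fcst [:1/2:]"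

text \<open>With \<open>t = y\<^sup>-\<^sup>1\<close> the element \<open>z = t \<lambda>\<close> satisfies \<open>z\<^sup>2 = t\<^sup>2 - \<epsilon>\<^sup>2/2\<close>, and the equations for
  \<open>\<sigma> = al + z be\<close> and \<open>\<rho> = i \<epsilon> r / \<surd>2 = ga + z de\<close> have coefficients polynomial in \<open>\<epsilon>\<close>.\<close>

locale formal_solution =
  fixes al be ga de :: "real poly dpoly fps"
  assumes al: "al = fps_X * (fps_tderiv al + al * al + (fps_X * fps_X - half * eps2) * (be * be) + fWp' * ga)
      + half * (eps2 * fps_X * fWm * fWp - fps_X * (fWp - fWm))"
    and be: "be = fps_X * (fps_tderiv be + 2 * (al * be) + fWp' * de) + half * (fWp + fWm)"
    and ga: "ga = fps_X * (1 - fps_X * (2 * (al + fWp * ga)))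
      + (fps_X * fps_X - half * eps2) * (fps_X * (2 * (be + fWp * de)))"
    and de: "de = - (fps_X * (fps_X * (2 * (be + fWp * de)))) - (1 - fps_X * (2 * (al + fWp * ga)))"

text \<open>On the right of the four equations every unknown stands under a factor X, so the right
  sides modulo X^(n+1) are determined by the unknowns modulo X^n.\<close>

lemma formal_solution_exists: "\<exists>al be ga de. formal_solution al be ga de"
proof -
  define A where "A = (\<lambda>(al :: real poly dpoly fps) (be :: real poly dpoly fps)
    (ga :: real poly dpoly fps) (de :: real poly dpoly fps).
    fps_X * (fps_tderiv al + al * al + (fps_X * fps_X - half * eps2) * (be * be) + fWp' * ga)
      + half * (eps2 * fps_X * fWm * fWp - fps_X * (fWp - fWm)))"
  define B where "B = (\<lambda>(al :: real poly dpoly fps) (be :: real poly dpoly fps)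
    (ga :: real poly dpoly fps) (de :: real poly dpoly fps).
    fps_X * (fps_tderiv be + 2 * (al * be) + fWp' * de) + half * (fWp + fWm))"
  define C where "C = (\<lambda>(al :: real poly dpoly fps) (be :: real poly dpoly fps)
    (ga :: real poly dpoly fps) (de :: real poly dpoly fps).
    fps_X * (1 - fps_X * (2 * (al + fWp * ga)))
      + (fps_X * fps_X - half * eps2) * (fps_X * (2 * (be + fWp * de))))"
  define D where "D = (\<lambda>(al :: real poly dpoly fps) (be :: real poly dpoly fps)
    (ga :: real poly dpoly fps) (de :: real poly dpoly fps).
    - (fps_X * (fps_X * (2 * (be + fWp * de)))) - (1 - fps_X * (2 * (al + fWp * ga))))"
  \<comment> \<open>The four series are packed into one sequence: entry n is the function sending j
    to coefficient n of series j. In \<open>T\<close> every j above 2 repeats the equation of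
    \<open>de\<close>; only j = 3 is read.\<close>
  define pr where "pr = (\<lambda>(j::nat) (x :: nat \<Rightarrow> nat \<Rightarrow> real poly dpoly). Abs_fps (\<lambda>n. x n j))"
  define T where "T = (\<lambda>x n (j::nat).
     fps_nth ((if j = 0 then A else if j = 1 then B else if j = 2 then C else D)
       (pr 0 x) (pr 1 x) (pr 2 x) (pr 3 x)) n)"
  have step: "agree (Suc n) (F a b c d) (F a' b' c' d')"
    if "agree n a a'" "agree n b b'" "agree n c c'" "agree n d d'" "F \<in> {A, B, C, D}"
    for F n a b c d a' b' c' d'
    using that(5)
    by (auto simp: A_def B_def C_def D_def intro!: agree_intros that(1-4))
  have "T x n = T y n" if "\<And>k. k < n \<Longrightarrow> x k = y k" for x y n
  proof -
    have "agree n (pr j x) (pr j y)" for j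
      using that by (simp add: agree_def pr_def)
    then have "agree (Suc n) (F (pr 0 x) (pr 1 x) (pr 2 x) (pr 3 x)) (F (pr 0 y) (pr 1 y) (pr 2 y) (pr 3 y))"
      if "F \<in> {A, B, C, D}" for F
      using step that by blast
    then show ?thesis
      by (auto simp: T_def agree_def fun_eq_iff)
  qed
  then obtain x where x: "T x = x" by (rule causal_fixpoint[of T])
  have nth: "pr j x = Abs_fps (\<lambda>n. T x n j)" for j
    by (simp only: pr_def x)
  have "pr 0 x = A (pr 0 x) (pr 1 x) (pr 2 x) (pr 3 x)" "pr 1 x = B (pr 0 x) (pr 1 x) (pr 2 x) (pr 3 x)"
    "pr 2 x = C (pr 0 x) (pr 1 x) (pr 2 x) (pr 3 x)" "pr 3 x = D (pr 0 x) (pr 1 x) (pr 2 x) (pr 3 x)"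
    by (subst nth, rule fps_ext, simp add: T_def)+
  then have "formal_solution (pr 0 x) (pr 1 x) (pr 2 x) (pr 3 x)"
    unfolding formal_solution_def A_def B_def C_def D_def by blast
  then show ?thesis by blast
qed

text \<open>The second equation comes from \<sigma> = y/2 - A \<rho> with A = \<epsilon>^-2 (1 +
  \<lambda>) + \<open>Wp\<close>: multiplied by t - z, its factor \<epsilon>^-2 disappears since (t
  + z)(t - z) = \<epsilon>^2/2. The parameter \<open>z\<close> will be the series of t \<lambda>,
  its negative, and t or -t at \<epsilon> = 0.\<close>

definition gp_system :: "real \<Rightarrow> complex dpoly fps \<Rightarrow> complex dpoly fps \<Rightarrow> complex dpoly fps \<Rightarrow> bool" where
  "gp_system \<epsilon> z \<sigma> \<rho> \<longleftrightarrow>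
     2 * \<sigma> = 2 * (fps_X * (fps_tderiv \<sigma> + \<sigma> * \<sigma> + fWp' * \<rho>))
       + fcst (complex_of_real (\<epsilon>\<^sup>2)) * fps_X * fWm * fWp + (fps_X + z) * fWm - (fps_X - z) * fWp \<and>
     \<rho> = (fps_X - z) * (1 - 2 * (fps_X * (\<sigma> + fWp * \<rho>)))"

context formal_solution
begin

definition sig :: "real \<Rightarrow> complex dpoly fps \<Rightarrow> complex dpoly fps" where
  "sig \<epsilon> z = eval_eps.fmap \<epsilon> al + z * eval_eps.fmap \<epsilon> be"

definition rho :: "real \<Rightarrow> complex dpoly fps \<Rightarrow> complex dpoly fps" where
  "rho \<epsilon> z = eval_eps.fmap \<epsilon> ga + z * eval_eps.fmap \<epsilon> de"

text \<open>The equations for \<open>al\<close>, \<open>be\<close>, \<open>ga\<close>,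
  \<open>de\<close> are the z-free and z-linear parts of the system after reduction by the value of
  z^2. Recombining them therefore works for every X-independent root of that relation.\<close>

lemma gp_system_sig:
  assumes z: "z * z = fps_X * fps_X - fcst (complex_of_real (\<epsilon>\<^sup>2 / 2))" and zd: "fps_tderiv z = 0"
  shows "gp_system \<epsilon> z (sig \<epsilon> z) (rho \<epsilon> z)"
proof -
  define a b c d where "a = eval_eps.fmap \<epsilon> al" and "b = eval_eps.fmap \<epsilon> be"
    and "c = eval_eps.fmap \<epsilon> ga" and "d = eval_eps.fmap \<epsilon> de"
  define h e where "h = fcst (complex_of_real (poly [:1/2:] \<epsilon>))"
    and "e = fcst (complex_of_real (poly [:0, 0, 1:] \<epsilon>))"
  define P M P' :: "complex dpoly fps" where "P = fWp" and "M = fWm" and "P' = fWp'"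
  have h: "2 * h = 1"
    by (simp add: h_def numeral_fps_const flip: cst_numeral cst_mult)
  have e: "e = fcst (complex_of_real (\<epsilon>\<^sup>2))"
    by (simp add: e_def power2_eq_square)
  have "h * e = fcst (complex_of_real (\<epsilon>\<^sup>2 / 2))"
    by (simp add: h_def e_def power2_eq_square flip: cst_mult)
  note z' = z[folded this]
  note map_simps = eval_eps.fmap_simps eval_eps.fmap_const eval_eps.dmap_cst eval_eps.dmap_W
    eval_eps.fmap_X eval_eps.fmap_1 eval_eps.fmap_numeral
  have a: "a = fps_X * (fps_tderiv a + a * a + (fps_X * fps_X - h * e) * (b * b) + P' * c)
      + h * (e * fps_X * M * P - fps_X * (P - M))"
    using arg_cong[OF al, of "eval_eps.fmap \<epsilon>"]
    by (simp only: map_simps a_def b_def c_def h_def e_def P_def M_def P'_def)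
  have b: "b = fps_X * (fps_tderiv b + 2 * (a * b) + P' * d) + h * (P + M)"
    using arg_cong[OF be, of "eval_eps.fmap \<epsilon>"]
    by (simp only: map_simps a_def b_def d_def h_def e_def P_def M_def P'_def)
  have c: "c = fps_X * (1 - fps_X * (2 * (a + P * c)))
      + (fps_X * fps_X - h * e) * (fps_X * (2 * (b + P * d)))"
    using arg_cong[OF ga, of "eval_eps.fmap \<epsilon>"]
    by (simp only: map_simps a_def b_def c_def d_def h_def e_def P_def)
  have d: "d = - (fps_X * (fps_X * (2 * (b + P * d)))) - (1 - fps_X * (2 * (a + P * c)))"
    using arg_cong[OF de, of "eval_eps.fmap \<epsilon>"]
    by (simp only: map_simps a_def b_def c_def d_def h_def e_def P_def)
  have half: "2 * (x + h * y) = 2 * x + y" for x y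
    by (simp only: distrib_left mult.assoc[symmetric] h mult_1_left)
  have a2: "2 * a = 2 * (fps_X * (fps_tderiv a + a * a + (z * z) * (b * b) + P' * c))
      + (e * fps_X * M * P - fps_X * (P - M))"
    by (subst a) (simp only: z' half)
  have b2: "2 * b = 2 * (fps_X * (fps_tderiv b + 2 * (a * b) + P' * d)) + (P + M)"
    by (subst b) (simp only: half)
  have "2 * (a + z * b) = 2 * a + z * (2 * b)"
    by (simp only: distrib_left mult.left_commute[of 2 z])
  also have "\<dots> = 2 * (fps_X * (fps_tderiv (a + z * b) + (a + z * b) * (a + z * b) + P' * (c + z * d)))
       + e * fps_X * M * P + (fps_X + z) * M - (fps_X - z) * P"
    unfolding a2 b2 by (simp add: fps_tderiv_add fps_tderiv_mult zd algebra_simps)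
  finally have 1: "2 * (a + z * b) = \<dots>" .
  have "c + z * d = fps_X * (1 - fps_X * (2 * (a + P * c)))
      + (z * z) * (fps_X * (2 * (b + P * d)))
      + z * (- (fps_X * (fps_X * (2 * (b + P * d)))) - (1 - fps_X * (2 * (a + P * c))))"
    using c d by (simp only: z')
  also have "\<dots> = (fps_X - z) * (1 - 2 * (fps_X * ((a + z * b) + P * (c + z * d))))"
    by (simp add: algebra_simps)
  finally show ?thesis
    using 1 unfolding gp_system_def sig_def rho_def
    by (simp only: a_def b_def c_def d_def e P_def M_def P'_def)
qed

end

subsection \<open>Parity in \<open>y\<close>\<close>

definition reflect :: "'a::comm_ring_1 fps \<Rightarrow> 'a fps" where
  "reflect f = Abs_fps (\<lambda>n. (-1) ^ n * fps_nth f n)"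

lemma reflect_nth [simp]: "fps_nth (reflect f) n = (-1) ^ n * fps_nth f n"
  by (simp add: reflect_def)

lemma reflect_add: "reflect (f + g) = reflect f + reflect g"
  and reflect_diff: "reflect (f - g) = reflect f - reflect g"
  and reflect_uminus: "reflect (- f) = - reflect f"
  by (rule fps_ext, simp add: algebra_simps)+

lemma reflect_mult: "reflect (f * g) = reflect f * reflect g"
proof (rule fps_ext)
  fix n
  have "(-1) ^ n * (fps_nth f i * fps_nth g (n - i)) =
      (-1) ^ i * fps_nth f i * ((-1) ^ (n - i) * fps_nth g (n - i))" if "i \<le> n" for i
    using power_add[of "-1 :: 'a" i "n - i"] that by (simp add: mult_ac)
  then show "fps_nth (reflect (f * g)) n = fps_nth (reflect f * reflect g) n"
    by (simp add: fps_mult_nth sum_distrib_left)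
qed

lemma reflect_const [simp]: "reflect (fps_const c) = fps_const c"
  and reflect_X [simp]: "reflect fps_X = - fps_X"
  by (rule fps_ext, simp add: fps_X_def)+

lemma reflect_1 [simp]: "reflect 1 = 1"
  and reflect_numeral [simp]: "reflect (numeral k) = numeral k"
  using reflect_const[of 1] by (simp_all add: numeral_fps_const)

lemma reflect_tderiv: "reflect (fps_tderiv f) = fps_tderiv (reflect f)"
proof (rule fps_ext)
  fix n
  show "fps_nth (reflect (fps_tderiv f)) n = fps_nth (fps_tderiv (reflect f)) n"
    by (cases "even n") (auto simp: tderiv_uminus)
qed

lemmas reflect_simps = reflect_add reflect_diff reflect_uminus reflect_mult reflect_tderiv

text \<open>The substitution \<open>y \<mapsto> -y\<close> at fixed \<open>\<lambda>\<close> exchanges the two solutions of the underlying linear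
  system, so \<open>\<sigma>\<close> plus its image is a logarithmic derivative, of the Wronskian up to a factor.\<close>

lemma gp_system_parity:
  assumes s: "gp_system \<epsilon> z \<sigma> \<rho>" and s': "gp_system \<epsilon> (- z) \<sigma>' \<rho>'"
    and z: "reflect z = z" and zd: "fps_tderiv z = 0"
  shows "fps_nth (\<sigma> + reflect \<sigma>') n \<simeq> 0"
proof -
  define S where "S = reflect \<sigma>'"
  define R where "R = reflect \<rho>'"
  define D where "D = \<sigma> - S"
  \<comment> \<open>Both \<sigma> and y + \<open>S\<close> solve the same Riccati equation, up to
    the companion \<open>R\<close> in place of \<rho>; \<open>u\<close> is t times the difference of
    these two logarithmic derivatives.\<close>
  define u where "u = 1 - fps_X * D"
  define P M P' E :: "complex dpoly fps"
    where "P = fWp" and "M = fWm" and "P' = fWp'" and "E = fcst (complex_of_real (\<epsilon>\<^sup>2))"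
  \<comment> \<open>This is 2 t (t - z) A with A = \<epsilon>^-2 (1 + \<lambda>) +
    \<open>Wp\<close>, written without \<epsilon>^-2.\<close>
  define q where "q = 1 + 2 * (fps_X * (fps_X - z)) * P"
  have dP: "fps_tderiv P = P'" by (simp add: P_def P'_def)
  have refl: "reflect P = P" "reflect M = M" "reflect P' = P'" "reflect E = E"
    by (simp_all add: P_def M_def P'_def E_def)
  note sys = gp_system_def[of \<epsilon>, folded P_def M_def P'_def E_def]
  \<comment> \<open>Since \<lambda> = y z, the reflection of y fixes \<lambda> only if z changes
    sign; this is why \<sigma>' is taken at - z.\<close>
  have S: "2 * S = - 2 * (fps_X * (fps_tderiv S + S * S + P' * R))
       - E * fps_X * M * P - (fps_X + z) * M + (fps_X - z) * P"
    and R: "R = - (fps_X - z) * (1 + 2 * (fps_X * (S + P * R)))"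
    using s'[unfolded sys, THEN conjunct1, THEN arg_cong, of reflect]
      s'[unfolded sys, THEN conjunct2, THEN arg_cong, of reflect]
    by (simp_all add: reflect_simps z refl flip: S_def R_def) (simp_all add: algebra_simps)
  have s1: "2 * \<sigma> = 2 * (fps_X * (fps_tderiv \<sigma> + \<sigma> * \<sigma> + P' * \<rho>))
       + E * fps_X * M * P + (fps_X + z) * M - (fps_X - z) * P"
    and r1: "\<rho> = (fps_X - z) * (1 - 2 * (fps_X * (\<sigma> + P * \<rho>)))"
    using s by (auto simp: sys)
  have "2 * (\<sigma> + S) = 2 * \<sigma> + 2 * S" by (simp only: distrib_left)
  also have "\<dots> = 2 * (fps_X * (fps_tderiv D + D * (\<sigma> + S) + P' * (\<rho> - R)))"
    unfolding s1 S by (simp add: D_def fps_tderiv_diff algebra_simps)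
  finally have "fcst 2 * (\<sigma> + S - fps_X * (fps_tderiv D + D * (\<sigma> + S) + P' * (\<rho> - R))) = 0"
    by (simp add: right_diff_distrib flip: numeral_fps_const)
  from fps_unit_cancel[OF _ this, of "cst (1/2)"]
  have "\<sigma> + S - fps_X * (fps_tderiv D + D * (\<sigma> + S) + P' * (\<rho> - R)) = 0"
    by (simp flip: cst_mult cst_numeral)
  then have 1: "u * (\<sigma> + S) = fps_X * fps_tderiv D + fps_X * P' * (\<rho> - R)"
    by (simp add: u_def algebra_simps)
  have "\<rho> + 2 * (fps_X * (fps_X - z)) * P * \<rho> = (fps_X - z) * (1 - 2 * (fps_X * \<sigma>))"
    by (subst (1) r1) (simp add: algebra_simps)
  moreover have "R + 2 * (fps_X * (fps_X - z)) * P * R = - (fps_X - z) * (1 + 2 * (fps_X * S))"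
    by (subst (1) R) (simp add: algebra_simps)
  ultimately have "(\<rho> + 2 * (fps_X * (fps_X - z)) * P * \<rho>) - (R + 2 * (fps_X * (fps_X - z)) * P * R)
      = (fps_X - z) * (1 - 2 * (fps_X * \<sigma>)) - (- (fps_X - z) * (1 + 2 * (fps_X * S)))"
    by (simp only:)
  then have 2: "q * (\<rho> - R) = 2 * (fps_X - z) * u"
    by (simp add: q_def u_def D_def algebra_simps)
  have "q * u * (\<sigma> + S) = q * (fps_X * fps_tderiv D) + fps_X * P' * (q * (\<rho> - R))"
    by (simp only: mult.assoc 1) (simp add: algebra_simps)
  also have "\<dots> = u * fps_tderiv q - q * fps_tderiv u"
    by (simp only: 2) (simp add: u_def q_def fps_tderiv_simps zd dP algebra_simps)
  finally have 3: "q * u * (\<sigma> + S) = u * fps_tderiv q - q * fps_tderiv u" .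
  have q0: "fps_nth q 0 = 1" and u0: "fps_nth u 0 = 1"
    by (simp_all add: q_def u_def)
  obtain qi ui where inv: "q * qi = 1" "u * ui = 1"
    using fps_unit_inverse[OF q0] fps_unit_inverse[OF u0] by metis
  define gq gu where "gq = qi * fps_tderiv q" and "gu = ui * fps_tderiv u"
  have gq: "q * gq = fps_tderiv q" and gu: "u * gu = fps_tderiv u"
    using inv by (simp_all add: gq_def gu_def mult.assoc[symmetric])
  \<comment> \<open>So \<sigma> + S is the logarithmic derivative of q / u.\<close>
  have "q * u * (\<sigma> + S - (gq - gu)) = 0"
    unfolding right_diff_distrib 3 gq[symmetric] gu[symmetric] by (simp add: algebra_simps)
  from fps_unit_cancel[OF _ this, of 1] q0 u0 have eq: "\<sigma> + S = gq - gu" by simp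
  show ?thesis
    unfolding S_def[symmetric] eq
    using same_integral_diff[OF log_derivative_same_integral_0[OF q0 gq, of n]
        log_derivative_same_integral_0[OF u0 gu, of n]] by simp
qed

context formal_solution
begin

text \<open>The parity relation reads (al + z be)_n + (-1)^n (al - z be)_n \<simeq> 0: twice
  \<open>z be\<close> drops out for odd n, twice \<open>al\<close> for even n.\<close>

lemma sig_parity:
  assumes z: "z * z = fps_X * fps_X - fcst (complex_of_real (\<epsilon>\<^sup>2 / 2))" and zd: "fps_tderiv z = 0"
    and zr: "reflect z = z"
  shows "odd n \<Longrightarrow> fps_nth (sig \<epsilon> z) n \<simeq> eval_eps \<epsilon> (fps_nth al n)"
    and "even n \<Longrightarrow> fps_nth (sig \<epsilon> z) n \<simeq> fps_nth (z * eval_eps.fmap \<epsilon> be) n"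
proof -
  have *: "fps_nth (sig \<epsilon> z + reflect (sig \<epsilon> (- z))) n \<simeq> 0"
  proof (rule gp_system_parity[OF gp_system_sig[OF z zd] gp_system_sig zr zd])
    show "- z * - z = fps_X * fps_X - fcst (complex_of_real (\<epsilon>\<^sup>2 / 2))" using z by simp
    show "fps_tderiv (- z) = 0" by (simp add: fps_tderiv_uminus zd)
  qed
  have cancel: "p \<simeq> 0" if "p + p \<simeq> 0" for p :: "complex dpoly"
  proof -
    have "cst (1/2) * (p + p) = (cst (1/2) + cst (1/2)) * p" by (simp add: algebra_simps)
    also have "\<dots> = p" by (simp flip: cst_add)
    finally show ?thesis using same_integral_cst[OF that, of "1/2"] by simp
  qed
  define p where "p = fps_nth (z * eval_eps.fmap \<epsilon> be) n"
  define q where "q = eval_eps \<epsilon> (fps_nth al n)"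
  have sum: "fps_nth (sig \<epsilon> z) n = q + p"
    by (simp add: sig_def p_def q_def)
  have sum': "q + p + (-1) ^ n * (q - p) \<simeq> 0"
    using * by (simp add: sig_def p_def q_def)
  show "fps_nth (sig \<epsilon> z) n \<simeq> eval_eps \<epsilon> (fps_nth al n)" if "odd n"
  proof -
    have "p + p \<simeq> 0" using sum' that by simp
    from same_integral_add[OF same_integral_refl[of q] cancel[OF this]]
    show ?thesis unfolding sum q_def[symmetric] by simp
  qed
  show "fps_nth (sig \<epsilon> z) n \<simeq> fps_nth (z * eval_eps.fmap \<epsilon> be) n" if "even n"
  proof -
    have "q + q \<simeq> 0" using sum' that by simp
    from same_integral_add[OF cancel[OF this] same_integral_refl[of p]]
    show ?thesis unfolding sum p_def[symmetric] by simp
  qed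
qed

end

subsection \<open>The scalar series \<open>\<lambda>\<close>\<close>

text \<open>The power (1 - 2 t^2 / \<epsilon>^2)^a. Exponent 1/2 describes \<lambda>; exponent -1/2
  produces the binomial weights of the modified odd Hamiltonians.\<close>

definition bin_series :: "real \<Rightarrow> complex \<Rightarrow> complex fps" where
  "bin_series \<epsilon> a = fps_binomial a oo (fps_const (- complex_of_real (2 / \<epsilon>\<^sup>2)) * fps_X ^ 2)"

lemma bin_series_nth:
  "fps_nth (bin_series \<epsilon> a) n =
     (if even n then (a gchoose (n div 2)) * (- complex_of_real (2 / \<epsilon>\<^sup>2)) ^ (n div 2) else 0)"
proof -
  define q where "q = - complex_of_real (2 / \<epsilon>\<^sup>2)"
  have "fps_nth (bin_series \<epsilon> a) n = (\<Sum>i=0..n. if n = 2 * i then (a gchoose i) * q ^ i else 0)"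
    unfolding bin_series_def q_def[symmetric] fps_compose_nth
    by (intro sum.cong refl) (auto simp: power_mult_distrib fps_const_power simp flip: power_mult)
  also have "\<dots> = (\<Sum>i\<in>{0..n}. if i = n div 2 \<and> even n then (a gchoose i) * q ^ i else 0)"
    by (intro sum.cong refl) auto
  also have "\<dots> = (if even n then (a gchoose (n div 2)) * q ^ (n div 2) else 0)"
    by (cases "even n") (auto simp: sum.delta)
  finally show ?thesis by (simp only: q_def)
qed

lemma bin_series_add: "bin_series \<epsilon> (a + b) = bin_series \<epsilon> a * bin_series \<epsilon> b"
  unfolding bin_series_def fps_binomial_add_mult by (rule fps_compose_mult_distrib) simp

lemma bin_series_0 [simp]: "bin_series \<epsilon> 0 = 1"
  by (simp add: bin_series_def)

lemma bin_series_1: "bin_series \<epsilon> 1 = 1 - fps_const (complex_of_real (2 / \<epsilon>\<^sup>2)) * fps_X ^ 2"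
  by (simp add: bin_series_def fps_binomial_1 fps_compose_add_distrib)

definition z_scalar :: "real \<Rightarrow> complex fps" where
  "z_scalar \<epsilon> = fps_const (- (\<i> * complex_of_real (\<epsilon> / sqrt 2))) * bin_series \<epsilon> (1 / 2)"

lemma z_scalar_square:
  assumes "\<epsilon> > 0"
  shows "z_scalar \<epsilon> * z_scalar \<epsilon> = fps_X * fps_X - fps_const (complex_of_real (\<epsilon>\<^sup>2 / 2))"
proof -
  define k where "k = \<i> * complex_of_real (\<epsilon> / sqrt 2)"
  have kk: "k * k = - complex_of_real (\<epsilon>\<^sup>2 / 2)"
    by (rule complex_eqI) (simp_all add: k_def power2_eq_square)
  have "z_scalar \<epsilon> * z_scalar \<epsilon> = fps_const (k * k) * (bin_series \<epsilon> (1/2) * bin_series \<epsilon> (1/2))"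
    unfolding z_scalar_def k_def[symmetric] by (rule fps_ext) (simp add: fps_mult_left_const_nth mult_ac)
  also have "bin_series \<epsilon> (1/2) * bin_series \<epsilon> (1/2) = 1 - fps_const (complex_of_real (2 / \<epsilon>\<^sup>2)) * (fps_X * fps_X)"
    by (simp add: bin_series_1 power2_eq_square flip: bin_series_add)
  also have "fps_const (k * k) * \<dots> =
      fps_const (k * k) - fps_const (k * k * complex_of_real (2 / \<epsilon>\<^sup>2)) * (fps_X * fps_X)"
    by (simp only: right_diff_distrib mult_1_right fps_const_mult[symmetric] mult.assoc)
  also have "k * k * complex_of_real (2 / \<epsilon>\<^sup>2) = -1"
    using assms unfolding kk by (simp flip: of_real_mult)
  finally show ?thesis by (simp add: kk fps_const_neg[symmetric] del: fps_const_neg)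
qed

lemma z_scalar_0: "fps_nth (z_scalar \<epsilon>) 0 = - (\<i> * complex_of_real (\<epsilon> / sqrt 2))"
  by (simp add: z_scalar_def bin_series_nth)

lemma fls_X_mult_X_inv [simp]:
  "fls_X * fls_X_inv = (1 :: 'a::comm_ring_1 fls)" "fls_X_inv * fls_X = (1 :: 'a::comm_ring_1 fls)"
  "fls_X * (fls_X_inv * f) = f" "fls_X_inv * (fls_X * f) = (f :: 'a fls)"
  by (simp_all add: fls_X_times_conv_shift fls_X_inv_times_conv_shift)

lemma fps_to_fls_X: "fps_to_fls fps_X = fls_X"
  by (rule fls_eqI) (auto simp: fps_X_def)

lemma lam_eq:
  assumes "\<epsilon> > 0"
  shows "lam \<epsilon> = fls_X_inv * fps_to_fls (z_scalar \<epsilon>)"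
proof -
  define l where "l = fls_X_inv * fps_to_fls (z_scalar \<epsilon>)"
  define c where "c = fls_const (complex_of_real (\<epsilon>\<^sup>2 / 2))"
  have "l\<^sup>2 = fls_X_inv * fls_X_inv * fps_to_fls (z_scalar \<epsilon> * z_scalar \<epsilon>)"
    by (simp add: l_def power2_eq_square fls_times_fps_to_fls mult_ac)
  also have "\<dots> = fls_X_inv * fls_X_inv * (fls_X * fls_X - c)"
    by (simp only: z_scalar_square[OF assms] fps_to_fls_minus fls_times_fps_to_fls fps_const_to_fls
        fps_to_fls_X c_def)
  also have "\<dots> = (fls_X_inv * fls_X) * (fls_X_inv * fls_X) - c * fls_X_inv\<^sup>2"
    by (simp only: right_diff_distrib mult_ac power2_eq_square)
  finally have l2: "l\<^sup>2 = 1 - c * fls_X_inv\<^sup>2" by simp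
  have nth: "fls_nth l n = (if n < -1 then 0 else fps_nth (z_scalar \<epsilon>) (nat (n + 1)))" for n
    by (simp add: l_def fls_X_inv_times_conv_shift)
  have l1: "fls_nth l (-1) = - (\<i> * complex_of_real (\<epsilon> / sqrt 2))"
    by (simp add: nth z_scalar_0)
  show ?thesis
    unfolding lam_def l_def[symmetric] c_def[symmetric]
  proof (rule the_equality, intro conjI allI impI)
    fix m assume m: "m\<^sup>2 = 1 - c * fls_X_inv\<^sup>2 \<and> (\<forall>n< - 1. fls_nth m n = 0) \<and>
      fls_nth m (-1) = - (\<i> * complex_of_real (\<epsilon> / sqrt 2))"
    \<comment> \<open>A square has only two roots here, and the prescribed coefficient at index -1,
      being nonzero, selects the sign.\<close>
    then have "m = l \<or> m = - l" using l2 by (metis power2_eq_iff)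
    moreover have "m \<noteq> - l" using m l1 assms by auto
    ultimately show "m = l" by simp
  qed (use l2 l1 nth in auto)
qed

definition lift_series :: "complex fps \<Rightarrow> complex dpoly fps" where
  "lift_series f = Abs_fps (\<lambda>n. cst (fps_nth f n))"

lemma lift_series_nth [simp]: "fps_nth (lift_series f) n = cst (fps_nth f n)"
  by (simp add: lift_series_def)

lemma lift_series_mult: "lift_series (f * g) = lift_series f * lift_series g"
  by (rule fps_ext) (simp add: fps_mult_nth cst_sum cst_mult)

lemma lift_series_diff: "lift_series (f - g) = lift_series f - lift_series g"
  by (rule fps_ext) (simp add: cst_diff)

lemma lift_series_const [simp]: "lift_series (fps_const c) = fcst c"
  and lift_series_X [simp]: "lift_series fps_X = fps_X"
  and lift_series_1 [simp]: "lift_series 1 = 1"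
  by (rule fps_ext, simp add: fps_X_def)+

lemma lift_series_tderiv [simp]: "fps_tderiv (lift_series f) = 0"
  by (rule fps_ext) simp

definition z_series :: "real \<Rightarrow> complex dpoly fps" where
  "z_series \<epsilon> = lift_series (z_scalar \<epsilon>)"

lemma z_series_square:
  "\<epsilon> > 0 \<Longrightarrow> z_series \<epsilon> * z_series \<epsilon> = fps_X * fps_X - fcst (complex_of_real (\<epsilon>\<^sup>2 / 2))"
  by (simp only: z_series_def lift_series_mult[symmetric] z_scalar_square)
    (simp only: lift_series_mult lift_series_diff lift_series_const lift_series_X)

lemma z_series_tderiv [simp]: "fps_tderiv (z_series \<epsilon>) = 0"
  by (simp add: z_series_def)

lemma z_series_reflect [simp]: "reflect (z_series \<epsilon>) = z_series \<epsilon>"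
  by (rule fps_ext) (auto simp: z_series_def z_scalar_def bin_series_nth)

lemma z_series_0: "fps_nth (z_series \<epsilon>) 0 = - cst (\<i> * complex_of_real (\<epsilon> / sqrt 2))"
  by (simp add: z_series_def z_scalar_0 cst_uminus)

lemma lamW_eq:
  assumes "\<epsilon> > 0"
  shows "lamW \<epsilon> = fls_X_inv * fps_to_fls (z_series \<epsilon>)"
proof (rule fls_eqI)
  fix n
  have lam: "fls_nth (lam \<epsilon>) n = (if n < -1 then 0 else fps_nth (z_scalar \<epsilon>) (nat (n + 1)))" for n
    by (simp add: lam_eq[OF assms] fls_X_inv_times_conv_shift)
  have "fls_nth (lamW \<epsilon>) n = cst (fls_nth (lam \<epsilon>) n)"
    unfolding lamW_def by (rule nth_Abs_fls_lower_bound[of "-1"]) (simp add: lam)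
  then show "fls_nth (lamW \<epsilon>) n = fls_nth (fls_X_inv * fps_to_fls (z_series \<epsilon>)) n"
    by (simp add: lam fls_X_inv_times_conv_shift z_series_def)
qed

subsection \<open>The series \<open>r\<close> and \<open>\<sigma>\<close>\<close>

lemma fls_eq_iff_X_mult: "f = g \<longleftrightarrow> fls_X * f = fls_X * (g :: 'a::comm_ring_1 fls)"
  by (metis fls_X_mult_X_inv(4))

text \<open>Multiplication by t turns the Laurent equation into one between power series, with
  \<lambda> entering only through z = t \<lambda>.\<close>

lemma is_r_iff:
  assumes "\<epsilon> > 0"
  defines "K \<equiv> fcst (\<i> * complex_of_real (\<epsilon> / sqrt 2))"
    and "J \<equiv> fcst (complex_of_real (1 / \<epsilon>\<^sup>2))"
  shows "is_r \<epsilon> r \<longleftrightarrow> fps_nth r 0 = 1 \<and>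
    fps_X * fps_tderiv r = K * (J * (fps_X + z_series \<epsilon>) + fps_X * fWp) * (r * r)
      + K * (J * (fps_X - z_series \<epsilon>) - fps_X * fWm)"
proof -
  define L where "L = fps_to_fls (z_series \<epsilon>)"
  define KK JJ PP MM RR where "KK = fps_to_fls K" and "JJ = fps_to_fls J"
    and "PP = fps_to_fls (fWp :: complex dpoly fps)" and "MM = fps_to_fls (fWm :: complex dpoly fps)"
    and "RR = fps_to_fls r"
  have "fls_X * (KK * (JJ * (1 + fls_X_inv * L) + PP) * RR\<^sup>2 + KK * (JJ * (1 - fls_X_inv * L) - MM))
     = KK * (JJ * (fls_X * 1 + fls_X * (fls_X_inv * L)) + fls_X * PP) * RR\<^sup>2 +
       KK * (JJ * (fls_X * 1 - fls_X * (fls_X_inv * L)) - fls_X * MM)"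
    by (simp only: algebra_simps)
  also have "\<dots> = KK * (JJ * (fls_X + L) + fls_X * PP) * (RR * RR) + KK * (JJ * (fls_X - L) - fls_X * MM)"
    by (simp add: power2_eq_square)
  also have "\<dots> = fps_to_fls (K * (J * (fps_X + z_series \<epsilon>) + fps_X * fWp) * (r * r)
      + K * (J * (fps_X - z_series \<epsilon>) - fps_X * fWm))"
    by (simp only: KK_def JJ_def PP_def MM_def RR_def L_def fps_to_fls_plus fps_to_fls_minus
        fls_times_fps_to_fls fps_to_fls_X)
  finally have eq: "fls_X * (KK * (JJ * (1 + fls_X_inv * L) + PP) * RR\<^sup>2 + KK * (JJ * (1 - fls_X_inv * L) - MM))
    = \<dots>" .
  show ?thesis
    unfolding is_r_def lamW_eq[OF assms(1)] series_deriv_eq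
    unfolding fps_const_to_fls[symmetric] K_def[symmetric] J_def[symmetric]
    unfolding KK_def[symmetric] JJ_def[symmetric] PP_def[symmetric] MM_def[symmetric] RR_def[symmetric] L_def[symmetric]
    unfolding fls_eq_iff_X_mult[of "fps_to_fls _"] eq
    unfolding fps_to_fls_X[symmetric] fls_times_fps_to_fls[symmetric] fps_to_fls_eq_iff ..
qed

lemma is_sigma_iff:
  assumes "\<epsilon> > 0"
  defines "H \<equiv> fcst (1 / 2)" and "N \<equiv> fcst (\<i> * complex_of_real (sqrt 2 * \<epsilon>))"
    and "E \<equiv> fcst (complex_of_real (\<epsilon>\<^sup>2))"
  shows "is_sigma \<epsilon> \<sigma> \<longleftrightarrow>
    fps_X * fps_tderiv \<sigma> = \<sigma> - fps_X * (\<sigma> * \<sigma>) + H * (- (E * fWm * fWp * fps_X)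
      - (fps_X + z_series \<epsilon>) * fWm + (fps_X - z_series \<epsilon>) * fWp - N * fWp' * r_series \<epsilon> * fps_X)"
proof -
  define L where "L = fps_to_fls (z_series \<epsilon>)"
  define HH NN EE PP MM QQ RR SS where "HH = fps_to_fls H" and "NN = fps_to_fls N" and "EE = fps_to_fls E"
    and "PP = fps_to_fls (fWp :: complex dpoly fps)" and "MM = fps_to_fls (fWm :: complex dpoly fps)"
    and "QQ = fps_to_fls (fWp' :: complex dpoly fps)"
    and "RR = fps_to_fls (r_series \<epsilon>)" and "SS = fps_to_fls \<sigma>"
  have "fls_X * (fls_X_inv * SS - SS\<^sup>2 + HH * (- (EE * MM * PP) - (1 + fls_X_inv * L) * MM
      + (1 - fls_X_inv * L) * PP - NN * QQ * RR))
     = fls_X * (fls_X_inv * SS) - fls_X * SS\<^sup>2 + HH * (- (EE * MM * PP * fls_X)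
       - (fls_X * 1 + fls_X * (fls_X_inv * L)) * MM
       + (fls_X * 1 - fls_X * (fls_X_inv * L)) * PP - NN * QQ * RR * fls_X)"
    by (simp only: algebra_simps mult_minus_left mult_minus_right)
  also have "\<dots> = SS - fls_X * (SS * SS) + HH * (- (EE * MM * PP * fls_X)
       - (fls_X + L) * MM + (fls_X - L) * PP - NN * QQ * RR * fls_X)"
    by (simp add: power2_eq_square)
  also have "\<dots> = fps_to_fls (\<sigma> - fps_X * (\<sigma> * \<sigma>) + H * (- (E * fWm * fWp * fps_X)
      - (fps_X + z_series \<epsilon>) * fWm + (fps_X - z_series \<epsilon>) * fWp - N * fWp' * r_series \<epsilon> * fps_X))"
    by (simp only: HH_def NN_def EE_def PP_def MM_def QQ_def RR_def SS_def L_def fps_to_fls_plus fps_to_fls_minus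
        fls_times_fps_to_fls fps_to_fls_X fps_to_fls_uminus)
  finally have eq: "fls_X * (fls_X_inv * SS - SS\<^sup>2 + HH * (- (EE * MM * PP) - (1 + fls_X_inv * L) * MM
      + (1 - fls_X_inv * L) * PP - NN * QQ * RR)) = \<dots>" .
  show ?thesis
    unfolding is_sigma_def lamW_eq[OF assms(1)] series_deriv_eq tderiv_W One_nat_def[symmetric]
    unfolding fps_const_to_fls[symmetric] H_def[symmetric] N_def[symmetric] E_def[symmetric]
    unfolding HH_def[symmetric] NN_def[symmetric] EE_def[symmetric] PP_def[symmetric] MM_def[symmetric]
      QQ_def[symmetric] RR_def[symmetric] SS_def[symmetric] L_def[symmetric]
    unfolding fls_eq_iff_X_mult[of "fps_to_fls _"] eq
    unfolding fps_to_fls_X[symmetric] fls_times_fps_to_fls[symmetric] fps_to_fls_eq_iff ..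
qed

lemma two_fcst_half [simp]: "2 * fcst (1 / 2 :: complex) = 1"
  by (simp add: numeral_fps_const flip: cst_numeral cst_mult)

lemma two_mult_cancel: "2 * x = 2 * y \<Longrightarrow> x = (y :: complex dpoly fps)"
proof -
  have half: "fcst (1 / 2) * (2 * x) = x" for x :: "complex dpoly fps"
    by (simp only: mult.assoc[symmetric] mult.commute[of _ 2] two_fcst_half mult_1_left)
  assume "2 * x = 2 * y"
  then have "fcst (1 / 2) * (2 * x) = fcst (1 / 2) * (2 * y)" by (rule arg_cong)
  then show "x = y" unfolding half .
qed

text \<open>The \<open>\<sigma>\<close>-equation turns into the Riccati equation for \<open>r\<close> since \<open>\<sigma> = y/2 - i \<kappa> A r\<close>, with
  \<open>\<kappa> = \<epsilon>/\<surd>2\<close> and \<open>A = \<epsilon>\<^sup>-\<^sup>2 (1 + \<lambda>) + W\<^sub>+\<close>.\<close>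

lemma gp_system_riccati:
  assumes eps: "\<epsilon> > 0" and s: "gp_system \<epsilon> (z_series \<epsilon>) \<sigma> \<rho>"
  defines "J \<equiv> fcst (complex_of_real (1 / \<epsilon>\<^sup>2))"
  shows "2 * (fps_X * fps_tderiv \<rho>) = 2 * ((J * (fps_X + z_series \<epsilon>) + fps_X * fWp) * (\<rho> * \<rho>))
      - fcst (complex_of_real (\<epsilon>\<^sup>2)) * (J * (fps_X - z_series \<epsilon>) - fps_X * fWm)"
proof -
  define z where "z = z_series \<epsilon>"
  define P M P' E :: "complex dpoly fps"
    where "P = fWp" and "M = fWm" and "P' = fWp'" and "E = fcst (complex_of_real (\<epsilon>\<^sup>2))"
  have dP: "fps_tderiv P = P'" "fps_tderiv J = 0" "fps_tderiv z = 0"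
    by (simp_all add: P_def P'_def J_def z_def)
  define A B where "A = J * (fps_X + z) + fps_X * P" and "B = J * (fps_X - z) - fps_X * M"
  have J0: "fps_nth J 0 = cst (complex_of_real (1 / \<epsilon>\<^sup>2))" by (simp add: J_def)
  have JE: "J * E = 1"
    using eps by (simp add: J_def E_def flip: cst_mult)
  have X2: "2 * ((fps_X + z) * (fps_X - z)) = E"
  proof -
    have "2 * ((fps_X + z) * (fps_X - z)) = 2 * (fps_X * fps_X - z * z)" by (simp add: algebra_simps)
    also have "\<dots> = 2 * fcst (complex_of_real (\<epsilon>\<^sup>2 / 2))"
      unfolding z_def z_series_square[OF eps] by (simp add: algebra_simps)
    also have "\<dots> = E"
      by (simp add: E_def numeral_fps_const flip: cst_mult cst_numeral)
    finally show ?thesis .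
  qed
  have s1: "2 * \<sigma> = 2 * (fps_X * (fps_tderiv \<sigma> + \<sigma> * \<sigma> + P' * \<rho>))
       + E * fps_X * M * P + (fps_X + z) * M - (fps_X - z) * P"
    and s2: "\<rho> = (fps_X - z) * (1 - 2 * (fps_X * (\<sigma> + P * \<rho>)))"
    using s by (simp_all only: gp_system_def P_def M_def P'_def E_def z_def)
  define X :: "complex dpoly fps" where "X = fps_X"
  define S where "S = E * X * M * P + (X + z) * M - (X - z) * P"
  have dX: "fps_tderiv X = 0" by (simp add: X_def)
  note A_def = A_def[folded X_def] note B_def = B_def[folded X_def] note X2 = X2[folded X_def]
  note s1 = s1[folded X_def] note s2 = s2[folded X_def]
  have "2 * (J * (X + z)) * \<rho> = J * (2 * ((X + z) * (X - z))) * (1 - 2 * (X * (\<sigma> + P * \<rho>)))"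
    by (subst s2) (simp only: mult_ac)
  also have "\<dots> = 1 - 2 * (X * (\<sigma> + P * \<rho>))" by (simp only: X2 JE mult_1_left)
  finally have 3: "2 * (A * \<rho>) = 1 - 2 * (X * \<sigma>)"
    by (simp add: A_def algebra_simps)
  have "fps_tderiv (2 * (A * \<rho>)) = fps_tderiv (1 - 2 * (X * \<sigma>))" by (simp only: 3)
  then have "2 * (A * fps_tderiv \<rho>) = 2 * (- (X * fps_tderiv \<sigma> + X * P' * \<rho>))"
    by (simp add: A_def fps_tderiv_simps dP dX algebra_simps)
  then have 4: "A * fps_tderiv \<rho> = - (X * fps_tderiv \<sigma> + X * P' * \<rho>)"
    by (rule two_mult_cancel)
  \<comment> \<open>With (X + z)(X - z) = \<epsilon>^2/2 the product A B reproduces the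
    inhomogeneous term \<open>S\<close> of the \<sigma>-equation.\<close>
  have AB: "2 * (E * (A * B)) = 1 - 2 * (X * S)"
  proof -
    have "2 * (E * (A * B)) = (J * E) * J * (2 * ((X + z) * (X - z)))
        + 2 * ((J * E) * (X * P * (X - z)) - (J * E) * (X * M * (X + z)) - E * (X * P * (X * M)))"
      by (simp add: A_def B_def algebra_simps)
    also have "\<dots> = J * E + 2 * (X * P * (X - z) - X * M * (X + z) - E * (X * P * (X * M)))"
      by (simp only: X2 JE mult_1_left)
    also have "\<dots> = 1 - 2 * (X * S)"
      unfolding JE S_def by (simp add: algebra_simps)
    finally show ?thesis .
  qed
  have 5: "2 * (X * (fps_tderiv \<sigma> + P' * \<rho>)) = 2 * \<sigma> - 2 * (X * (\<sigma> * \<sigma>)) - S"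
  proof -
    have "2 * (X * (fps_tderiv \<sigma> + P' * \<rho>)) =
        2 * (X * (fps_tderiv \<sigma> + \<sigma> * \<sigma> + P' * \<rho>)) - 2 * (X * (\<sigma> * \<sigma>))"
      by (simp add: algebra_simps)
    moreover have "2 * \<sigma> = 2 * (X * (fps_tderiv \<sigma> + \<sigma> * \<sigma> + P' * \<rho>)) + S"
      using s1 by (simp only: S_def add.assoc add_diff_eq)
    ultimately show ?thesis by simp
  qed
  have "A * (2 * (2 * (X * fps_tderiv \<rho>))) = 2 * X * (2 * (A * fps_tderiv \<rho>))"
    by (simp only: mult_ac)
  also have "\<dots> = - (2 * X * (2 * (X * (fps_tderiv \<sigma> + P' * \<rho>))))"
    by (simp only: 4) (simp add: algebra_simps)
  also have "\<dots> = (1 - 2 * (X * \<sigma>)) * (1 - 2 * (X * \<sigma>)) - (1 - 2 * (X * S))"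
    unfolding 5 by (simp add: algebra_simps)
  also have "\<dots> = A * (2 * (2 * (A * (\<rho> * \<rho>)) - E * B))"
    unfolding AB[symmetric] 3[symmetric] by (simp add: algebra_simps)
  finally have Ax: "A * (2 * (2 * (X * fps_tderiv \<rho>)) - 2 * (2 * (A * (\<rho> * \<rho>)) - E * B)) = 0"
    by (simp only: right_diff_distrib) simp
  \<comment> \<open>The constant term of \<open>A\<close> is -i / (sqrt 2 \<epsilon>), coming from
    that of z; being a nonzero scalar it allows \<open>A\<close> to be cancelled.\<close>
  have A0: "fps_nth A 0 * cst (1 / (- (\<i> * complex_of_real (\<epsilon> / sqrt 2)) * complex_of_real (1 / \<epsilon>\<^sup>2))) = 1"
  proof -
    define k where "k = - (\<i> * complex_of_real (\<epsilon> / sqrt 2))"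
    have "fps_nth A 0 = cst (complex_of_real (1 / \<epsilon>\<^sup>2)) * cst k"
      by (simp add: A_def X_def J0 z_def z_series_0 k_def cst_uminus)
    moreover have "k * complex_of_real (1 / \<epsilon>\<^sup>2) \<noteq> 0" using eps by (simp add: k_def)
    ultimately show ?thesis unfolding k_def[symmetric] by (simp flip: cst_mult)
  qed
  from fps_unit_cancel[OF A0 Ax] have "2 * (2 * (X * fps_tderiv \<rho>)) = 2 * (2 * (A * (\<rho> * \<rho>)) - E * B)" by simp
  from two_mult_cancel[OF this] show ?thesis
    by (simp only: A_def B_def P_def M_def E_def z_def X_def)
qed

text \<open>The difference satisfies a linear equation with factor A (r + s). The last assumption
  will be met because both initial values are 1, so that the constant term is 2 A_0.\<close>

lemma riccati_unique:
  fixes A B r s :: "complex dpoly fps"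
  assumes "fps_X * fps_tderiv r = A * (r * r) + B" "fps_X * fps_tderiv s = A * (s * s) + B"
    and "fps_nth (A * (r + s)) 0 * w = 1"
  shows "r = s"
proof -
  have "A * (r + s) * (r - s) = fps_X * fps_tderiv r - fps_X * fps_tderiv s"
    unfolding assms(1,2) by (simp add: algebra_simps)
  also have "\<dots> = fps_X * (1 * fps_tderiv (r - s))"
    by (simp add: fps_tderiv_diff algebra_simps)
  finally have "r - s = 0" by (rule fps_linear_eq_zero[OF assms(3)])
  then show ?thesis by simp
qed

text \<open>Both definite descriptions are resolved here: r = \<rho> / \<open>K\<close> is the
  unique solution of the r-equation, and with that r the given \<sigma> is the unique solution of
  its own.\<close>

lemma sigma_series_eqI:
  assumes eps: "\<epsilon> > 0" and s: "gp_system \<epsilon> (z_series \<epsilon>) \<sigma> \<rho>"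
  shows "sigma_series \<epsilon> = \<sigma>"
proof -
  define k where "k = \<i> * complex_of_real (\<epsilon> / sqrt 2)"
  have k0: "k \<noteq> 0" using eps by (simp add: k_def)
  have kk: "k * k = - complex_of_real (\<epsilon>\<^sup>2 / 2)"
    by (rule complex_eqI) (simp_all add: k_def power2_eq_square)
  define K where "K = fcst k"
  define Ki where "Ki = fcst (1 / k)"
  have KKi: "K * Ki = 1" using k0 by (simp add: K_def Ki_def flip: cst_mult)
  define J where "J = fcst (complex_of_real (1 / \<epsilon>\<^sup>2))"
  define A B where "A = J * (fps_X + z_series \<epsilon>) + fps_X * fWp"
    and "B = J * (fps_X - z_series \<epsilon>) - fps_X * fWm"
  define E where "E = fcst (complex_of_real (\<epsilon>\<^sup>2))"
  have KK: "E = - (2 * (K * K))"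
  proof -
    have "complex_of_real (\<epsilon>\<^sup>2) = - (2 * (k * k))" unfolding kk by simp
    then have "cst (complex_of_real (\<epsilon>\<^sup>2)) = - (2 * (cst k * cst k))"
      by (simp only: cst_uminus cst_mult cst_numeral)
    then show ?thesis by (simp add: E_def K_def numeral_fps_const)
  qed
  have ric: "2 * (fps_X * fps_tderiv \<rho>) = 2 * (A * (\<rho> * \<rho>)) - E * B"
    using gp_system_riccati[OF eps s] by (simp only: A_def B_def J_def E_def)
  define r where "r = Ki * \<rho>"
  have rho: "\<rho> = K * r" by (simp add: r_def mult.assoc[symmetric] KKi)
  have dK: "fps_tderiv (K * r) = K * fps_tderiv r" by (simp add: fps_tderiv_mult K_def)
  have "2 * (fps_X * (K * fps_tderiv r)) = 2 * (K * (K * A * (r * r) + K * B))"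
    using ric unfolding rho KK dK by (simp only:) (simp add: algebra_simps)
  then have *: "fps_X * (K * fps_tderiv r) = K * (K * A * (r * r) + K * B)"
    by (rule two_mult_cancel)
  have KK': "Ki * (K * y) = y" for y
    using KKi by (simp only: mult.assoc[symmetric] mult.commute[of Ki K] mult_1_left)
  have r_ric: "fps_X * fps_tderiv r = K * A * (r * r) + K * B"
    using arg_cong[OF *, of "\<lambda>x. Ki * x"] by (simp only: KK' mult.left_commute[of fps_X K])
  \<comment> \<open>The sign chosen for the leading coefficient of \<lambda> enters here: \<rho> has
    constant term - z_0 = \<open>k\<close>, hence r_0 = 1.\<close>
  have "fps_nth \<rho> 0 = fps_nth ((fps_X - z_series \<epsilon>) * (1 - 2 * (fps_X * (\<sigma> + fWp * \<rho>)))) 0"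
    using s unfolding gp_system_def by simp
  also have "\<dots> = cst k" by (simp add: z_series_0 k_def)
  finally have "fps_nth \<rho> 0 = cst k" .
  then have r0: "fps_nth r 0 = 1" using k0 by (simp add: r_def Ki_def flip: cst_mult)
  have is_r: "is_r \<epsilon> r" unfolding is_r_iff[OF eps]
    using r_ric r0 by (simp only: A_def B_def J_def K_def k_def)
  have uniq: "r' = r" if "is_r \<epsilon> r'" for r'
  proof (rule riccati_unique)
    show "fps_X * fps_tderiv r = K * A * (r * r) + K * B" by (rule r_ric)
    show "fps_X * fps_tderiv r' = K * A * (r' * r') + K * B"
      using that unfolding is_r_iff[OF eps] by (simp only: A_def B_def J_def K_def k_def)
    have "fps_nth r' 0 = 1" using that by (simp add: is_r_def)
    then have "fps_nth (K * A * (r' + r)) 0 = fps_nth K 0 * fps_nth A 0 * 2"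
      using r0 by simp
    also have "fps_nth K 0 * fps_nth A 0 = cst (k * (complex_of_real (1 / \<epsilon>\<^sup>2) * - k))"
    proof -
      have "fps_nth A 0 = cst (complex_of_real (1 / \<epsilon>\<^sup>2)) * - cst k"
        by (simp add: A_def J_def z_series_0 k_def)
      then show ?thesis unfolding cst_mult cst_uminus by (simp add: K_def)
    qed
    also have "k * (complex_of_real (1 / \<epsilon>\<^sup>2) * - k) = - (k * k) * complex_of_real (1 / \<epsilon>\<^sup>2)"
      by simp
    also have "\<dots> = 1 / 2" unfolding kk using eps by (simp add: field_simps)
    also have "cst (1 / 2) * 2 = (1 :: complex dpoly)"
      by (simp flip: cst_numeral cst_mult)
    finally show "fps_nth (K * A * (r' + r)) 0 * 1 = 1" by simp
  qed
  have r_series: "r_series \<epsilon> = r"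
    unfolding r_series_def by (rule the_equality[of "is_r \<epsilon>", OF is_r uniq])
  define N where "N = fcst (\<i> * complex_of_real (sqrt 2 * \<epsilon>))"
  define T where "T = - (E * fWm * fWp * fps_X) - (fps_X + z_series \<epsilon>) * fWm
       + (fps_X - z_series \<epsilon>) * fWp - N * fWp' * r_series \<epsilon> * fps_X"
  have sigma_iff: "is_sigma \<epsilon> \<tau> \<longleftrightarrow> fps_X * fps_tderiv \<tau> = \<tau> - fps_X * (\<tau> * \<tau>) + fcst (1/2) * T" for \<tau>
    unfolding is_sigma_iff[OF eps] T_def E_def N_def ..
  have "N = 2 * K"
  proof -
    have "sqrt 2 * \<epsilon> = 2 * (\<epsilon> / sqrt 2)" using real_sqrt_mult_self[of 2]
      by (simp add: field_simps)
    then have "\<i> * complex_of_real (sqrt 2 * \<epsilon>) = 2 * k"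
      unfolding k_def by (simp only: of_real_mult of_real_numeral mult_ac)
    then show ?thesis by (simp add: N_def K_def numeral_fps_const cst_mult)
  qed
  then have N: "N * fWp' * r_series \<epsilon> * fps_X = 2 * (fps_X * (fWp' * \<rho>))"
    by (simp only: rho r_series mult_ac)
  have "2 * (fps_X * fps_tderiv \<sigma>) = 2 * (\<sigma> - fps_X * (\<sigma> * \<sigma>) + fcst (1/2) * T)"
  proof -
    define U where "U = E * fps_X * fWm * fWp + (fps_X + z_series \<epsilon>) * fWm - (fps_X - z_series \<epsilon>) * fWp"
    have TU: "T = - U - 2 * (fps_X * (fWp' * \<rho>))"
      unfolding T_def N U_def by (simp only: mult_ac) simp
    have "2 * (fcst (1/2) * T) = T" by (simp only: mult.assoc[symmetric] two_fcst_half mult_1_left)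
    moreover have "2 * \<sigma> = 2 * (fps_X * (fps_tderiv \<sigma> + \<sigma> * \<sigma> + fWp' * \<rho>)) + U"
      using s[unfolded gp_system_def, THEN conjunct1] by (simp only: U_def E_def add.assoc add_diff_eq)
    ultimately show ?thesis by (simp only: distrib_left right_diff_distrib TU) simp
  qed
  then have is_sigma: "is_sigma \<epsilon> \<sigma>"
    unfolding sigma_iff by (rule two_mult_cancel)
  \<comment> \<open>The term y \<sigma> takes the place of an initial condition: it makes the linear
    factor of the difference start with 1.\<close>
  have uniq: "\<tau> = \<sigma>" if tau: "is_sigma \<epsilon> \<tau>" for \<tau>
  proof -
    have "(1 - fps_X * (\<tau> + \<sigma>)) * (\<tau> - \<sigma>) =
        (\<tau> - fps_X * (\<tau> * \<tau>) + fcst (1/2) * T) - (\<sigma> - fps_X * (\<sigma> * \<sigma>) + fcst (1/2) * T)"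
      by (simp add: algebra_simps)
    also have "\<dots> = fps_X * fps_tderiv \<tau> - fps_X * fps_tderiv \<sigma>"
      using tau is_sigma unfolding sigma_iff by simp
    also have "\<dots> = fps_X * (1 * fps_tderiv (\<tau> - \<sigma>))"
      by (simp add: fps_tderiv_diff right_diff_distrib)
    finally have "\<tau> - \<sigma> = 0" by (rule fps_linear_eq_zero[rotated, where w = 1]) simp
    then show ?thesis by simp
  qed
  show "sigma_series \<epsilon> = \<sigma>"
    unfolding sigma_series_def by (rule the_equality[of "is_sigma \<epsilon>", OF is_sigma uniq])
qed

subsection \<open>The Hamiltonians in terms of the formal solution\<close>

lemma ham_GP_even:
  "ham_GP \<epsilon> (2 * int n) =
     cst (complex_of_real ((sqrt 2 * \<epsilon>) ^ (2 * n + 1)) * - ((-1) ^ n)) * fps_nth (sigma_series \<epsilon>) (2 * n + 1)"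
proof -
  have "nat (2 * int n) = 2 * n" by simp
  moreover have "(- \<i>) ^ (2 * n) = (-1) ^ n" by (simp add: power_mult)
  ultimately show ?thesis
    by (simp add: ham_GP_def cst_uminus mult.commute)
qed

lemma ham_GP_odd:
  assumes "m > 0"
  shows "ham_GP \<epsilon> (2 * int m - 1) =
     cst (- (\<i> * (- complex_of_real (2 * \<epsilon>\<^sup>2)) ^ m)) * fps_nth (sigma_series \<epsilon>) (2 * m)"
proof -
  obtain k where m: "m = Suc k" using assms by (cases m) auto
  have n: "nat (2 * int m - 1) = 2 * k + 1" by (simp add: m)
  have "(- \<i>) ^ (2 * k + 1) = \<i> * (-1) ^ m" by (simp add: m power_mult)
  moreover have "complex_of_real (sqrt 2 * \<epsilon>) ^ (2 * m) = complex_of_real (2 * \<epsilon>\<^sup>2) ^ m"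
    by (simp only: power_mult of_real_power[symmetric] power_mult_distrib real_sqrt_pow2[of 2])
  moreover have "(- complex_of_real (2 * \<epsilon>\<^sup>2)) ^ m = (-1) ^ m * complex_of_real (2 * \<epsilon>\<^sup>2) ^ m"
    by (rule power_minus)
  moreover have "2 * int m - 1 \<noteq> -1" using assms by simp
  moreover have "2 * k + 1 + 1 = 2 * m" by (simp add: m)
  ultimately show ?thesis
    unfolding ham_GP_def n by (simp only: if_False cst_uminus mult.assoc mult_minus_left)
qed

context formal_solution
begin

lemma sigma_series_eq: "\<epsilon> > 0 \<Longrightarrow> sigma_series \<epsilon> = sig \<epsilon> (z_series \<epsilon>)"
  by (rule sigma_series_eqI, assumption) (rule gp_system_sig[OF z_series_square z_series_tderiv])

lemma be_0: "fps_nth be 0 = cst [:1/2:] * (Wp + Wm)"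
  by (subst be) simp

lemma ham_GPt_even:
  assumes "\<epsilon> > 0"
  shows "ham_GPt \<epsilon> (2 * int n) \<simeq>
    cst (complex_of_real ((sqrt 2 * \<epsilon>) ^ (2 * n + 1)) * - ((-1) ^ n)) * eval_eps \<epsilon> (fps_nth al (2 * n + 1))"
proof -
  have "ham_GPt \<epsilon> (2 * int n) = ham_GP \<epsilon> (2 * int n)" by (simp add: ham_GPt_def)
  then show ?thesis
    unfolding ham_GP_even sigma_series_eq[OF assms]
    by (simp only:) (intro same_integral_cst sig_parity(1) z_series_square assms z_series_tderiv
        z_series_reflect, simp)
qed

text \<open>The binomial sum is a convolution with (1 - 2 t^2 / \<epsilon>^2)^(-1/2), which is the
  reciprocal of z up to the constant -i \<epsilon> / sqrt 2. It strips the factor z from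
  \<open>z be\<close>.\<close>

lemma ham_GPt_odd:
  assumes eps: "\<epsilon> > 0"
  shows "2 * ham_GPt \<epsilon> (2 * int n - 1) \<simeq>
    cst (complex_of_real ((sqrt 2 * \<epsilon>) ^ (2 * n + 1)) * - ((-1) ^ n)) * eval_eps \<epsilon> (fps_nth be (2 * n))"
proof -
  define b where "b = eval_eps.fmap \<epsilon> be"
  define zb where "zb = z_series \<epsilon> * b"
  define q where "q = - complex_of_real (2 / \<epsilon>\<^sup>2)"
  define p where "p = - complex_of_real (2 * \<epsilon>\<^sup>2)"
  define k where "k = complex_of_real (\<epsilon> / sqrt 2)"
  define Bi where "Bi = lift_series (bin_series \<epsilon> (- (1 / 2)))"
  \<comment> \<open>The 4^(n-m) in the definition splits into q^(n-m), part of the binomial series,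
    and p^(n-m), the ratio of the normalizations at indices n and m.\<close>
  have qp: "q * p = 4" using eps by (simp add: q_def p_def)
  have "bin_series \<epsilon> (- (1 / 2)) * z_scalar \<epsilon> = fps_const (- (\<i> * k)) * (bin_series \<epsilon> (- (1 / 2)) * bin_series \<epsilon> (1 / 2))"
    by (simp only: z_scalar_def k_def mult_ac)
  also have "bin_series \<epsilon> (- (1 / 2)) * bin_series \<epsilon> (1 / 2) = 1"
    by (simp flip: bin_series_add)
  finally have "Bi * z_series \<epsilon> = fcst (- (\<i> * k))"
    by (simp only: Bi_def z_series_def lift_series_mult[symmetric] mult_1_right lift_series_const)
  then have Bi_zb: "Bi * zb = fcst (- (\<i> * k)) * b"
    by (simp only: zb_def mult.assoc[symmetric])
  have summand: "cst (if m = 0 then 1 / 2 else 1) * ham_GP \<epsilon> (2 * int m - 1) \<simeq> cst (- (\<i> * p ^ m)) * fps_nth zb (2 * m)"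
    for m
  proof (cases "m = 0")
    \<comment> \<open>The separately defined Hamiltonian of index -1 is twice what the formula for
      positive m would give at m = 0; the weight 1/2 corrects this, and the identity is
      exact.\<close>
    case True
    have "cst (- (\<i> * p ^ m)) * fps_nth zb (2 * m) = cst (- \<i> * (- (\<i> * k)) * (1 / 2)) * (Wp + Wm)"
      using True by (simp only: cst_mult) (simp add: zb_def b_def z_series_0 be_0 eval_eps.dmap_mult eval_eps.dmap_add k_def
          cst_uminus mult_ac)
    also have "\<dots> = cst (- (k / 2)) * (Wp + Wm)" by (simp add: mult.assoc[symmetric])
    also have "\<dots> = cst (1 / 2 * - k) * (Wp + Wm)" by simp
    also have "\<dots> = cst (1 / 2) * (cst (- k) * (Wp + Wm))" by (simp only: cst_mult mult.assoc)
    also have "\<dots> = cst (if m = 0 then 1 / 2 else 1) * ham_GP \<epsilon> (2 * int m - 1)"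
      using True by (simp add: ham_GP_def k_def cst_uminus)
    finally show ?thesis by simp
  next
    case False
    then have "ham_GP \<epsilon> (2 * int m - 1) \<simeq> cst (- (\<i> * p ^ m)) * fps_nth zb (2 * m)"
      unfolding p_def zb_def b_def using eps
      by (subst ham_GP_odd, simp, subst sigma_series_eq[OF eps])
        (intro same_integral_cst sig_parity(2) z_series_square z_series_tderiv z_series_reflect, simp_all)
    then show ?thesis using False by simp
  qed
  have odd: "odd (2 * int n - 1)" by simp
  have nat: "nat ((2 * int n - 1 + 1) div 2) = n" by simp
  have "ham_GPt \<epsilon> (2 * int n - 1) =
      (\<Sum>m=0..n. cst (((-1/2) gchoose (n - m)) * 4 ^ (n - m)) *
        (cst (if m = 0 then 1 / 2 else 1) * ham_GP \<epsilon> (2 * int m - 1)))"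
    unfolding ham_GPt_def Let_def nat using odd by (simp only: if_False cst_mult mult.assoc)
  also have "\<dots> \<simeq> (\<Sum>m=0..n. cst (((-1/2) gchoose (n - m)) * 4 ^ (n - m)) *
        (cst (- (\<i> * p ^ m)) * fps_nth zb (2 * m)))"
    by (intro same_integral_sum same_integral_cst summand)
  also have "\<dots> = cst (- (\<i> * p ^ n)) * (\<Sum>m=0..n. fps_nth Bi (2 * (n - m)) * fps_nth zb (2 * m))"
    unfolding sum_distrib_left
  proof (intro sum.cong refl)
    fix m assume "m \<in> {0..n}"
    then have pn: "p ^ n = p ^ (n - m) * p ^ m" by (simp flip: power_add)
    have "((-1/2) gchoose (n - m)) * 4 ^ (n - m) * - (\<i> * p ^ m) =
        - (\<i> * p ^ n) * (((-1/2) gchoose (n - m)) * q ^ (n - m))"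
      unfolding pn qp[symmetric] power_mult_distrib by (simp only: mult_ac mult_minus_left mult_minus_right)
    moreover have "fps_nth Bi (2 * (n - m)) = cst (((-1/2) gchoose (n - m)) * q ^ (n - m))"
      by (simp add: Bi_def bin_series_nth q_def)
    ultimately show "cst (((-1/2) gchoose (n - m)) * 4 ^ (n - m)) * (cst (- (\<i> * p ^ m)) * fps_nth zb (2 * m))
        = cst (- (\<i> * p ^ n)) * (fps_nth Bi (2 * (n - m)) * fps_nth zb (2 * m))"
      by (simp only: mult.assoc[symmetric] cst_mult[symmetric])
  qed
  also have "(\<Sum>m=0..n. fps_nth Bi (2 * (n - m)) * fps_nth zb (2 * m)) = fps_nth (zb * Bi) (2 * n)"
  proof -
    have "fps_nth (zb * Bi) (2 * n) = (\<Sum>i\<in>{0..2*n}. fps_nth zb i * fps_nth Bi (2 * n - i))"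
      by (simp add: fps_mult_nth)
    also have "\<dots> = (\<Sum>i\<in>(\<lambda>m. 2 * m) ` {0..n}. fps_nth zb i * fps_nth Bi (2 * n - i))"
    proof (rule sum.mono_neutral_right)
      show "\<forall>i\<in>{0..2 * n} - (\<lambda>m. 2 * m) ` {0..n}. fps_nth zb i * fps_nth Bi (2 * n - i) = 0"
      proof
        fix i assume i: "i \<in> {0..2 * n} - (\<lambda>m. 2 * m) ` {0..n}"
        have "odd i"
        proof
          assume "even i"
          then obtain j where "i = 2 * j" by (elim evenE)
          with i show False by auto
        qed
        then show "fps_nth zb i * fps_nth Bi (2 * n - i) = 0"
          using i by (simp add: Bi_def bin_series_nth)
      qed
    qed auto
    also have "\<dots> = (\<Sum>m\<in>{0..n}. fps_nth zb (2 * m) * fps_nth Bi (2 * n - 2 * m))"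
      by (subst sum.reindex) (auto simp: inj_on_def)
    finally show ?thesis by (simp only: mult.commute[of "fps_nth Bi _"] diff_mult_distrib2)
  qed
  also have "zb * Bi = fcst (- (\<i> * k)) * b" using Bi_zb by (simp only: mult.commute)
  also have "cst (- (\<i> * p ^ n)) * fps_nth (fcst (- (\<i> * k)) * b) (2 * n) =
     cst (- (\<i> * p ^ n) * - (\<i> * k)) * eval_eps \<epsilon> (fps_nth be (2 * n))"
    unfolding cst_mult b_def by (simp add: mult.assoc)
  finally have "cst 2 * ham_GPt \<epsilon> (2 * int n - 1) \<simeq>
     cst 2 * (cst (- (\<i> * p ^ n) * - (\<i> * k)) * eval_eps \<epsilon> (fps_nth be (2 * n)))"
    by (rule same_integral_cst)
  also have "\<dots> = cst (2 * (- (\<i> * p ^ n) * - (\<i> * k))) * eval_eps \<epsilon> (fps_nth be (2 * n))"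
    by (simp only: cst_mult mult.assoc)
  also have "2 * (- (\<i> * p ^ n) * - (\<i> * k)) = - (p ^ n * (2 * k))" by (simp add: algebra_simps)
  also have "\<dots> = complex_of_real ((sqrt 2 * \<epsilon>) ^ (2 * n + 1)) * - ((-1) ^ n)"
  proof -
    have "(sqrt 2 * \<epsilon>) ^ (2 * n + 1) = (2 * \<epsilon>\<^sup>2) ^ n * (sqrt 2 * \<epsilon>)"
      by (simp add: power_mult power_mult_distrib)
    moreover have "sqrt 2 * \<epsilon> = 2 * (\<epsilon> / sqrt 2)" using real_sqrt_mult_self[of 2]
      by (simp add: field_simps)
    ultimately have "complex_of_real ((sqrt 2 * \<epsilon>) ^ (2 * n + 1)) = complex_of_real (2 * \<epsilon>\<^sup>2) ^ n * (2 * k)"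
      by (simp only: k_def of_real_mult of_real_power of_real_numeral)
    moreover have "p ^ n = (-1) ^ n * complex_of_real (2 * \<epsilon>\<^sup>2) ^ n"
      unfolding p_def by (rule power_minus)
    ultimately show ?thesis by (simp only: mult_ac mult_minus_left mult_minus_right)
  qed
  finally show ?thesis by (simp only: cst_numeral)
qed

end

subsection \<open>The limit \<open>\<epsilon> = 0\<close>\<close>

definition kdv_series :: "complex dpoly \<Rightarrow> complex dpoly fps" where
  "kdv_series U = Abs_fps (sigma_KdV U)"

lemma kdv_series_eq:
  "kdv_series U = fps_X * (fps_tderiv (kdv_series U) + kdv_series U * kdv_series U) - fps_X * fps_const U"
proof (rule fps_ext)
  fix n
  show "fps_nth (kdv_series U) n = fps_nth (fps_X * (fps_tderiv (kdv_series U) + kdv_series U * kdv_series U)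
      - fps_X * fps_const U) n"
    by (cases "(U, n)" rule: sigma_KdV.cases)
      (auto simp: kdv_series_def fps_mult_nth[of "Abs_fps (sigma_KdV U)"])
qed

lemma riccati_unique_0:
  fixes s t c :: "complex dpoly fps"
  assumes "s = fps_X * (fps_tderiv s + s * s) + c" "t = fps_X * (fps_tderiv t + t * t) + c"
  shows "s = t"
proof -
  have "(1 - fps_X * (s + t)) * (s - t) = (s - fps_X * (s * s)) - (t - fps_X * (t * t))"
    by (simp add: algebra_simps)
  also have "s - fps_X * (s * s) = fps_X * fps_tderiv s + c"
    by (subst (1) assms(1)) (simp add: algebra_simps)
  also have "t - fps_X * (t * t) = fps_X * fps_tderiv t + c"
    by (subst (1) assms(2)) (simp add: algebra_simps)
  also have "fps_X * fps_tderiv s + c - (fps_X * fps_tderiv t + c) = fps_X * (1 * fps_tderiv (s - t))"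
    by (simp add: fps_tderiv_diff algebra_simps)
  finally have "s - t = 0" by (rule fps_linear_eq_zero[rotated, where w = 1]) simp
  then show ?thesis by simp
qed

text \<open>At z = t the factor t - z kills \<rho>, leaving the KdV Riccati equation itself; hence
  an equality and not merely one modulo total derivatives.\<close>

lemma gp_system_limit_minus:
  assumes "gp_system 0 fps_X \<sigma> \<rho>"
  shows "\<sigma> = kdv_series (- Wm)"
proof (rule riccati_unique_0)
  have "\<rho> = 0" using assms by (simp add: gp_system_def)
  then have "2 * \<sigma> = 2 * (fps_X * (fps_tderiv \<sigma> + \<sigma> * \<sigma>)) + (fps_X + fps_X) * fWm"
    using assms by (simp add: gp_system_def)
  also have "\<dots> = 2 * (fps_X * (fps_tderiv \<sigma> + \<sigma> * \<sigma>) + fps_X * fWm)"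
    by (simp add: algebra_simps)
  finally show "\<sigma> = fps_X * (fps_tderiv \<sigma> + \<sigma> * \<sigma>) + fps_X * fWm" by (rule two_mult_cancel)
  show "kdv_series (- Wm) = fps_X * (fps_tderiv (kdv_series (- Wm)) + kdv_series (- Wm) * kdv_series (- Wm))
     + fps_X * fWm"
    using kdv_series_eq[of "- Wm"] by (simp flip: fps_const_neg)
qed

text \<open>With \<open>V = y\<^sup>2/4 + W\<^sub>+\<close> and \<open>\<omega> = s - y/2\<close> for the KdV series \<open>s\<close>, the solution here is
  \<open>\<sigma> - y/2 = V/\<omega> = \<omega> + \<partial>\<^sub>X \<omega> / \<omega>\<close>; below \<open>q\<close>, \<open>u\<close>, \<open>v\<close> are \<open>V\<close>, \<open>\<omega>\<close> and \<open>\<sigma> - y/2\<close> up to powers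
  of \<open>y\<close>.\<close>

lemma gp_system_limit_plus:
  assumes gp: "gp_system 0 (- fps_X) \<sigma> \<rho>"
  shows "fps_nth \<sigma> n \<simeq> sigma_KdV Wp n"
proof -
  define s where "s = kdv_series Wp"
  define P P' X :: "complex dpoly fps" where "P = fWp" and "P' = fWp'" and "X = fps_X"
  have d: "fps_tderiv P = P'" "fps_tderiv X = 0" by (simp_all add: P_def P'_def X_def)
  define q u v where "q = 1 + 4 * (X * X * P)" and "u = 1 - 2 * (X * s)" and "v = 1 - 2 * (X * \<sigma>)"
  have q0: "fps_nth q 0 = 1" and u0: "fps_nth u 0 = 1" and v0: "fps_nth v 0 = 1"
    by (simp_all add: q_def u_def v_def X_def)
  have dq: "fps_tderiv q = 4 * (X * X * P')" and du: "fps_tderiv u = - (2 * (X * fps_tderiv s))"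
    and dv: "fps_tderiv v = - (2 * (X * fps_tderiv \<sigma>))"
    by (simp_all add: q_def u_def v_def fps_tderiv_simps d)
  have "2 * \<sigma> = 2 * (fps_X * (fps_tderiv \<sigma> + \<sigma> * \<sigma> + fWp' * \<rho>)) - (fps_X + fps_X) * fWp"
    and rho: "\<rho> = (X + X) * (1 - 2 * (X * (\<sigma> + P * \<rho>)))"
    using gp by (simp_all add: gp_system_def X_def P_def)
  then have "2 * \<sigma> = 2 * (X * (fps_tderiv \<sigma> + \<sigma> * \<sigma> + P' * \<rho>) - X * P)"
    by (simp add: X_def P_def P'_def algebra_simps)
  then have sig: "\<sigma> = X * (fps_tderiv \<sigma> + \<sigma> * \<sigma> + P' * \<rho>) - X * P" by (rule two_mult_cancel)
  have s: "s = X * (fps_tderiv s + s * s) - X * P"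
    using kdv_series_eq[of Wp] by (simp only: s_def X_def P_def)
  have "\<rho> = 2 * X * v - 4 * (X * X * P) * \<rho>"
    by (subst (1) rho) (simp add: v_def algebra_simps)
  then have rq: "q * \<rho> = 2 * X * v"
    by (simp add: q_def distrib_right eq_diff_eq)
  have "v * v - 2 * (X * fps_tderiv v) + fps_tderiv q * \<rho> =
      1 - 4 * X * (\<sigma> - X * (fps_tderiv \<sigma> + \<sigma> * \<sigma> + P' * \<rho>))"
    unfolding dv dq by (simp add: v_def algebra_simps)
  also have "\<sigma> - X * (fps_tderiv \<sigma> + \<sigma> * \<sigma> + P' * \<rho>) = - (X * P)"
    using sig by (simp add: algebra_simps)
  also have "1 - 4 * X * - (X * P) = q" by (simp add: q_def mult.assoc)
  finally have v: "v * v - 2 * (X * fps_tderiv v) + fps_tderiv q * \<rho> = q" .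
  have "u * u - 2 * (X * fps_tderiv u) = 1 - 4 * X * (s - X * (fps_tderiv s + s * s))"
    unfolding du by (simp add: u_def algebra_simps)
  also have "s - X * (fps_tderiv s + s * s) = - (X * P)"
    using s by (simp add: algebra_simps)
  also have "1 - 4 * X * - (X * P) = q" by (simp add: q_def mult.assoc)
  finally have u: "u * u - 2 * (X * fps_tderiv u) = q" .
  obtain vi where vi: "v * vi = 1" using fps_unit_inverse[OF v0] .
  \<comment> \<open>The quotient q / v is shown to solve the same Riccati equation as
    \<open>u\<close> with the same constant term, which forces q = u v.\<close>
  define x where "x = q * vi"
  have xv: "x * v = q" by (simp only: x_def mult.assoc mult.commute[of vi] vi mult_1_right)
  have x0: "fps_nth x 0 = 1"
    using arg_cong[OF xv, of "\<lambda>f. fps_nth f 0"] v0 q0 by simp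
  have dxv: "fps_tderiv x * v = fps_tderiv q - x * fps_tderiv v"
    by (simp add: xv[symmetric] fps_tderiv_mult)
  have "(v * v) * (x * x - 2 * (X * fps_tderiv x) - q)
      = (x * v) * (x * v) - 2 * X * v * (fps_tderiv x * v) - q * (v * v)"
    by (simp add: algebra_simps)
  also have "\<dots> = (x * v) * (x * v) - 2 * X * v * fps_tderiv q + 2 * X * (x * v) * fps_tderiv v - q * (v * v)"
    unfolding dxv by (simp add: algebra_simps)
  also have "\<dots> = q * (q - (v * v - 2 * (X * fps_tderiv v) + fps_tderiv q * \<rho>))
       + fps_tderiv q * (q * \<rho> - 2 * X * v)"
    unfolding xv by (simp add: algebra_simps)
  also have "\<dots> = 0" unfolding v rq by simp
  finally have "(v * v) * (x * x - 2 * (X * fps_tderiv x) - q) = 0" .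
  from fps_unit_cancel[OF _ this, of 1] v0
  have x: "x * x - 2 * (X * fps_tderiv x) = q" by simp
  have "(x + u) * (x - u) = (x * x - 2 * (X * fps_tderiv x)) - (u * u - 2 * (X * fps_tderiv u))
      + 2 * (X * fps_tderiv x) - 2 * (X * fps_tderiv u)"
    by (simp add: algebra_simps)
  also have "\<dots> = fps_X * (2 * fps_tderiv (x - u))"
    unfolding x u by (simp add: X_def fps_tderiv_diff algebra_simps)
  finally have *: "(x + u) * (x - u) = fps_X * (2 * fps_tderiv (x - u))" .
  have "fps_nth (x + u) 0 = cst 2" using x0 u0 by simp
  then have "fps_nth (x + u) 0 * cst (1 / 2) = 1" by (simp only: cst_mult[symmetric]) simp
  from fps_linear_eq_zero[OF this *] have "x = u" by simp
  \<comment> \<open>Subtracting u^2 leaves \<sigma> - s as the logarithmic derivative of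
    \<open>u\<close>.\<close>
  then have "u * v = u * u - 2 * (X * fps_tderiv u)" using xv u by simp
  then have "2 * (X * (u * (\<sigma> - s))) = 2 * (X * fps_tderiv u)"
    by (simp add: u_def v_def algebra_simps)
  from two_mult_cancel[OF this] have "u * (\<sigma> - s) = fps_tderiv u"
    by (simp only: X_def fps_X_mult_cancel)
  from same_integral_add[OF log_derivative_same_integral_0[OF u0 this, of n] same_integral_refl[of "fps_nth s n"]]
  show ?thesis by (simp add: s_def kdv_series_def)
qed

context formal_solution
begin

lemma limit_minus:
  "eval_eps 0 (fps_nth al (2 * n + 1)) + eval_eps 0 (fps_nth be (2 * n)) = sigma_KdV (- Wm) (2 * n + 1)"
proof -
  have "sig 0 fps_X = kdv_series (- Wm)"
    by (rule gp_system_limit_minus[of _ "rho 0 fps_X"], rule gp_system_sig) simp_all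
  \<comment> \<open>The factor z = X shifts the index of \<open>be\<close>, which pairs coefficient
    2n+1 of \<open>al\<close> with coefficient 2n of \<open>be\<close>.\<close>
  from arg_cong[OF this, of "\<lambda>f. fps_nth f (2 * n + 1)"] show ?thesis
    by (simp add: sig_def kdv_series_def)
qed

lemma limit_plus:
  "eval_eps 0 (fps_nth al (2 * n + 1)) - eval_eps 0 (fps_nth be (2 * n)) \<simeq> sigma_KdV Wp (2 * n + 1)"
proof -
  have "fps_nth (sig 0 (- fps_X)) (2 * n + 1) \<simeq> sigma_KdV Wp (2 * n + 1)"
    by (rule gp_system_limit_plus[of _ "rho 0 (- fps_X)"], rule gp_system_sig)
      (simp_all add: fps_tderiv_uminus)
  then show ?thesis by (simp add: sig_def)
qed

end

lemma energy_KdV_eq: "energy_KdV (int n - 1) U = cst (- ((-1) ^ n)) * sigma_KdV U (2 * n + 1)"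
proof -
  have "nat (2 * (int n - 1) + 3) = 2 * n + 1" by (simp add: nat_eq_iff)
  moreover have "(-1 :: complex) powi (int n - 1) = - ((-1) ^ n)"
    by (simp add: power_int_diff)
  ultimately show ?thesis by (simp only: energy_KdV_def)
qed

subsection \<open>Degree and weight of monomials\<close>

text \<open>Common form of the degree (f = 1) and of the total number of derivatives (f =
  \<open>snd\<close>). \<open>mon_weight\<close> counts derivatives only; the scaling weight adds
  \<open>2 * mon_degree\<close> to it.\<close>

definition mon_sum :: "(jet \<Rightarrow> nat) \<Rightarrow> (jet \<Rightarrow>\<^sub>0 nat) \<Rightarrow> nat" where
  "mon_sum f m = (\<Sum>v\<in>Poly_Mapping.keys m. Poly_Mapping.lookup m v * f v)"

abbreviation mon_weight :: "(jet \<Rightarrow>\<^sub>0 nat) \<Rightarrow> nat" where "mon_weight \<equiv> mon_sum snd"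

lemma mon_degree_eq: "mon_degree = mon_sum (\<lambda>_. 1)"
  by (rule ext) (simp add: mon_degree_def mon_sum_def)

lemma mon_sum_add: "mon_sum f (m + m') = mon_sum f m + mon_sum f m'"
  unfolding mon_sum_def by (rule setsum_keys_plus_distrib) (auto simp: algebra_simps)

lemma mon_sum_single [simp]: "mon_sum f (Poly_Mapping.single v k) = k * f v"
  by (simp add: mon_sum_def)

lemma mon_sum_0 [simp]: "mon_sum f 0 = 0"
  by (simp add: mon_sum_def)

text \<open>Written additively so that additive invariants of \<open>raise m v\<close> can be read
  off without the truncated subtraction.\<close>

lemma raise_plus_single:
  assumes "v \<in> Poly_Mapping.keys m"
  shows "raise m v + Poly_Mapping.single v 1 = m + Poly_Mapping.single (fst v, Suc (snd v)) 1"
proof (rule poly_mapping_eqI)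
  fix k
  have "Poly_Mapping.lookup m v \<noteq> 0" using assms by (simp add: in_keys_iff)
  then show "Poly_Mapping.lookup (raise m v + Poly_Mapping.single v 1) k =
      Poly_Mapping.lookup (m + Poly_Mapping.single (fst v, Suc (snd v)) 1) k"
    by (auto simp: raise_def lookup_add lookup_minus lookup_single when_def)
qed

lemma mon_degree_raise:
  assumes "v \<in> Poly_Mapping.keys m"
  shows "mon_degree (raise m v) = mon_degree m"
  using arg_cong[OF raise_plus_single[OF assms], of mon_degree]
  by (simp add: mon_degree_eq mon_sum_add)

lemma mon_weight_raise:
  assumes "v \<in> Poly_Mapping.keys m"
  shows "mon_weight (raise m v) = Suc (mon_weight m)"
  using arg_cong[OF raise_plus_single[OF assms], of mon_weight]
  by (simp add: mon_sum_add)

lemma order_le_mon_weight: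
  assumes "v \<in> Poly_Mapping.keys m"
  shows "snd v \<le> mon_weight m"
proof -
  have "1 \<le> Poly_Mapping.lookup m v" using assms by (simp add: in_keys_iff)
  then have "snd v \<le> Poly_Mapping.lookup m v * snd v" by simp
  also have "\<dots> \<le> mon_weight m"
    unfolding mon_sum_def using assms by (intro member_le_sum) auto
  finally show ?thesis .
qed

lemma keys_sum_subset: "Poly_Mapping.keys (sum f I) \<subseteq> (\<Union>i\<in>I. Poly_Mapping.keys (f i))"
proof (induction I rule: infinite_finite_induct)
  case (insert x F)
  then show ?case using keys_add[of "f x" "sum f F"] by auto
qed auto

lemma keys_tderiv_mon: "Poly_Mapping.keys (tderiv_mon m c) \<subseteq> raise m ` Poly_Mapping.keys m"
  unfolding tderiv_mon_def by (rule order.trans[OF keys_sum_subset]) (auto split: if_splits)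

lemma keys_uminus [simp]: "Poly_Mapping.keys (- p) = Poly_Mapping.keys (p :: 'a::comm_ring_1 dpoly)"
  by (auto simp: in_keys_iff)

subsection \<open>Lowering the order by integration by parts\<close>

text \<open>With 2M derivatives in all, only one factor can have order M + J + 1, and the others
  share M - J - 1. Moving one derivative from it onto them lowers it to M + J and raises their total
  to M - J.\<close>

lemma reduce_order_step:
  fixes c :: "'a::comm_ring_1"
  assumes wt: "mon_weight m = 2 * M" and ord: "\<forall>v\<in>Poly_Mapping.keys m. snd v \<le> Suc (M + J)"
  shows "\<exists>q. Poly_Mapping.single m c \<simeq> q \<and> (\<forall>k\<in>Poly_Mapping.keys q. mon_degree k = mon_degree m \<and>
    mon_weight k = 2 * M \<and> (\<forall>v\<in>Poly_Mapping.keys k. snd v \<le> M + J))"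
proof (cases "\<exists>v\<in>Poly_Mapping.keys m. snd v = Suc (M + J)")
  case False
  then have "\<forall>v\<in>Poly_Mapping.keys m. snd v \<le> M + J" using ord by (metis le_SucE)
  then show ?thesis using wt by (intro exI[of _ "Poly_Mapping.single m c"]) auto
next
  case True
  then obtain v where v: "v \<in> Poly_Mapping.keys m" "snd v = Suc (M + J)" by blast
  define v' where "v' = (fst v, M + J)"
  define k where "k = m - Poly_Mapping.single v 1"
  have m: "m = Poly_Mapping.single v 1 + k"
  proof (rule poly_mapping_eqI)
    fix x
    have "Poly_Mapping.lookup m v \<noteq> 0" using v by (simp add: in_keys_iff)
    then show "Poly_Mapping.lookup m x = Poly_Mapping.lookup (Poly_Mapping.single v 1 + k) x"
      by (auto simp: k_def lookup_add lookup_minus lookup_single when_def)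
  qed
  have wk: "mon_weight k + Suc (M + J) = 2 * M" and dk: "mon_degree m = Suc (mon_degree k)"
    using wt v unfolding m by (simp_all add: mon_sum_add mon_degree_eq)
  define q where "q = - (Poly_Mapping.single (Poly_Mapping.single v' 1) c * tderiv (Poly_Mapping.single k 1))"
  have "Poly_Mapping.single m c = Poly_Mapping.single (Poly_Mapping.single v 1) c * Poly_Mapping.single k 1"
    by (simp only: mult_single m[symmetric] mult_1_right)
  also have "Poly_Mapping.single (Poly_Mapping.single v 1) c = tderiv (Poly_Mapping.single (Poly_Mapping.single v' 1) c)"
    using v by (cases v) (simp add: tderiv_single tderiv_mon_def raise_def v'_def)
  also have "\<dots> * Poly_Mapping.single k 1 \<simeq> q"
    unfolding q_def by (rule same_integral_by_parts)
  finally have "Poly_Mapping.single m c \<simeq> q" .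
  moreover have "mon_degree x = mon_degree m \<and> mon_weight x = 2 * M \<and> (\<forall>u\<in>Poly_Mapping.keys x. snd u \<le> M + J)"
    if "x \<in> Poly_Mapping.keys q" for x
  proof -
    have "x \<in> {a + b |a b. a \<in> Poly_Mapping.keys (Poly_Mapping.single (Poly_Mapping.single v' 1) c) \<and>
        b \<in> Poly_Mapping.keys (tderiv_mon k (1::'a))}"
      using that keys_mult[of "Poly_Mapping.single (Poly_Mapping.single v' 1) c" "tderiv_mon k (1::'a)"]
      by (simp only: q_def keys_uminus tderiv_single) blast
    then obtain u where u: "u \<in> Poly_Mapping.keys k" "x = Poly_Mapping.single v' 1 + raise k u"
      using keys_tderiv_mon[of k "1::'a"] by (auto split: if_splits)
    have wr: "mon_weight (raise k u) = Suc (mon_weight k)" using u by (simp add: mon_weight_raise)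
    have "snd y \<le> M + J" if "y \<in> Poly_Mapping.keys x" for y
    proof -
      have "y = v' \<or> y \<in> Poly_Mapping.keys (raise k u)"
        using that keys_add[of "Poly_Mapping.single v' (1::nat)" "raise k u"] unfolding u by (auto split: if_splits)
      then show ?thesis
      proof
        assume "y \<in> Poly_Mapping.keys (raise k u)"
        then have "snd y \<le> Suc (mon_weight k)" using order_le_mon_weight wr by metis
        also have "\<dots> \<le> M + J" using wk by simp
        finally show ?thesis .
      qed (simp add: v'_def)
    qed
    moreover have "mon_degree x = mon_degree m"
      using mon_degree_raise[OF u(1)] dk by (simp add: u(2) mon_degree_eq mon_sum_add)
    moreover have "mon_weight x = 2 * M"
      using wk by (simp add: u(2) mon_sum_add wr v'_def)
    ultimately show ?thesis by blast
  qed
  ultimately show ?thesis by blast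
qed

lemma keys_split:
  fixes p :: "'a::comm_ring_1 dpoly"
  assumes "\<And>m (c :: 'a). R m \<Longrightarrow> \<exists>q. Poly_Mapping.single m c \<simeq> q \<and> (\<forall>k\<in>Poly_Mapping.keys q. R' k)"
    and "\<forall>m\<in>Poly_Mapping.keys p. R m"
  shows "\<exists>q. p \<simeq> q \<and> (\<forall>k\<in>Poly_Mapping.keys q. R' k)"
proof -
  have "\<exists>q. Poly_Mapping.single m (Poly_Mapping.lookup p m) \<simeq> q \<and> (\<forall>k\<in>Poly_Mapping.keys q. R' k)"
    if "m \<in> Poly_Mapping.keys p" for m
    by (rule assms(1)) (use assms(2) that in blast)
  then have "\<forall>m\<in>Poly_Mapping.keys p. \<exists>q. Poly_Mapping.single m (Poly_Mapping.lookup p m) \<simeq> q \<and>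
      (\<forall>k\<in>Poly_Mapping.keys q. R' k)"
    by (rule ballI)
  from bchoice[OF this] obtain f where f: "\<forall>m\<in>Poly_Mapping.keys p.
      Poly_Mapping.single m (Poly_Mapping.lookup p m) \<simeq> f m \<and> (\<forall>k\<in>Poly_Mapping.keys (f m). R' k)" ..
  have "(\<Sum>m\<in>Poly_Mapping.keys p. Poly_Mapping.single m (Poly_Mapping.lookup p m))
      \<simeq> (\<Sum>m\<in>Poly_Mapping.keys p. f m)"
    by (intro same_integral_sum) (use f in blast)
  then have "p \<simeq> (\<Sum>m\<in>Poly_Mapping.keys p. f m)"
    by (simp only: dpoly_sum_single[of p, symmetric])
  moreover have "\<forall>k\<in>Poly_Mapping.keys (\<Sum>m\<in>Poly_Mapping.keys p. f m). R' k"
  proof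
    fix k assume "k \<in> Poly_Mapping.keys (\<Sum>m\<in>Poly_Mapping.keys p. f m)"
    then have "k \<in> (\<Union>m\<in>Poly_Mapping.keys p. Poly_Mapping.keys (f m))"
      by (rule subsetD[OF keys_sum_subset])
    then show "R' k" using f by blast
  qed
  ultimately show ?thesis by blast
qed

lemma reduce_order_mon:
  fixes c :: "'a::comm_ring_1"
  assumes "mon_weight m = 2 * M"
  shows "\<exists>q. Poly_Mapping.single m c \<simeq> q \<and> (\<forall>k\<in>Poly_Mapping.keys q. mon_degree k = mon_degree m \<and>
    (\<forall>v\<in>Poly_Mapping.keys k. snd v \<le> M))"
proof -
  define R where "R = (\<lambda>J k. mon_degree k = mon_degree m \<and> mon_weight k = 2 * M \<and>
    (\<forall>v\<in>Poly_Mapping.keys k. snd v \<le> M + J))"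
  have "\<exists>q. p \<simeq> q \<and> (\<forall>k\<in>Poly_Mapping.keys q. R 0 k)" if "\<forall>k\<in>Poly_Mapping.keys p. R J k"
    for p :: "'a dpoly" and J
    using that
  proof (induction J arbitrary: p)
    case (Suc J)
    have "\<exists>q. Poly_Mapping.single k c \<simeq> q \<and> (\<forall>k\<in>Poly_Mapping.keys q. R J k)" if "R (Suc J) k"
      for k and c :: 'a
      using that reduce_order_step[of k M J c] unfolding R_def by auto
    from keys_split[of "R (Suc J)" "R J", OF this Suc.prems]
    obtain q where q: "p \<simeq> q" "\<forall>k\<in>Poly_Mapping.keys q. R J k" by blast
    from Suc.IH[OF q(2)] q(1) show ?case using same_integral_trans by blast
  qed (use same_integral_refl in blast)
  \<comment> \<open>No order exceeds the total 2M, so 2M is a safe initial excess.\<close>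
  moreover have "\<forall>k\<in>Poly_Mapping.keys (Poly_Mapping.single m c). R (2 * M) k"
    using assms by (auto simp: R_def dest!: order_le_mon_weight)
  ultimately obtain q where "Poly_Mapping.single m c \<simeq> q" "\<forall>k\<in>Poly_Mapping.keys q. R 0 k" by blast
  then show ?thesis by (intro exI[of _ q]) (auto simp: R_def)
qed

text \<open>The integer bound \<open>N\<close> includes -1, where the hypothesis leaves no monomial
  in \<open>p\<close>; this serves the lowest index n = 0.\<close>

lemma reduce_order:
  fixes p :: "'a::comm_ring_1 dpoly"
  assumes "\<forall>m\<in>Poly_Mapping.keys p. even (mon_weight m) \<and> int (mon_weight m) \<le> 2 * N \<and> L \<le> mon_degree m"
  shows "\<exists>q. p \<simeq> q \<and> order_le q N \<and> (\<forall>m\<in>Poly_Mapping.keys q. L \<le> mon_degree m)"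
proof -
  define R' where "R' = (\<lambda>k. L \<le> mon_degree k \<and> (\<forall>v\<in>Poly_Mapping.keys k. int (snd v) \<le> N))"
  have "\<exists>q. p \<simeq> q \<and> (\<forall>k\<in>Poly_Mapping.keys q. R' k)"
  proof (rule keys_split[OF _ assms])
    fix m and c :: 'a
    assume m: "even (mon_weight m) \<and> int (mon_weight m) \<le> 2 * N \<and> L \<le> mon_degree m"
    then obtain M where M: "mon_weight m = 2 * M" by (elim conjE evenE)
    with m have "int M \<le> N" by simp
    with reduce_order_mon[OF M, of c] m
    show "\<exists>q. Poly_Mapping.single m c \<simeq> q \<and> (\<forall>k\<in>Poly_Mapping.keys q. R' k)"
      unfolding R'_def by (metis of_nat_mono order_trans)
  qed
  then show ?thesis unfolding R'_def order_le_def by blast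
qed

subsection \<open>Grading of the formal solution\<close>

text \<open>The weights are \<open>2 + j\<close> for \<open>\<partial>\<^sub>X\<^sup>j W\<^sub>\<plusminus>\<close> and \<open>-1\<close> for \<open>\<epsilon>\<close>; \<open>s\<close> measures by how much the degree
  in \<open>W\<close> exceeds the power of \<open>\<epsilon>\<close>, and \<open>l\<close> bounds the degree from below.\<close>

definition graded :: "int \<Rightarrow> int \<Rightarrow> nat \<Rightarrow> real poly dpoly \<Rightarrow> bool" where
  "graded w s l p \<longleftrightarrow> (\<forall>m i. coeff (Poly_Mapping.lookup p m) i \<noteq> 0 \<longrightarrow>
     even i \<and> int (mon_weight m) + 2 * int (mon_degree m) = int i + w \<and>
     int i + s \<le> int (mon_degree m) \<and> l \<le> mon_degree m)"

lemma graded_0 [simp]: "graded w s l 0"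
  by (simp add: graded_def)

lemma graded_add: "graded w s l p \<Longrightarrow> graded w s l q \<Longrightarrow> graded w s l (p + q)"
  unfolding graded_def lookup_add coeff_add
proof (intro allI impI)
  fix m i
  assume p: "\<forall>m i. coeff (Poly_Mapping.lookup p m) i \<noteq> 0 \<longrightarrow> even i \<and>
      int (mon_weight m) + 2 * int (mon_degree m) = int i + w \<and> int i + s \<le> int (mon_degree m) \<and> l \<le> mon_degree m"
    and q: "\<forall>m i. coeff (Poly_Mapping.lookup q m) i \<noteq> 0 \<longrightarrow> even i \<and>
      int (mon_weight m) + 2 * int (mon_degree m) = int i + w \<and> int i + s \<le> int (mon_degree m) \<and> l \<le> mon_degree m"
    and "coeff (Poly_Mapping.lookup p m) i + coeff (Poly_Mapping.lookup q m) i \<noteq> 0"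
  then have "coeff (Poly_Mapping.lookup p m) i \<noteq> 0 \<or> coeff (Poly_Mapping.lookup q m) i \<noteq> 0" by auto
  then show "even i \<and> int (mon_weight m) + 2 * int (mon_degree m) = int i + w \<and>
      int i + s \<le> int (mon_degree m) \<and> l \<le> mon_degree m"
    using p q by blast
qed

lemma graded_uminus: "graded w s l p \<Longrightarrow> graded w s l (- p)"
  by (simp add: graded_def)

lemma graded_diff: "graded w s l p \<Longrightarrow> graded w s l q \<Longrightarrow> graded w s l (p - q)"
  using graded_add[OF _ graded_uminus] by fastforce

lemma graded_sum: "(\<And>i. i \<in> I \<Longrightarrow> graded w s l (f i)) \<Longrightarrow> graded w s l (sum f I)"
  by (induction I rule: infinite_finite_induct) (auto intro: graded_add)

lemma graded_weaken:
  "graded w s l p \<Longrightarrow> w = w' \<Longrightarrow> s' \<le> s \<Longrightarrow> l' \<le> l \<Longrightarrow> graded w' s' l' p"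
  unfolding graded_def by fastforce

lemma graded_single:
  "graded w s l (Poly_Mapping.single m c) \<longleftrightarrow> (\<forall>i. coeff c i \<noteq> 0 \<longrightarrow>
     even i \<and> int (mon_weight m) + 2 * int (mon_degree m) = int i + w \<and>
     int i + s \<le> int (mon_degree m) \<and> l \<le> mon_degree m)"
proof -
  have "coeff (Poly_Mapping.lookup (Poly_Mapping.single m c) m') i = (if m = m' then coeff c i else 0)" for m' i
    by (simp add: lookup_single when_def)
  then show ?thesis unfolding graded_def by auto
qed

lemma graded_component: "graded w s l p \<Longrightarrow> graded w s l (Poly_Mapping.single m (Poly_Mapping.lookup p m))"
  unfolding graded_single by (simp add: graded_def)

lemma graded_mult:
  assumes "graded w s l p" "graded w' s' l' q"
  shows "graded (w + w') (s + s') (l + l') (p * q)"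
proof -
  have single: "graded (w + w') (s + s') (l + l') (Poly_Mapping.single m c * Poly_Mapping.single m' c')"
    if "graded w s l (Poly_Mapping.single m c)" "graded w' s' l' (Poly_Mapping.single m' c')" for m m' c c'
    unfolding mult_single graded_single
  proof (intro allI impI)
    fix i assume "coeff (c * c') i \<noteq> 0"
    then obtain j where "j \<le> i" "coeff c j \<noteq> 0" "coeff c' (i - j) \<noteq> 0"
      unfolding coeff_mult by (metis (no_types, lifting) atMost_iff mult_zero_left mult_zero_right sum.neutral)
    then have "even j \<and> int (mon_weight m) + 2 * int (mon_degree m) = int j + w \<and>
        int j + s \<le> int (mon_degree m) \<and> l \<le> mon_degree m"
      "even (i - j) \<and> int (mon_weight m') + 2 * int (mon_degree m') = int (i - j) + w' \<and>
        int (i - j) + s' \<le> int (mon_degree m') \<and> l' \<le> mon_degree m'"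
      using that unfolding graded_single by blast+
    with \<open>j \<le> i\<close> show "even i \<and> int (mon_weight (m + m')) + 2 * int (mon_degree (m + m')) = int i + (w + w') \<and>
       int i + (s + s') \<le> int (mon_degree (m + m')) \<and> l + l' \<le> mon_degree (m + m')"
      unfolding mon_degree_eq mon_sum_add by auto
  qed
  have "p * q = (\<Sum>m\<in>Poly_Mapping.keys p. \<Sum>m'\<in>Poly_Mapping.keys q.
      Poly_Mapping.single m (Poly_Mapping.lookup p m) * Poly_Mapping.single m' (Poly_Mapping.lookup q m'))"
    by (subst (1) dpoly_sum_single[of p], subst (1) dpoly_sum_single[of q]) (rule sum_product)
  then show ?thesis
    using assms by (simp only:) (intro graded_sum single graded_component)
qed

lemma graded_tderiv:
  assumes "graded w s l p"
  shows "graded (w + 1) s l (tderiv p)"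
  unfolding tderiv_altdef tderiv_mon_def
proof (intro graded_sum)
  fix m v assume v: "v \<in> Poly_Mapping.keys (m :: jet \<Rightarrow>\<^sub>0 nat)"
  have *: "coeff (of_nat k * c) i \<noteq> 0 \<Longrightarrow> coeff c i \<noteq> 0" for k i and c :: "real poly"
    by (induction k) (auto simp: distrib_right)
  show "graded (w + 1) s l (Poly_Mapping.single (raise m v)
      (of_nat (Poly_Mapping.lookup m v) * Poly_Mapping.lookup p m))"
    unfolding graded_single mon_degree_raise[OF v] mon_weight_raise[OF v]
  proof (intro allI impI)
    fix i assume "coeff (of_nat (Poly_Mapping.lookup m v) * Poly_Mapping.lookup p m) i \<noteq> 0"
    from *[OF this] assms have "even i \<and> int (mon_weight m) + 2 * int (mon_degree m) = int i + w \<and>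
        int i + s \<le> int (mon_degree m) \<and> l \<le> mon_degree m"
      unfolding graded_def by blast
    then show "even i \<and> int (Suc (mon_weight m)) + 2 * int (mon_degree m) = int i + (w + 1) \<and>
        int i + s \<le> int (mon_degree m) \<and> l \<le> mon_degree m"
      by simp
  qed
qed

lemma graded_W: "graded (2 + int j) 1 1 (W x j)"
  by (auto simp: W_def graded_single mon_degree_eq coeff_1)

lemma graded_cst: "graded 0 0 0 (cst [:a:])" and graded_eps2: "graded (-2) (-2) 0 (cst [:0, 0, a:])"
  by (auto simp: cst_def graded_single mon_degree_eq coeff_pCons split: nat.splits)

text \<open>The series variable has weight -1, hence the shift by k; the cutoff n is for induction
  on the number of known coefficients.\<close>

definition fgraded :: "nat \<Rightarrow> int \<Rightarrow> int \<Rightarrow> nat \<Rightarrow> real poly dpoly fps \<Rightarrow> bool" where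
  "fgraded n w s l f \<longleftrightarrow> (\<forall>k<n. graded (w + int k) s l (fps_nth f k))"

lemma fgraded_add: "fgraded n w s l f \<Longrightarrow> fgraded n w s l g \<Longrightarrow> fgraded n w s l (f + g)"
  and fgraded_diff: "fgraded n w s l f \<Longrightarrow> fgraded n w s l g \<Longrightarrow> fgraded n w s l (f - g)"
  and fgraded_uminus: "fgraded n w s l f \<Longrightarrow> fgraded n w s l (- f)"
  by (simp_all add: fgraded_def graded_add graded_diff graded_uminus)

lemma fgraded_weaken: "fgraded n w s l f \<Longrightarrow> w = w' \<Longrightarrow> s' \<le> s \<Longrightarrow> l' \<le> l \<Longrightarrow> fgraded n w' s' l' f"
  unfolding fgraded_def using graded_weaken[OF _ refl] by blast

lemma fgraded_mult:
  assumes "fgraded n w s l f" "fgraded n w' s' l' g"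
  shows "fgraded n (w + w') (s + s') (l + l') (f * g)"
  unfolding fgraded_def fps_mult_nth
proof (intro allI impI graded_sum)
  fix k i assume k: "k < n" "i \<in> {0..k}"
  then have "i < n" "k - i < n" by auto
  with assms have "graded (w + int i) s l (fps_nth f i)" "graded (w' + int (k - i)) s' l' (fps_nth g (k - i))"
    unfolding fgraded_def by blast+
  from graded_mult[OF this] show "graded (w + w' + int k) (s + s') (l + l') (fps_nth f i * fps_nth g (k - i))"
    by (rule graded_weaken) (use k in auto)
qed

lemma fgraded_tderiv:
  assumes "fgraded n w s l f"
  shows "fgraded n (w + 1) s l (fps_tderiv f)"
  unfolding fgraded_def fps_tderiv_nth
proof (intro allI impI)
  fix k assume "k < n"
  then have "graded (w + int k) s l (fps_nth f k)" using assms by (simp add: fgraded_def)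
  from graded_tderiv[OF this] show "graded (w + 1 + int k) s l (tderiv (fps_nth f k))"
    by (simp only: ac_simps)
qed

lemma fgraded_X_mult: "fgraded n w s l f \<Longrightarrow> fgraded (Suc n) (w - 1) s l (fps_X * f)"
  unfolding fgraded_def
proof (intro allI impI)
  fix k assume *: "\<forall>k<n. graded (w + int k) s l (fps_nth f k)" "k < Suc n"
  show "graded (w - 1 + int k) s l (fps_nth (fps_X * f) k)"
  proof (cases k)
    case (Suc j)
    then have "graded (w + int j) s l (fps_nth f j)" using * by simp
    then show ?thesis using Suc by simp
  qed simp
qed

lemma fgraded_const: "graded w s l c \<Longrightarrow> fgraded n w s l (fps_const c)"
  by (auto simp: fgraded_def)

lemma fgraded_1: "fgraded n 0 0 0 1"
  using graded_cst[of 1] fgraded_const[of 0 0 0 1] by (simp add: pCons_one)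

lemma fgraded_X: "fgraded n (-1) 0 0 fps_X"
proof (cases n)
  case (Suc k)
  then show ?thesis using fgraded_X_mult[OF fgraded_1[of k]] by simp
qed (simp add: fgraded_def)

lemma fgraded_double: "fgraded n w s l f \<Longrightarrow> fgraded n w s l (2 * f)"
  unfolding mult_2 by (rule fgraded_add)

context formal_solution
begin

text \<open>The four triples are those for which the system closes when z is given weight -1 and
  counted as one power of \<epsilon>: be and de then exceed al and ga by one in the first two
  entries. The deficit 2 of \<epsilon>^2 is paid by \<open>be * be\<close> or
  \<open>Wm * Wp\<close>, the deficit 1 of \<open>ga\<close> by its factor from
  \<open>Wp\<close>.\<close>

lemma fgraded_solution:
  "fgraded n 1 0 1 al \<and> fgraded n 2 1 1 be \<and> fgraded n (-1) (-1) 0 ga \<and> fgraded n 0 0 0 de"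
proof (induction n)
  case 0
  show ?case by (simp add: fgraded_def)
next
  case (Suc n)
  then have IH: "fgraded n 1 0 1 al" "fgraded n 2 1 1 be" "fgraded n (-1) (-1) 0 ga" "fgraded n 0 0 0 de"
    by auto
  have P: "fgraded k 2 1 1 fWp" and M: "fgraded k 2 1 1 fWm" and P': "fgraded k 3 1 1 fWp'" for k
    using fgraded_const[OF graded_W[of 0 WPlus]] fgraded_const[OF graded_W[of 0 WMinus]]
      fgraded_const[OF graded_W[of 1 WPlus]] by simp_all
  have h: "fgraded k 0 0 0 half" and e: "fgraded k (-2) (-2) 0 eps2" for k
    by (rule fgraded_const, rule graded_cst graded_eps2)+
  note mult = fgraded_mult[THEN fgraded_weaken]
  have he: "fgraded k (-2) (-2) 0 (half * eps2)" for k by (rule mult[OF h e]) simp_all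
  have XX: "fgraded k (-2) 0 0 (fps_X * fps_X)" for k by (rule mult[OF fgraded_X fgraded_X]) simp_all
  have bb: "fgraded n 4 2 2 (be * be)" by (rule mult[OF IH(2) IH(2)]) simp_all
  have "fgraded n 2 0 1 (fps_tderiv al + al * al + (fps_X * fps_X - half * eps2) * (be * be) + fWp' * ga)"
    unfolding left_diff_distrib
    by (intro fgraded_add fgraded_diff)
      (rule fgraded_tderiv[OF IH(1), THEN fgraded_weaken] mult[OF IH(1) IH(1)] mult[OF XX bb]
        mult[OF he bb] mult[OF P' IH(3)]; simp)+
  then have 1: "fgraded (Suc n) 1 0 1 (fps_X * (fps_tderiv al + al * al + (fps_X * fps_X - half * eps2) * (be * be) + fWp' * ga))"
    by (rule fgraded_X_mult[THEN fgraded_weaken]) simp_all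
  have eXMP: "fgraded k 1 0 2 (eps2 * fps_X * fWm * fWp)" for k
    by (rule mult[OF mult[OF mult[OF e fgraded_X refl order_refl order_refl] M refl order_refl order_refl] P]) simp_all
  have XPM: "fgraded k 1 1 1 (fps_X * (fWp - fWm))" for k
    by (rule mult[OF fgraded_X fgraded_diff[OF P M]]) simp_all
  have "fgraded k 1 0 1 (eps2 * fps_X * fWm * fWp - fps_X * (fWp - fWm))" for k
    by (rule fgraded_diff; rule eXMP[THEN fgraded_weaken] XPM[THEN fgraded_weaken]; simp)
  from mult[OF h this] have 2: "fgraded (Suc n) 1 0 1 (half * (eps2 * fps_X * fWm * fWp - fps_X * (fWp - fWm)))"
    by simp
  have al': "fgraded (Suc n) 1 0 1 al"
    by (subst al) (rule fgraded_add[OF 1 2])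
  have "fgraded n 3 1 1 (fps_tderiv be + 2 * (al * be) + fWp' * de)"
    by (intro fgraded_add fgraded_double)
      (rule fgraded_tderiv[OF IH(2), THEN fgraded_weaken] mult[OF IH(1) IH(2)] mult[OF P' IH(4)]; simp)+
  then have 3: "fgraded (Suc n) 2 1 1 (fps_X * (fps_tderiv be + 2 * (al * be) + fWp' * de))"
    by (rule fgraded_X_mult[THEN fgraded_weaken]) simp_all
  have be': "fgraded (Suc n) 2 1 1 be"
    by (subst be) (rule fgraded_add[OF 3 mult[OF h fgraded_add[OF P M]]]; simp)
  have "fgraded n 1 0 1 (2 * (al + fWp * ga))"
    by (intro fgraded_double fgraded_add IH(1) mult[OF P IH(3)]) simp_all
  from fgraded_weaken[OF fgraded_X_mult[OF this], of 0 0 0]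
  have "fgraded (Suc n) 0 0 0 (fps_X * (2 * (al + fWp * ga)))" by simp
  then have c: "fgraded (Suc n) 0 0 0 (1 - fps_X * (2 * (al + fWp * ga)))"
    by (rule fgraded_diff[OF fgraded_1])
  have "fgraded n 2 1 1 (2 * (be + fWp * de))"
    by (intro fgraded_double fgraded_add IH(2) mult[OF P IH(4)]) simp_all
  then have d: "fgraded (Suc n) 1 1 1 (fps_X * (2 * (be + fWp * de)))"
    by (rule fgraded_X_mult[THEN fgraded_weaken]) simp_all
  have ga': "fgraded (Suc n) (-1) (-1) 0 ga"
    by (subst ga, unfold left_diff_distrib, intro fgraded_add fgraded_diff)
      (rule mult[OF fgraded_X c] mult[OF XX d] mult[OF he d]; simp)+
  have de': "fgraded (Suc n) 0 0 0 de"
    by (subst de, intro fgraded_diff fgraded_uminus c) (rule mult[OF fgraded_X d]; simp)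
  from al' be' ga' de' show ?case by blast
qed

lemma graded_al: "graded (1 + int n) 0 1 (fps_nth al n)"
  and graded_be: "graded (2 + int n) 1 1 (fps_nth be n)"
  using fgraded_solution[of "Suc n"] by (auto simp: fgraded_def)

end

subsection \<open>Homogeneous components\<close>

definition hom_part :: "nat \<Rightarrow> 'a::comm_ring_1 dpoly \<Rightarrow> 'a dpoly" where
  "hom_part d p = (\<Sum>m\<in>{m\<in>Poly_Mapping.keys p. mon_degree m = d}.
     Poly_Mapping.single m (Poly_Mapping.lookup p m))"

lemma lookup_hom_part [simp]:
  "Poly_Mapping.lookup (hom_part d p) m = (if mon_degree m = d then Poly_Mapping.lookup p m else 0)"
  by (auto simp: hom_part_def lookup_sum lookup_single when_def sum.delta in_keys_iff)

lemma hom_part_add: "hom_part d (p + q) = hom_part d p + hom_part d q"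
  and hom_part_diff: "hom_part d (p - q) = hom_part d p - hom_part d q"
  and hom_part_uminus: "hom_part d (- p) = - hom_part d p"
  and hom_part_0: "hom_part d 0 = 0"
  and hom_part_single: "hom_part d (Poly_Mapping.single m c) = (if mon_degree m = d then Poly_Mapping.single m c else 0)"
  by (rule poly_mapping_eqI, simp add: lookup_add lookup_minus lookup_single when_def)+

lemma hom_part_sum: "hom_part d (sum f I) = (\<Sum>i\<in>I. hom_part d (f i))"
  by (induction I rule: infinite_finite_induct) (simp_all add: hom_part_add hom_part_0)

lemma hom_part_mult: "hom_part d (p * q) = (\<Sum>i\<le>d. hom_part i p * hom_part (d - i) q)"
proof (induction p rule: dpoly_induct)
  case (single m c)
  show ?case
  proof (induction q rule: dpoly_induct)
    case (single m' c')
    have "(\<Sum>i\<le>d. hom_part i (Poly_Mapping.single m c) * hom_part (d - i) (Poly_Mapping.single m' c')) =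
        (\<Sum>i\<le>d. if i = mon_degree m then
          (if mon_degree m' = d - i then Poly_Mapping.single m c * Poly_Mapping.single m' c' else 0) else 0)"
      by (intro sum.cong) (auto simp: hom_part_single)
    also have "\<dots> = (if mon_degree m + mon_degree m' = d then Poly_Mapping.single m c * Poly_Mapping.single m' c' else 0)"
      by (auto simp: sum.delta)
    finally show ?case
      by (simp add: mult_single hom_part_single mon_degree_eq mon_sum_add)
  qed (simp add: distrib_left hom_part_add sum.distrib)
qed (simp add: distrib_right hom_part_add sum.distrib)

lemma hom_part_tderiv: "hom_part d (tderiv p) = tderiv (hom_part d p)"
proof (induction p rule: dpoly_induct)
  case (single m c)
  have "hom_part d (tderiv_mon m c) = (if mon_degree m = d then tderiv_mon m c else 0)"
    unfolding tderiv_mon_def hom_part_sum by (auto simp: hom_part_single mon_degree_raise intro!: sum.cong)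
  then show ?case by (simp add: tderiv_single hom_part_single)
qed (simp add: tderiv_add hom_part_add)

lemma hom_part_W: "hom_part d (W x j) = (if d = 1 then W x j else 0)"
  by (auto simp: W_def hom_part_single mon_degree_eq)

lemma hom_part_cst: "hom_part d (cst c) = (if d = 0 then cst c else 0)"
  by (auto simp: cst_def hom_part_single mon_degree_eq)

definition fhom_part :: "nat \<Rightarrow> 'a::comm_ring_1 dpoly fps \<Rightarrow> 'a dpoly fps" where
  "fhom_part d f = Abs_fps (\<lambda>n. hom_part d (fps_nth f n))"

lemma fhom_part_nth [simp]: "fps_nth (fhom_part d f) n = hom_part d (fps_nth f n)"
  by (simp add: fhom_part_def)

lemma fhom_part_add: "fhom_part d (f + g) = fhom_part d f + fhom_part d g"
  and fhom_part_diff: "fhom_part d (f - g) = fhom_part d f - fhom_part d g"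
  and fhom_part_uminus: "fhom_part d (- f) = - fhom_part d f"
  and fhom_part_tderiv: "fhom_part d (fps_tderiv f) = fps_tderiv (fhom_part d f)"
  by (rule fps_ext, simp add: hom_part_add hom_part_diff hom_part_uminus hom_part_tderiv)+

lemma fhom_part_mult: "fhom_part d (f * g) = (\<Sum>i\<le>d. fhom_part i f * fhom_part (d - i) g)"
proof (rule fps_ext)
  fix n
  have "fps_nth (fhom_part d (f * g)) n =
      (\<Sum>j=0..n. \<Sum>i\<le>d. hom_part i (fps_nth f j) * hom_part (d - i) (fps_nth g (n - j)))"
    by (simp add: fps_mult_nth hom_part_sum hom_part_mult)
  also have "\<dots> = (\<Sum>i\<le>d. \<Sum>j=0..n. hom_part i (fps_nth f j) * hom_part (d - i) (fps_nth g (n - j)))"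
    by (rule sum.swap)
  finally show "fps_nth (fhom_part d (f * g)) n = fps_nth (\<Sum>i\<le>d. fhom_part i f * fhom_part (d - i) g) n"
    by (simp add: fps_sum_nth fps_mult_nth)
qed

lemma fhom_part_const: "fhom_part d (fps_const c) = fps_const (hom_part d c)"
  by (rule fps_ext) (simp add: hom_part_0)

lemma fhom_part_mult_0: "fhom_part 0 (f * g) = fhom_part 0 f * fhom_part 0 g"
  and fhom_part_mult_1: "fhom_part 1 (f * g) = fhom_part 0 f * fhom_part 1 g + fhom_part 1 f * fhom_part 0 g"
  and fhom_part_mult_2: "fhom_part 2 (f * g) =
    fhom_part 0 f * fhom_part 2 g + fhom_part 1 f * fhom_part 1 g + fhom_part 2 f * fhom_part 0 g"
  by (simp_all add: fhom_part_mult atMost_Suc numeral_2_eq_2 add_ac)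

lemma fhom_part_fWp: "fhom_part d (fps_const (W x j)) = (if d = 1 then fps_const (W x j) else 0)"
  by (simp add: fhom_part_const hom_part_W)

lemma fhom_part_fcst: "fhom_part d (fcst c) = (if d = 0 then fcst c else 0)"
  by (simp add: fhom_part_const hom_part_cst)

lemma fhom_part_1: "fhom_part d (1 :: 'a::comm_ring_1 dpoly fps) = (if d = 0 then 1 else 0)"
  using fhom_part_fcst[of d "1 :: 'a"] by simp

lemma fhom_part_2: "fhom_part d (2 :: 'a::comm_ring_1 dpoly fps) = (if d = 0 then 2 else 0)"
  using fhom_part_fcst[of d "2 :: 'a"] by (simp add: numeral_fps_const)

lemma fhom_part_X: "fhom_part d (fps_X :: 'a::comm_ring_1 dpoly fps) = (if d = 0 then fps_X else 0)"
proof (rule fps_ext)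
  fix n
  have "hom_part d (1 :: 'a dpoly) = (if d = 0 then 1 else 0)"
    using hom_part_cst[of d "1 :: 'a"] by simp
  then show "fps_nth (fhom_part d (fps_X :: 'a dpoly fps)) n = fps_nth (if d = 0 then fps_X else 0) n"
    by (auto simp: fps_X_def hom_part_0)
qed

lemmas fhom_part_simps = fhom_part_add fhom_part_diff fhom_part_uminus fhom_part_tderiv
  fhom_part_mult_0 fhom_part_mult_1 fhom_part_mult_2 fhom_part_fWp fhom_part_fcst fhom_part_1
  fhom_part_2 fhom_part_X

subsection \<open>Expansion in \<open>\<epsilon>\<^sup>2\<close>\<close>

text \<open>Setting \<epsilon> = 0 inside the polynomial type, so that being free of \<epsilon>
  means being fixed by \<open>eps0.dmap\<close>.\<close>

interpretation eps0: coeff_hom "\<lambda>c :: real poly. [:coeff c 0:]"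
  by unfold_locales (simp_all add: coeff_mult_0)

interpretation shift: coeff_additive "poly_shift 2 :: real poly \<Rightarrow> real poly"
  by unfold_locales (rule poly_eqI, simp add: coeff_poly_shift)

abbreviation eps_shift :: "real poly dpoly \<Rightarrow> real poly dpoly" where
  "eps_shift \<equiv> Poly_Mapping.map (poly_shift 2)"

lemma eps_shift_free:
  assumes "eps0.dmap p = p"
  shows "eps_shift p = 0"
proof -
  have "eps_shift (eps0.dmap p) = 0"
    by (rule poly_mapping_eqI) (auto intro!: poly_eqI simp: coeff_poly_shift coeff_pCons split: nat.splits)
  then show ?thesis by (simp only: assms)
qed

lemma eps_shift_mult_eps2: "eps_shift (cst [:0, 0, 1:] * p) = p"
proof (rule poly_mapping_eqI)
  fix m
  have "poly_shift 2 ([:0, 0, 1:] * c) = c" for c :: "real poly"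
    by (rule poly_eqI) (simp add: coeff_poly_shift)
  then show "Poly_Mapping.lookup (eps_shift (cst [:0, 0, 1:] * p)) m = Poly_Mapping.lookup p m"
    by (simp only: shift.lookup_dmap lookup_cst_mult)
qed

text \<open>The grading allows even powers of \<epsilon> only, so the difference from the value at 0
  is divisible by \<epsilon>^2 and not just by \<epsilon>.\<close>

lemma eval_eps_shift:
  assumes "graded w s l p"
  shows "eval_eps \<epsilon> p = eval_eps 0 p + cst (complex_of_real (\<epsilon>\<^sup>2)) * eval_eps \<epsilon> (eps_shift p)"
proof (rule poly_mapping_eqI)
  fix m
  define c where "c = Poly_Mapping.lookup p m"
  have c1: "coeff c 1 = 0" using assms unfolding graded_def c_def by (metis odd_one)
  have "c = [:coeff c 0:] + [:0, 0, 1:] * poly_shift 2 c"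
  proof (rule poly_eqI)
    fix i
    show "coeff c i = coeff ([:coeff c 0:] + [:0, 0, 1:] * poly_shift 2 c) i"
      using c1 by (cases i; cases "i - 1") (auto simp: coeff_poly_shift coeff_pCons split: nat.splits)
  qed
  then have "poly c \<epsilon> = poly ([:coeff c 0:] + [:0, 0, 1:] * poly_shift 2 c) \<epsilon>" by (rule arg_cong)
  then have "poly c \<epsilon> = poly c 0 + \<epsilon>\<^sup>2 * poly (poly_shift 2 c) \<epsilon>"
    by (simp add: poly_0_coeff_0 power2_eq_square)
  then have "complex_of_real (poly c \<epsilon>) =
      complex_of_real (poly c 0) + complex_of_real (\<epsilon>\<^sup>2) * complex_of_real (poly (poly_shift 2 c) \<epsilon>)"
    by (simp only: of_real_add of_real_mult)
  then show "Poly_Mapping.lookup (eval_eps \<epsilon> p) m =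
     Poly_Mapping.lookup (eval_eps 0 p + cst (complex_of_real (\<epsilon>\<^sup>2)) * eval_eps \<epsilon> (eps_shift p)) m"
    by (simp only: lookup_add lookup_cst_mult eval_eps.lookup_dmap shift.lookup_dmap c_def)
qed

lemma hom_part_eps_shift: "hom_part d (eps_shift p) = eps_shift (hom_part d p)"
  by (rule poly_mapping_eqI) simp

text \<open>The exponent i is the one in \<open>p\<close>, before the shift, and is therefore at
  least 2.\<close>

lemma keys_eps_shift:
  assumes "graded w s l p" "m \<in> Poly_Mapping.keys (eps_shift p)"
  obtains i where "even i" "2 \<le> i" "int (mon_weight m) + 2 * int (mon_degree m) = int i + w"
    "int i + s \<le> int (mon_degree m)"
proof -
  have "poly_shift 2 (Poly_Mapping.lookup p m) \<noteq> 0" using assms(2) by (simp add: in_keys_iff)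
  then obtain j where "coeff (Poly_Mapping.lookup p m) (j + 2) \<noteq> 0"
    by (metis coeff_poly_shift leading_coeff_0_iff)
  with assms(1) have "even (j + 2) \<and> int (mon_weight m) + 2 * int (mon_degree m) = int (j + 2) + w \<and>
      int (j + 2) + s \<le> int (mon_degree m)"
    unfolding graded_def by blast
  then show ?thesis by (intro that[of "j + 2"]) auto
qed

text \<open>A monomial of degree 1 allows at most the first power of \<epsilon>, and only even
  powers occur.\<close>

lemma hom_part_1_eps_free:
  assumes "graded w s l p" "0 \<le> s"
  shows "eps0.dmap (hom_part 1 p) = hom_part 1 p"
proof (rule poly_mapping_eqI)
  fix m
  show "Poly_Mapping.lookup (eps0.dmap (hom_part 1 p)) m = Poly_Mapping.lookup (hom_part 1 p) m"
  proof (cases "mon_degree m = 1")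
    case True
    have "coeff (Poly_Mapping.lookup p m) i = 0" if "i > 0" for i
    proof (rule ccontr)
      assume "coeff (Poly_Mapping.lookup p m) i \<noteq> 0"
      then have "even i \<and> int i + s \<le> int (mon_degree m)" using assms(1) unfolding graded_def by blast
      then have "even i" "int i + s \<le> 1" using True by simp_all
      with \<open>0 \<le> s\<close> \<open>i > 0\<close> show False by auto
    qed
    then have "[:coeff (Poly_Mapping.lookup p m) 0:] = Poly_Mapping.lookup p m"
      by (intro poly_eqI) (auto simp: coeff_pCons split: nat.splits)
    then show ?thesis using True by simp
  qed simp
qed

lemma hom_part_0_eq_0:
  assumes "graded w s 1 p"
  shows "hom_part 0 p = 0"
proof (rule poly_mapping_eqI)
  fix m
  have "Poly_Mapping.lookup p m = 0" if "mon_degree m = 0"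
    using assms that unfolding graded_def by (intro poly_eqI) force
  then show "Poly_Mapping.lookup (hom_part 0 p) m = Poly_Mapping.lookup 0 m" by simp
qed

subsection \<open>The quadratic part\<close>

lemma sum_uminus_one_even: "(\<Sum>i\<le>2 * n. (-1) ^ i) = (1 :: 'a::comm_ring_1)"
  by (induction n) (simp_all add: numeral_2_eq_2)

text \<open>Each summand is (-1)^i D_0 D_2n after i integrations by parts. The 2n+1 alternating
  signs add up to 1, and D_0 D_2n is (-1)^n times the middle square.\<close>

lemma square_of_derivatives:
  fixes D :: "nat \<Rightarrow> 'a::comm_ring_1 dpoly"
  assumes D: "\<And>i. tderiv (D i) = D (Suc i)"
  shows "(\<Sum>i\<le>2 * n. D i * D (2 * n - i)) \<simeq> cst ((-1) ^ n) * (D n * D n)"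
proof -
  have *: "D i * D (2 * n - i) \<simeq> cst ((-1) ^ i) * (D 0 * D (2 * n))" if "i \<le> 2 * n" for i
    using that
  proof (induction i)
    case (Suc i)
    then obtain k where k: "2 * n - i = Suc k" "2 * n - Suc i = k" by (metis Suc_diff_Suc Suc_le_lessD)
    have "D (Suc i) * D (2 * n - Suc i) = tderiv (D i) * D k" by (simp add: D k)
    also have "\<dots> \<simeq> - (D i * tderiv (D k))" by (rule same_integral_by_parts)
    also have "- (D i * tderiv (D k)) = - (D i * D (2 * n - i))" by (simp add: D k)
    also have "\<dots> \<simeq> - (cst ((-1) ^ i) * (D 0 * D (2 * n)))"
      using Suc by (intro same_integral_uminus) simp
    also have "\<dots> = cst ((-1) ^ Suc i) * (D 0 * D (2 * n))" by (simp add: cst_uminus)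
    finally show ?case .
  qed simp
  have "(\<Sum>i\<le>2 * n. D i * D (2 * n - i)) \<simeq> (\<Sum>i\<le>2 * n. cst ((-1) ^ i) * (D 0 * D (2 * n)))"
    by (intro same_integral_sum *) simp
  also have "\<dots> = D 0 * D (2 * n)"
    by (simp only: sum_distrib_right[symmetric] cst_sum[symmetric] sum_uminus_one_even cst_1 mult_1_left)
  finally have 1: "(\<Sum>i\<le>2 * n. D i * D (2 * n - i)) \<simeq> D 0 * D (2 * n)" .
  have "cst ((-1) ^ n) * (D n * D n) \<simeq> cst ((-1) ^ n) * (cst ((-1) ^ n) * (D 0 * D (2 * n)))"
    using *[of n] by (intro same_integral_cst) (simp add: mult_2)
  also have "\<dots> = D 0 * D (2 * n)"
    by (simp only: mult.assoc[symmetric] cst_mult[symmetric] power_mult_distrib[symmetric]) simp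
  finally show ?thesis using 1 same_integral_sym same_integral_trans by blast
qed

context formal_solution
begin

text \<open>In degree 2 the equation for \<open>al\<close> involves, besides its own derivative,
  only linear parts, which are explicit. The constant -1/8 is the -1/2 from z^2 = t^2 -
  \<epsilon>^2/2 times the square of the 1/2 in b1 = eta/2 + P.\<close>

lemma quadratic_part:
  "hom_part 2 (eps_shift (fps_nth al (2 * n + 1))) \<simeq>
     cst [:- (1 / 8) * (-1) ^ n:] * (W WPlus n - W WMinus n)\<^sup>2"
proof -
  define a1 b1 a2 c1 where "a1 = fhom_part 1 al" and "b1 = fhom_part 1 be"
    and "a2 = fhom_part 2 al" and "c1 = fhom_part 1 ga"
  define P M P' X h e :: "real poly dpoly fps"
    where "P = fWp" and "M = fWm" and "P' = fWp'" and "X = fps_X" and "h = half" and "e = eps2"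
  have al0: "fhom_part 0 al = 0" and be0: "fhom_part 0 be = 0"
    using hom_part_0_eq_0[OF graded_al] hom_part_0_eq_0[OF graded_be] by (simp_all add: fps_eq_iff)
  have ga0: "fhom_part 0 ga = X"
    using arg_cong[OF ga, of "fhom_part 0"] by (simp add: fhom_part_simps al0 be0 X_def)
  have de0: "fhom_part 0 de = - 1"
    using arg_cong[OF de, of "fhom_part 0"] by (simp add: fhom_part_simps al0 be0)
  have b1: "b1 = X * fps_tderiv b1 - X * P' + h * (P + M)"
    using arg_cong[OF be, of "fhom_part 1"]
    by (simp add: fhom_part_simps al0 be0 de0 b1_def X_def P'_def h_def P_def M_def
        del: fps_const_add fps_const_neg fps_const_mult One_nat_def)
      (simp add: algebra_simps del: fps_const_add fps_const_neg fps_const_mult)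
  have c1: "c1 = - (X * (X * (2 * (a1 + P * X)))) + (X * X - h * e) * (X * (2 * (b1 - P)))"
    using arg_cong[OF ga, of "fhom_part 1"]
    by (simp add: fhom_part_simps al0 be0 ga0 de0 a1_def b1_def c1_def X_def h_def e_def P_def del: fps_const_mult fps_const_neg One_nat_def)
  have a2: "a2 = X * (fps_tderiv a2 + a1 * a1 + (X * X - h * e) * (b1 * b1) + P' * c1) + h * (e * X * M * P)"
    using arg_cong[OF al, of "fhom_part 2"]
    by (simp add: fhom_part_simps al0 be0 a1_def b1_def a2_def c1_def X_def h_def e_def P_def M_def P'_def
        del: fps_const_mult fps_const_neg fps_const_sub One_nat_def)
  have "2 * [:1/2:] = (1 :: real poly)" by (simp add: numeral_poly one_pCons)
  then have "2 * cst [:1/2:] = (1 :: real poly dpoly)"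
    by (simp only: cst_numeral[symmetric] cst_mult[symmetric] cst_1)
  then have h2: "2 * h = 1" by (simp add: h_def numeral_fps_const)
  have dP: "fps_tderiv P = P'" by (simp add: P_def P'_def)
  have dh: "fps_tderiv h = 0" "fps_tderiv X = 0" by (simp_all add: h_def X_def)
  \<comment> \<open>Normalized so that the only source in its equation is M - P; its coefficients
    are then the derivatives of W_- - W_+.\<close>
  define eta where "eta = 2 * (b1 - P)"
  have eta: "eta = X * fps_tderiv eta + (M - P)"
  proof -
    have "eta = 2 * (X * fps_tderiv b1 - X * P') + (2 * h) * (P + M) - 2 * P"
      unfolding eta_def by (subst b1) (simp add: algebra_simps)
    also have "2 * (X * fps_tderiv b1 - X * P') = X * fps_tderiv eta"
      by (simp add: eta_def fps_tderiv_simps dP algebra_simps)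
    finally show ?thesis by (simp add: h2 add_diff_eq)
  qed
  have eta_nth: "fps_nth eta i = W WMinus i - W WPlus i" for i
  proof (induction i)
    case 0
    show ?case by (subst eta) (simp add: X_def M_def P_def)
  next
    case (Suc i)
    show ?case by (subst eta) (simp add: X_def M_def P_def Suc tderiv_diff)
  qed
  \<comment> \<open>The quadratic part splits into a total derivative, the \<epsilon>-free
    \<open>A0\<close> that the shift annihilates, and \<epsilon>^2 times \<open>Y\<close>.\<close>
  define A0 where "A0 = X * (a1 * a1 + X * X * (b1 * b1) + P' * (- (X * (X * (2 * (a1 + P * X)))) + X * X * (X * (2 * (b1 - P)))))"
  define Y where "Y = h * (X * (M * P)) - h * (X * (b1 * b1)) - X * (P' * (X * (b1 - P)))"
  have a2': "a2 = X * fps_tderiv a2 + A0 + e * Y"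
  proof -
    have "a2 = X * fps_tderiv a2 + A0 + e * (h * (X * (M * P)) - h * (X * (b1 * b1)) - (2 * h) * (X * (P' * (X * (b1 - P)))))"
      by (subst a2) (simp add: A0_def c1 algebra_simps)
    then show ?thesis by (simp only: h2 Y_def mult_1_left)
  qed
  \<comment> \<open>In terms of eta, everything except the square of eta assembles into a total
    derivative, by M - P = eta - X eta_X.\<close>
  have Y: "Y = - (h * h * h * (X * (eta * eta))) - fps_tderiv (h * (X * (X * (eta * P))))"
  proof -
    have b1': "b1 = h * eta + P"
      unfolding eta_def by (simp only: mult.assoc[symmetric] mult.commute[of h 2] h2) simp
    have MP: "M - P = eta - X * fps_tderiv eta"
      using eta by (metis add_diff_cancel_left')
    have "Y = h * (X * (M * P)) - h * h * h * (X * (eta * eta)) - (2 * h) * (h * (X * (eta * P)))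
        - h * (X * (P * P)) - h * (X * (X * (P' * eta)))"
      unfolding Y_def b1' by (simp add: algebra_simps)
    also have "\<dots> = - (h * h * h * (X * (eta * eta))) + h * (X * ((M - P) * P - eta * P - X * (eta * P')))"
      by (simp only: h2) (simp add: algebra_simps)
    also have "(M - P) * P - eta * P - X * (eta * P') = - (X * fps_tderiv (eta * P))"
      unfolding MP by (simp add: fps_tderiv_mult dP algebra_simps)
    finally have "Y = - (h * h * h * (X * (eta * eta))) - h * (X * (X * fps_tderiv (eta * P)))"
      by (simp only: mult_minus_right add_uminus_conv_diff)
    moreover have "fps_tderiv (h * (X * (X * (eta * P)))) = h * (X * (X * fps_tderiv (eta * P)))"
      by (simp only: fps_tderiv_mult[of h] fps_tderiv_mult[of X] dh mult_zero_left add_0_left)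
    ultimately show ?thesis by (simp only:)
  qed
  have free: "eps0.fmap a1 = a1" "eps0.fmap b1 = b1"
    by (rule fps_ext, simp add: a1_def b1_def hom_part_1_eps_free[OF graded_al]
        hom_part_1_eps_free[OF graded_be] del: One_nat_def)+
  have "eps0.fmap A0 = A0"
    unfolding A0_def
    by (simp only: eps0.fmap_simps free X_def P_def P'_def eps0.fmap_X eps0.fmap_const eps0.dmap_W
        eps0.fmap_numeral)
  then have A0: "eps0.dmap (fps_nth A0 k) = fps_nth A0 k" for k
    by (metis eps0.fmap_nth)
  define T where "T = h * (X * (X * (eta * P)))"
  have "fps_nth a2 (2 * n + 1) = tderiv (fps_nth a2 (2 * n)) + fps_nth A0 (2 * n + 1)
      + cst [:0, 0, 1:] * fps_nth Y (2 * n + 1)"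
    by (subst a2') (simp add: X_def e_def)
  then have "hom_part 2 (eps_shift (fps_nth al (2 * n + 1))) =
      eps_shift (tderiv (fps_nth a2 (2 * n))) + eps_shift (fps_nth A0 (2 * n + 1)) + fps_nth Y (2 * n + 1)"
    by (simp only: hom_part_eps_shift a2_def fhom_part_nth shift.dmap_add eps_shift_mult_eps2)
  also have "eps_shift (fps_nth A0 (2 * n + 1)) = 0" by (rule eps_shift_free[OF A0])
  also have "fps_nth Y (2 * n + 1) = - (cst [:1/8:] * (\<Sum>i\<le>2 * n. fps_nth eta i * fps_nth eta (2 * n - i)))
      - tderiv (fps_nth T (2 * n + 1))"
  proof -
    have "h * h * h = fcst [:1/8:]" by (simp add: h_def flip: cst_mult)
    then show ?thesis
      unfolding Y T_def[symmetric] by (simp add: X_def fps_mult_nth[of eta eta] atLeast0AtMost)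
  qed
  finally have eq: "hom_part 2 (eps_shift (fps_nth al (2 * n + 1))) =
     tderiv (eps_shift (fps_nth a2 (2 * n)) - fps_nth T (2 * n + 1))
     - cst [:1/8:] * (\<Sum>i\<le>2 * n. fps_nth eta i * fps_nth eta (2 * n - i))"
    by (simp add: shift.dmap_tderiv tderiv_diff)
  have "(\<Sum>i\<le>2 * n. fps_nth eta i * fps_nth eta (2 * n - i)) \<simeq> cst ((-1) ^ n) * (fps_nth eta n * fps_nth eta n)"
    by (rule square_of_derivatives) (simp add: eta_nth tderiv_diff)
  then have "hom_part 2 (eps_shift (fps_nth al (2 * n + 1))) \<simeq>
      0 - cst [:1/8:] * (cst ((-1) ^ n) * (fps_nth eta n * fps_nth eta n))"
    unfolding eq by (intro same_integral_diff same_integral_tderiv same_integral_cst)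
  also have "\<dots> = cst [:- (1 / 8) * (-1) ^ n:] * (W WPlus n - W WMinus n)\<^sup>2"
  proof -
    have sq: "fps_nth eta n * fps_nth eta n = (W WPlus n - W WMinus n)\<^sup>2"
      unfolding eta_nth power2_eq_square by (simp add: algebra_simps)
    have c: "[:- (1 / 8) * (-1) ^ n:] = - ([:1/8:] * (-1 :: real poly) ^ n)"
      by (cases "even n") simp_all
    show ?thesis unfolding sq c by (simp only: cst_uminus cst_mult diff_0 mult_minus_left mult.assoc)
  qed
  finally show ?thesis .
qed

end

subsection \<open>The polynomials \<open>P\<^sub>n\<close>\<close>

lemma order_le_add: "order_le p k \<Longrightarrow> order_le q k \<Longrightarrow> order_le (p + q) k"
  unfolding order_le_def using keys_add[of p q] by blast

lemma order_le_mono: "order_le p k \<Longrightarrow> k \<le> k' \<Longrightarrow> order_le p k'"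
  unfolding order_le_def by force

lemma keys_square_jet_diff:
  fixes c :: "'a::{comm_ring_1}"
  assumes "m \<in> Poly_Mapping.keys (cst c * (W WPlus n - W WMinus n)\<^sup>2)"
  shows "mon_degree m = 2" and "\<forall>v\<in>Poly_Mapping.keys m. snd v = n"
proof -
  define D where "D = (W WPlus n - W WMinus n :: 'a dpoly)"
  have D: "\<exists>s. k = Poly_Mapping.single (s, n) 1" if "k \<in> Poly_Mapping.keys D" for k
  proof -
    have "Poly_Mapping.lookup (W WPlus n) k - Poly_Mapping.lookup (W WMinus n) k \<noteq> (0 :: 'a)"
      using that by (simp add: D_def in_keys_iff lookup_minus)
    then show ?thesis by (auto simp: W_def lookup_single when_def split: if_splits)
  qed
  have "m \<in> Poly_Mapping.keys (D * D)"
    using assms by (auto simp: in_keys_iff power2_eq_square D_def)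
  then have "m \<in> {a + b |a b. a \<in> Poly_Mapping.keys D \<and> b \<in> Poly_Mapping.keys D}"
    using keys_mult[of D D] by blast
  then obtain a b where ab: "m = a + b" "a \<in> Poly_Mapping.keys D" "b \<in> Poly_Mapping.keys D" by blast
  then obtain s t where m: "m = Poly_Mapping.single (s, n) 1 + Poly_Mapping.single (t, n) 1"
    using D[of a] D[of b] by blast
  show "mon_degree m = 2" by (simp add: m mon_degree_eq mon_sum_add)
  show "\<forall>v\<in>Poly_Mapping.keys m. snd v = n"
  proof
    fix v assume "v \<in> Poly_Mapping.keys m"
    then have "v \<in> Poly_Mapping.keys (Poly_Mapping.single (s, n) (1::nat)) \<union>
        Poly_Mapping.keys (Poly_Mapping.single (t, n) (1::nat))"
      unfolding m by (rule subsetD[OF keys_add])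
    then show "snd v = n" by auto
  qed
qed

lemma keys_cst_mult: "Poly_Mapping.keys (cst c * p) \<subseteq> Poly_Mapping.keys (p :: 'a::comm_ring_1 dpoly)"
  by (auto simp: in_keys_iff)

text \<open>The sign -(-1)^n is shared by the Hamiltonians and the KdV energies. The 2 offsets the
  prefactor c/2 and, since \<open>ham_GPt_odd\<close> concerns twice the Hamiltonian, also
  c/4.\<close>

abbreviation alternating :: "nat \<Rightarrow> real poly" where "alternating n \<equiv> [:-2 * (-1) ^ n:]"

context formal_solution
begin

definition P_even :: "nat \<Rightarrow> real poly dpoly" where
  "P_even n = cst (alternating n) * eps_shift (fps_nth al (2 * n + 1))"

definition P_odd :: "nat \<Rightarrow> real poly dpoly" where
  "P_odd n = cst (alternating n) * eps_shift (fps_nth be (2 * n))"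

text \<open>A monomial of degree d with original power i of \<epsilon> has 2n + 2 + i - 2d
  derivatives. From d \<ge> i + 1 and i \<ge> 2 this is at most 2n - 2.\<close>

lemma P_odd_reduced:
  "\<exists>q. P_odd n \<simeq> q \<and> order_le q (int n - 1) \<and> (\<forall>m\<in>Poly_Mapping.keys q. 2 \<le> mon_degree m)"
proof (rule reduce_order, rule ballI)
  fix m assume "m \<in> Poly_Mapping.keys (P_odd n)"
  then have "m \<in> Poly_Mapping.keys (eps_shift (fps_nth be (2 * n)))"
    unfolding P_odd_def by (rule subsetD[OF keys_cst_mult])
  with graded_be[of "2 * n"] obtain i where i: "even i" "2 \<le> i"
    "int (mon_weight m) + 2 * int (mon_degree m) = int i + (2 + int (2 * n))" "int i + 1 \<le> int (mon_degree m)"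
    by (rule keys_eps_shift)
  then have "mon_weight m + 2 * mon_degree m = i + 2 + 2 * n" by linarith
  then have "even (mon_weight m + 2 * mon_degree m)" using i(1) by simp
  then show "even (mon_weight m) \<and> int (mon_weight m) \<le> 2 * (int n - 1) \<and> 2 \<le> mon_degree m"
    using i by simp
qed

text \<open>The same count holds with d \<ge> i only, so up to 2n derivatives are possible, and
  exactly 2n only for i = d = 2. Splitting off degree 2 therefore leaves at most 2n - 2.\<close>

lemma P_even_reduced:
  "\<exists>q. P_even n \<simeq> cst [:1/4:] * (W WPlus n - W WMinus n)\<^sup>2 + q \<and> order_le q (int n - 1) \<and>
     (\<forall>m\<in>Poly_Mapping.keys q. 2 \<le> mon_degree m)"
proof -
  define p where "p = eps_shift (fps_nth al (2 * n + 1))"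
  define p2 where "p2 = hom_part 2 p"
  have "\<exists>q. cst (alternating n) * (p - p2) \<simeq> q \<and> order_le q (int n - 1) \<and> (\<forall>m\<in>Poly_Mapping.keys q. 2 \<le> mon_degree m)"
  proof (rule reduce_order, rule ballI)
    fix m assume "m \<in> Poly_Mapping.keys (cst (alternating n) * (p - p2))"
    then have "m \<in> Poly_Mapping.keys (p - p2)"
      by (rule subsetD[OF keys_cst_mult])
    then have m2: "mon_degree m \<noteq> 2" and "m \<in> Poly_Mapping.keys p"
      by (auto simp: p2_def in_keys_iff lookup_minus split: if_splits)
    with graded_al[of "2 * n + 1"] obtain i where i: "even i" "2 \<le> i"
      "int (mon_weight m) + 2 * int (mon_degree m) = int i + (1 + int (2 * n + 1))" "int i + 0 \<le> int (mon_degree m)"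
      unfolding p_def by (elim keys_eps_shift)
    then have eq: "mon_weight m + 2 * mon_degree m = i + 2 + 2 * n" by linarith
    then have "even (mon_weight m + 2 * mon_degree m)" using i(1) by simp
    moreover have "mon_weight m + 2 \<le> 2 * n"
    proof (cases "i = 2")
      case True
      then show ?thesis using eq i m2 by linarith
    next
      case False
      then have "4 \<le> i" using i(1,2) by presburger
      then show ?thesis using eq i(4) by linarith
    qed
    ultimately show "even (mon_weight m) \<and> int (mon_weight m) \<le> 2 * (int n - 1) \<and> 2 \<le> mon_degree m"
      using i by simp
  qed
  then obtain q where q: "cst (alternating n) * (p - p2) \<simeq> q" "order_le q (int n - 1)"
    "\<forall>m\<in>Poly_Mapping.keys q. 2 \<le> mon_degree m" by blast
  have "P_even n = cst (alternating n) * p2 + cst (alternating n) * (p - p2)"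
    by (simp add: P_even_def p_def algebra_simps)
  also have "\<dots> \<simeq> cst (alternating n) * (cst [:- (1 / 8) * (-1) ^ n:] * (W WPlus n - W WMinus n)\<^sup>2) + q"
    unfolding p2_def p_def by (intro same_integral_add same_integral_cst quadratic_part q(1)[unfolded p2_def p_def])
  also have "cst (alternating n) * (cst [:- (1 / 8) * (-1) ^ n:] * (W WPlus n - W WMinus n)\<^sup>2) =
      cst [:1/4:] * (W WPlus n - W WMinus n)\<^sup>2"
  proof -
    have "alternating n * [:- (1 / 8) * (-1) ^ n:] = [:1/4:]" by (cases "even n") simp_all
    then show ?thesis by (simp only: mult.assoc[symmetric] cst_mult[symmetric])
  qed
  finally show ?thesis using q(2,3) by blast
qed

text \<open>At n = 0 the count of derivatives would be negative, so no monomial survives.\<close>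

lemma P_odd_0: "P_odd 0 = 0"
proof -
  have "eps_shift (fps_nth be 0) = 0"
  proof (rule ccontr)
    assume "eps_shift (fps_nth be 0) \<noteq> 0"
    then obtain m where "m \<in> Poly_Mapping.keys (eps_shift (fps_nth be 0))"
      by (metis keys_eq_empty equals0I)
    with graded_be[of 0] obtain i where "int (mon_weight m) + 2 * int (mon_degree m) = int i + (2 + int 0)"
      "int i + 1 \<le> int (mon_degree m)" "2 \<le> i"
      by (elim keys_eps_shift)
    then show False by linarith
  qed
  then show ?thesis by (simp add: P_odd_def)
qed

text \<open>The KdV limits determine the sum and the difference of the \<epsilon>-free parts
  \<open>a0\<close> and \<open>b0\<close> modulo total derivatives; solving for the two separately
  gives both expansions.\<close>

lemma hamiltonian_expansion:
  fixes n :: nat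
  assumes eps: "\<epsilon> > 0"
  defines "c \<equiv> complex_of_real ((sqrt 2 * \<epsilon>) ^ (2 * n + 1))"
    and "E_plus \<equiv> energy_KdV (int n - 1) Wp" and "E_minus \<equiv> energy_KdV (int n - 1) (- Wm)"
  shows "ham_GPt \<epsilon> (2 * int n) \<simeq>
      cst (c / 2) * (E_minus + E_plus + cst (complex_of_real (\<epsilon>\<^sup>2)) * eval_eps \<epsilon> (P_even n))"
    and "ham_GPt \<epsilon> (2 * int n - 1) \<simeq>
      cst (c / 4) * (E_minus - E_plus + cst (complex_of_real (\<epsilon>\<^sup>2)) * eval_eps \<epsilon> (P_odd n))"
proof -
  define s :: complex where "s = - ((-1) ^ n)"
  define a b a0 b0 a1 b1 where "a = eval_eps \<epsilon> (fps_nth al (2 * n + 1))" and "b = eval_eps \<epsilon> (fps_nth be (2 * n))"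
    and "a0 = eval_eps 0 (fps_nth al (2 * n + 1))" and "b0 = eval_eps 0 (fps_nth be (2 * n))"
    and "a1 = eval_eps \<epsilon> (eps_shift (fps_nth al (2 * n + 1)))" and "b1 = eval_eps \<epsilon> (eps_shift (fps_nth be (2 * n)))"
  define e where "e = cst (complex_of_real (\<epsilon>\<^sup>2))"
  have a: "a = a0 + e * a1" and b: "b = b0 + e * b1"
    unfolding a_def b_def a0_def b0_def a1_def b1_def e_def
    by (rule eval_eps_shift, rule graded_al graded_be)+
  have alt: "complex_of_real (poly (alternating n) \<epsilon>) = 2 * s"
    by (simp add: s_def)
  have P: "eval_eps \<epsilon> (P_even n) = cst (2 * s) * a1" "eval_eps \<epsilon> (P_odd n) = cst (2 * s) * b1"
    unfolding P_even_def P_odd_def eval_eps.dmap_mult eval_eps.dmap_cst alt a1_def b1_def by simp_all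
  have Ep: "E_plus \<simeq> cst s * (a0 - b0)"
    unfolding E_plus_def energy_KdV_eq s_def a0_def b0_def
    by (intro same_integral_cst same_integral_sym[OF limit_plus])
  have Em: "E_minus = cst s * (a0 + b0)"
    unfolding E_minus_def energy_KdV_eq s_def a0_def b0_def limit_minus ..
  have two: "cst (2 * s) = cst s + cst s" by (simp only: cst_add[symmetric] mult_2)
  have "cst (2 * s) * a0 = cst s * (a0 + b0) + cst s * (a0 - b0)" unfolding two by (simp add: algebra_simps)
  also have "\<dots> \<simeq> E_minus + E_plus"
    unfolding Em by (intro same_integral_add same_integral_refl same_integral_sym[OF Ep])
  finally have a0: "cst (2 * s) * a0 \<simeq> E_minus + E_plus" .
  have "cst (2 * s) * b0 = cst s * (a0 + b0) - cst s * (a0 - b0)" unfolding two by (simp add: algebra_simps)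
  also have "\<dots> \<simeq> E_minus - E_plus"
    unfolding Em by (intro same_integral_diff same_integral_refl same_integral_sym[OF Ep])
  finally have b0: "cst (2 * s) * b0 \<simeq> E_minus - E_plus" .
  have "ham_GPt \<epsilon> (2 * int n) \<simeq> cst (c * s) * a"
    using ham_GPt_even[OF eps, of n] unfolding c_def s_def a_def .
  also have "\<dots> = cst (c / 2 * (2 * s)) * a" by simp
  also have "\<dots> = cst (c / 2) * (cst (2 * s) * a0 + e * (cst (2 * s) * a1))"
    unfolding a cst_mult[of "c / 2"] by (simp only: algebra_simps)
  also have "\<dots> \<simeq> cst (c / 2) * (E_minus + E_plus + e * eval_eps \<epsilon> (P_even n))"
    unfolding P by (intro same_integral_cst same_integral_add a0 same_integral_refl)
  finally show "ham_GPt \<epsilon> (2 * int n) \<simeq>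
      cst (c / 2) * (E_minus + E_plus + cst (complex_of_real (\<epsilon>\<^sup>2)) * eval_eps \<epsilon> (P_even n))"
    unfolding e_def .
  have "ham_GPt \<epsilon> (2 * int n - 1) = cst (1 / 2) * (2 * ham_GPt \<epsilon> (2 * int n - 1))"
    by (simp only: mult.assoc[symmetric] cst_numeral[symmetric] cst_mult[symmetric]) simp
  also have "\<dots> \<simeq> cst (1 / 2) * (cst (c * s) * b)"
    using ham_GPt_odd[OF eps, of n] unfolding c_def s_def b_def by (rule same_integral_cst)
  also have "\<dots> = cst (c / 4 * (2 * s)) * b" by (simp add: mult.assoc[symmetric] flip: cst_mult)
  also have "\<dots> = cst (c / 4) * (cst (2 * s) * b0 + e * (cst (2 * s) * b1))"
    unfolding b cst_mult[of "c / 4"] by (simp only: algebra_simps)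
  also have "\<dots> \<simeq> cst (c / 4) * (E_minus - E_plus + e * eval_eps \<epsilon> (P_odd n))"
    unfolding P by (intro same_integral_cst same_integral_add b0 same_integral_refl)
  finally show "ham_GPt \<epsilon> (2 * int n - 1) \<simeq>
      cst (c / 4) * (E_minus - E_plus + cst (complex_of_real (\<epsilon>\<^sup>2)) * eval_eps \<epsilon> (P_odd n))"
    unfolding e_def .
qed

end

theorem theorem1p1:
  shows "\<exists>P :: int \<Rightarrow> real poly dpoly.
    P (-1) = 0 \<and>
    (\<forall>n\<ge>0. order_le (P n) (n div 2)) \<and>
    (\<forall>n\<ge>-1. \<forall>m\<in>Poly_Mapping.keys (P n). 2 \<le> mon_degree m) \<and>
    (\<forall>n::nat. \<forall>\<epsilon>::real. \<epsilon> > 0 \<longrightarrow>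
      (let H_even = ham_GPt \<epsilon> (2 * int n);
           H_odd = ham_GPt \<epsilon> (2 * int n - 1);
           P_even = eval_eps \<epsilon> (P (2 * int n));
           P_odd = eval_eps \<epsilon> (P (2 * int n - 1));
           E_plus = energy_KdV (int n - 1) Wp;
           E_minus = energy_KdV (int n - 1) (- Wm);
           c = complex_of_real ((sqrt 2 * \<epsilon>) ^ (2 * n + 1))
       in H_even - 2 * H_odd
            \<simeq> cst c * (E_plus + cst (complex_of_real (\<epsilon>\<^sup>2 / 2)) * (P_even - P_odd)) \<and>
          H_even + 2 * H_odd
            \<simeq> cst c * (E_minus + cst (complex_of_real (\<epsilon>\<^sup>2 / 2)) * (P_even + P_odd)) \<and>
          H_even
            \<simeq> cst (c / 2) * (E_minus + E_plus + cst (complex_of_real (\<epsilon>\<^sup>2)) * P_even) \<and>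
          H_odd
            \<simeq> cst (c / 4) * (E_minus - E_plus + cst (complex_of_real (\<epsilon>\<^sup>2)) * P_odd))) \<and>
    (\<forall>n::nat. \<exists>Q :: real poly dpoly.
      order_le Q (int n - 1) \<and>
      (\<forall>\<epsilon>::real. \<epsilon> > 0 \<longrightarrow>
        eval_eps \<epsilon> (P (2 * int n))
          \<simeq> cst (1 / 4) * (W WPlus n - W WMinus n)\<^sup>2 + eval_eps \<epsilon> Q))"
proof -
  obtain al be ga de where "formal_solution al be ga de" using formal_solution_exists by blast
  then interpret formal_solution al be ga de .
  from P_even_reduced have "\<forall>n. \<exists>q. P_even n \<simeq> cst [:1/4:] * (W WPlus n - W WMinus n)\<^sup>2 + q \<and>
      order_le q (int n - 1) \<and> (\<forall>m\<in>Poly_Mapping.keys q. 2 \<le> mon_degree m)" by blast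
  from choice[OF this] obtain Q where
    Q: "\<And>n. P_even n \<simeq> cst [:1/4:] * (W WPlus n - W WMinus n)\<^sup>2 + Q n"
      "\<And>n. order_le (Q n) (int n - 1)" "\<And>n. \<forall>m\<in>Poly_Mapping.keys (Q n). 2 \<le> mon_degree m"
    by blast
  from P_odd_reduced have "\<forall>n. \<exists>q. P_odd n \<simeq> q \<and> order_le q (int n - 1) \<and>
      (\<forall>m\<in>Poly_Mapping.keys q. 2 \<le> mon_degree m)" by blast
  from choice[OF this] obtain R where
    R: "\<And>n. P_odd n \<simeq> R n" "\<And>n. order_le (R n) (int n - 1)"
      "\<And>n. \<forall>m\<in>Poly_Mapping.keys (R n). 2 \<le> mon_degree m"
    by blast
  define S :: "nat \<Rightarrow> real poly dpoly" where "S n = cst [:1/4:] * (W WPlus n - W WMinus n)\<^sup>2" for n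
  \<comment> \<open>These are the representatives of low order; the unreduced polynomials differ
    from them by total derivatives. The value 0 at k = -1 is legitimate because
    \<open>P_odd 0 = 0\<close>.\<close>
  define P :: "int \<Rightarrow> real poly dpoly" where
    "P k = (if k = -1 then 0 else if even k then S (nat (k div 2)) + Q (nat (k div 2)) else R (nat ((k + 1) div 2)))" for k
  have P_even: "P (2 * int n) = S n + Q n" for n
  proof -
    have "2 * int n \<noteq> -1" by presburger
    then show ?thesis by (simp add: P_def)
  qed
  have P_odd: "P (2 * int n - 1) = (if n = 0 then 0 else R n)" for n
    by (simp add: P_def)
  have cases: "(\<exists>n. k = 2 * int n) \<or> (\<exists>n. k = 2 * int n - 1)" if "k \<ge> -1" for k :: int
  proof (cases "even k")
    case True
    then have "k = 2 * int (nat (k div 2))" using that by auto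
    then show ?thesis by blast
  next
    case False
    then have "k = 2 * ((k + 1) div 2) - 1" by presburger
    moreover have "0 \<le> (k + 1) div 2" using that by simp
    ultimately have "k = 2 * int (nat ((k + 1) div 2)) - 1" by simp
    then show ?thesis by blast
  qed
  have S_order: "order_le (S n) (int n)" for n
    unfolding order_le_def S_def using keys_square_jet_diff(2)[of _ "[:1/4:] :: real poly" n] by force
  have S_deg: "\<forall>m\<in>Poly_Mapping.keys (S n). 2 \<le> mon_degree m" for n
    unfolding S_def using keys_square_jet_diff(1)[of _ "[:1/4:] :: real poly" n] by simp
  have PS: "P_even n \<simeq> P (2 * int n)" and PR: "P_odd n \<simeq> P (2 * int n - 1)" for n
    using Q(1)[of n] R(1)[of n] P_odd_0 by (auto simp: P_even P_odd S_def)
  have ord: "order_le (P k) (k div 2)" if "k \<ge> 0" for k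
  proof -
    from cases[of k] that consider n where "k = 2 * int n" | n where "k = 2 * int n - 1" by fastforce
    then show ?thesis
    proof cases
      case 1
      then show ?thesis
        using order_le_add[OF S_order order_le_mono[OF Q(2)[of n], of "int n"]] by (simp add: P_even)
    next
      case 2
      moreover have "(2 * int n - 1) div 2 = int n - 1" by presburger
      ultimately show ?thesis using R(2)[of n] that by (simp add: P_odd)
    qed
  qed
  have deg: "2 \<le> mon_degree m" if "k \<ge> -1" "m \<in> Poly_Mapping.keys (P k)" for k m
  proof -
    from cases[OF that(1)] consider n where "k = 2 * int n" | n where "k = 2 * int n - 1" by blast
    then show ?thesis
    proof cases
      case 1
      then have "m \<in> Poly_Mapping.keys (S n) \<union> Poly_Mapping.keys (Q n)"
        using that(2) unfolding 1 P_even by (intro subsetD[OF keys_add])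
      then show ?thesis using S_deg Q(3) by blast
    next
      case 2
      then show ?thesis using that(2) R(3)[of n] by (simp add: P_odd split: if_splits)
    qed
  qed
  show ?thesis
  proof (intro exI[of _ P] conjI allI impI ballI)
    show "P (-1) = 0" by (simp add: P_def)
  next
    fix n :: nat and \<epsilon> :: real
    assume eps: "\<epsilon> > 0"
    define c where "c = complex_of_real ((sqrt 2 * \<epsilon>) ^ (2 * n + 1))"
    define Ep Em where "Ep = energy_KdV (int n - 1) Wp" and "Em = energy_KdV (int n - 1) (- Wm)"
    define Pe Po where "Pe = eval_eps \<epsilon> (P (2 * int n))" and "Po = eval_eps \<epsilon> (P (2 * int n - 1))"
    define He Ho where "He = ham_GPt \<epsilon> (2 * int n)" and "Ho = ham_GPt \<epsilon> (2 * int n - 1)"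
    define e where "e = complex_of_real (\<epsilon>\<^sup>2)"
    have "He \<simeq> cst (c / 2) * (Em + Ep + cst e * eval_eps \<epsilon> (P_even n))"
      unfolding He_def c_def Em_def Ep_def e_def by (rule hamiltonian_expansion[OF eps])
    also have "\<dots> \<simeq> cst (c / 2) * (Em + Ep + cst e * Pe)"
      unfolding Pe_def
      by (intro same_integral_cst same_integral_add same_integral_refl eval_eps.dmap_same_integral PS)
    finally have He: "He \<simeq> cst (c / 2) * (Em + Ep + cst e * Pe)" .
    have "Ho \<simeq> cst (c / 4) * (Em - Ep + cst e * eval_eps \<epsilon> (P_odd n))"
      unfolding Ho_def c_def Em_def Ep_def e_def by (rule hamiltonian_expansion[OF eps])
    also have "\<dots> \<simeq> cst (c / 4) * (Em - Ep + cst e * Po)"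
      unfolding Po_def
      by (intro same_integral_cst same_integral_add same_integral_refl eval_eps.dmap_same_integral PR)
    finally have Ho: "Ho \<simeq> cst (c / 4) * (Em - Ep + cst e * Po)" .
    have "2 * Ho \<simeq> 2 * (cst (c / 4) * (Em - Ep + cst e * Po))"
      using same_integral_cst[OF Ho, of 2] by simp
    also have "\<dots> = cst (c / 2) * (Em - Ep + cst e * Po)"
      by (simp only: mult.assoc[symmetric] cst_numeral[symmetric] cst_mult[symmetric]) simp
    finally have Ho2: "2 * Ho \<simeq> cst (c / 2) * (Em - Ep + cst e * Po)" .
    have c: "cst c = cst (c / 2) + cst (c / 2)" and e: "cst e = cst (e / 2) + cst (e / 2)"
      by (simp_all flip: cst_add)
    have "He - 2 * Ho \<simeq> cst (c / 2) * (Em + Ep + cst e * Pe) - cst (c / 2) * (Em - Ep + cst e * Po)"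
      by (intro same_integral_diff He Ho2)
    also have "\<dots> = cst c * (Ep + cst (e / 2) * (Pe - Po))"
      unfolding c e by (simp add: algebra_simps)
    finally have 1: "He - 2 * Ho \<simeq> cst c * (Ep + cst (e / 2) * (Pe - Po))" .
    have "He + 2 * Ho \<simeq> cst (c / 2) * (Em + Ep + cst e * Pe) + cst (c / 2) * (Em - Ep + cst e * Po)"
      by (intro same_integral_add He Ho2)
    also have "\<dots> = cst c * (Em + cst (e / 2) * (Pe + Po))"
      unfolding c e by (simp add: algebra_simps)
    finally have 2: "He + 2 * Ho \<simeq> cst c * (Em + cst (e / 2) * (Pe + Po))" .
    have e2: "complex_of_real (\<epsilon>\<^sup>2 / 2) = e / 2" by (simp add: e_def)
    show "let H_even = ham_GPt \<epsilon> (2 * int n);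
           H_odd = ham_GPt \<epsilon> (2 * int n - 1);
           P_even = eval_eps \<epsilon> (P (2 * int n));
           P_odd = eval_eps \<epsilon> (P (2 * int n - 1));
           E_plus = energy_KdV (int n - 1) Wp;
           E_minus = energy_KdV (int n - 1) (- Wm);
           c = complex_of_real ((sqrt 2 * \<epsilon>) ^ (2 * n + 1))
       in H_even - 2 * H_odd
            \<simeq> cst c * (E_plus + cst (complex_of_real (\<epsilon>\<^sup>2 / 2)) * (P_even - P_odd)) \<and>
          H_even + 2 * H_odd
            \<simeq> cst c * (E_minus + cst (complex_of_real (\<epsilon>\<^sup>2 / 2)) * (P_even + P_odd)) \<and>
          H_even
            \<simeq> cst (c / 2) * (E_minus + E_plus + cst (complex_of_real (\<epsilon>\<^sup>2)) * P_even) \<and>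
          H_odd
            \<simeq> cst (c / 4) * (E_minus - E_plus + cst (complex_of_real (\<epsilon>\<^sup>2)) * P_odd)"
      unfolding Let_def e2 e_def[symmetric] c_def[symmetric] Ep_def[symmetric] Em_def[symmetric]
        Pe_def[symmetric] Po_def[symmetric] He_def[symmetric] Ho_def[symmetric]
      by (intro conjI 1 2 He Ho)
  next
    fix n :: nat
    have "eval_eps \<epsilon> (P (2 * int n)) = cst (1 / 4) * (W WPlus n - W WMinus n)\<^sup>2 + eval_eps \<epsilon> (Q n)" for \<epsilon>
      unfolding P_even S_def power2_eq_square
      by (simp add: eval_eps.dmap_add eval_eps.dmap_mult eval_eps.dmap_diff)
    then show "\<exists>Q :: real poly dpoly. order_le Q (int n - 1) \<and>
      (\<forall>\<epsilon>::real. \<epsilon> > 0 \<longrightarrow> eval_eps \<epsilon> (P (2 * int n))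
          \<simeq> cst (1 / 4) * (W WPlus n - W WMinus n)\<^sup>2 + eval_eps \<epsilon> Q)"
      using Q(2) by (intro exI[of _ "Q n"]) simp
  qed (use ord deg in auto)
qed

end
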